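(* There are infinitely many finite simple groups $G$ with $B(G) < R(G)$.
   Context: A subgroup $H$ of a finite group $G$ is core-free if it contains no nontrivial normal subgroup of $G$. A $k$-tuple $(H_1,\ldots,H_k)$ of core-free subgroups of $G$ (repetitions allowed) is regular if $\bigcap_{i=1}^k H_i^{g_i}=1$ for some $g_1,\ldots,g_k\in G$ (equivalently, $G$ has a regular orbit on $G/H_1\times\cdots\times G/H_k$). The regularity number $R(G)$ is the minimal positive integer $k$ such that every $k$-tuple of core-free subgroups of $G$ is regular. For a core-free subgroup $H$, $b(G,H)$ is the base size of $G$ acting on $G/H$, i.e. the minimal number of conjugates of $H$ in $G$ with trivial intersection. The base number $B(G)$ is the minimal positive integer $k$ such that $b(G,H)\leqslant k$ for every core-free subgroup $H$ of $G$. *)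

theory Defs
  imports "HOL-Algebra.Algebra"
begin

definition core_free :: "('a, 'b) monoid_scheme \<Rightarrow> 'a set \<Rightarrow> bool" where
  "core_free G H \<longleftrightarrow> subgroup H G \<and> (\<forall>N. N \<lhd> G \<and> N \<subseteq> H \<longrightarrow> N = {\<one>\<^bsub>G\<^esub>})"

definition conjugate :: "('a, 'b) monoid_scheme \<Rightarrow> 'a set \<Rightarrow> 'a \<Rightarrow> 'a set" where
  "conjugate G H g = inv\<^bsub>G\<^esub> g <#\<^bsub>G\<^esub> H #>\<^bsub>G\<^esub> g"

text \<open>
  A \<open>k\<close>-tuple is a function on \<open>nat\<close> of which only the values at \<open>0, \<dots>, k - 1\<close> matter.
  The intersection is taken inside \<open>carrier G\<close>, so that for \<open>k = 0\<close> it is \<open>G\<close> itself.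
\<close>

definition conj_inter ::
  "('a, 'b) monoid_scheme \<Rightarrow> nat \<Rightarrow> (nat \<Rightarrow> 'a set) \<Rightarrow> (nat \<Rightarrow> 'a) \<Rightarrow> 'a set" where
  "conj_inter G k H g = carrier G \<inter> (\<Inter>i<k. conjugate G (H i) (g i))"

definition regular_tuple :: "('a, 'b) monoid_scheme \<Rightarrow> nat \<Rightarrow> (nat \<Rightarrow> 'a set) \<Rightarrow> bool" where
  "regular_tuple G k H \<longleftrightarrow>
     (\<exists>g. (\<forall>i<k. g i \<in> carrier G) \<and> conj_inter G k H g = {\<one>\<^bsub>G\<^esub>})"

definition regularity_number :: "('a, 'b) monoid_scheme \<Rightarrow> nat" where
  "regularity_number G =
     (LEAST k. 0 < k \<and> (\<forall>H. (\<forall>i<k. core_free G (H i)) \<longrightarrow> regular_tuple G k H))"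

definition base_size :: "('a, 'b) monoid_scheme \<Rightarrow> 'a set \<Rightarrow> nat" where
  "base_size G H = (LEAST k. regular_tuple G k (\<lambda>_. H))"

definition base_number :: "('a, 'b) monoid_scheme \<Rightarrow> nat" where
  "base_number G = (LEAST k. 0 < k \<and> (\<forall>H. core_free G H \<longrightarrow> base_size G H \<le> k))"

text \<open>
  For a finite group \<open>G\<close> the three minima above are attained, because every tuple of
  \<open>order G\<close> core-free subgroups is regular: as long as the intersection of the conjugates
  chosen so far is nontrivial, a suitable conjugate of the next subgroup makes it smaller.
\<close>

lemma (in group) mult_inv_cancel:
  assumes "x \<in> carrier G" "y \<in> carrier G"
  shows "x \<otimes> (inv x \<otimes> y) = y" "inv x \<otimes> (x \<otimes> y) = y"
  using assms by (simp_all add: m_assoc [symmetric])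

lemma (in group) mem_conjugate_iff:
  assumes "subgroup H G" "g \<in> carrier G" "x \<in> carrier G"
  shows "x \<in> conjugate G H g \<longleftrightarrow> g \<otimes> x \<otimes> inv g \<in> H"
proof
  assume "x \<in> conjugate G H g"
  then obtain h where h: "h \<in> H" "x = inv g \<otimes> h \<otimes> g"
    unfolding conjugate_def l_coset_def r_coset_def by auto
  have "h \<in> carrier G"
    using subgroup.mem_carrier[OF assms(1) h(1)] .
  with assms(2) have "g \<otimes> x \<otimes> inv g = h"
    unfolding h(2) by (simp add: m_assoc mult_inv_cancel)
  with h show "g \<otimes> x \<otimes> inv g \<in> H" by simp
next
  assume *: "g \<otimes> x \<otimes> inv g \<in> H"
  have "x = inv g \<otimes> (g \<otimes> x \<otimes> inv g) \<otimes> g"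
    using assms by (simp add: m_assoc mult_inv_cancel)
  with * show "x \<in> conjugate G H g"
    unfolding conjugate_def l_coset_def r_coset_def by blast
qed

lemma (in group) core_free_inter_conjugates:
  assumes "core_free G H" "x \<in> carrier G" "\<And>g. g \<in> carrier G \<Longrightarrow> x \<in> conjugate G H g"
  shows "x = \<one>"
proof -
  have H: "subgroup H G"
    using assms(1) unfolding core_free_def by blast
  define N where "N = {y \<in> carrier G. \<forall>g\<in>carrier G. g \<otimes> y \<otimes> inv g \<in> H}"
  have "subgroup N G"
  proof (rule subgroupI)
    show "N \<noteq> {}"
      using subgroup.one_closed[OF H] unfolding N_def by (auto intro!: exI[of _ \<one>])
    show "inv a \<in> N" if "a \<in> N" for a
    proof -
      have "g \<otimes> inv a \<otimes> inv g \<in> H" if g: "g \<in> carrier G" for g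
      proof -
        have "g \<otimes> inv a \<otimes> inv g = inv (g \<otimes> a \<otimes> inv g)"
          using g \<open>a \<in> N\<close> unfolding N_def by (simp add: inv_mult_group m_assoc)
        then show ?thesis
          using g \<open>a \<in> N\<close> subgroup.m_inv_closed[OF H] unfolding N_def by simp
      qed
      then show ?thesis using that unfolding N_def by simp
    qed
    show "a \<otimes> b \<in> N" if "a \<in> N" "b \<in> N" for a b
    proof -
      have "g \<otimes> (a \<otimes> b) \<otimes> inv g \<in> H" if g: "g \<in> carrier G" for g
      proof -
        have "g \<otimes> (a \<otimes> b) \<otimes> inv g = (g \<otimes> a \<otimes> inv g) \<otimes> (g \<otimes> b \<otimes> inv g)"
          using g \<open>a \<in> N\<close> \<open>b \<in> N\<close> unfolding N_def by (simp add: m_assoc mult_inv_cancel)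
        then show ?thesis
          using g \<open>a \<in> N\<close> \<open>b \<in> N\<close> subgroup.m_closed[OF H] unfolding N_def by simp
      qed
      then show ?thesis using that unfolding N_def by simp
    qed
  qed (auto simp: N_def)
  moreover have "z \<otimes> y \<otimes> inv z \<in> N" if "z \<in> carrier G" "y \<in> N" for z y
  proof -
    have "g \<otimes> (z \<otimes> y \<otimes> inv z) \<otimes> inv g \<in> H" if g: "g \<in> carrier G" for g
    proof -
      have "g \<otimes> (z \<otimes> y \<otimes> inv z) \<otimes> inv g = (g \<otimes> z) \<otimes> y \<otimes> inv (g \<otimes> z)"
        using g \<open>z \<in> carrier G\<close> \<open>y \<in> N\<close> unfolding N_def by (simp add: inv_mult_group m_assoc)
      then show ?thesis
        using g \<open>z \<in> carrier G\<close> \<open>y \<in> N\<close> unfolding N_def by simp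
    qed
    then show ?thesis using that unfolding N_def by simp
  qed
  ultimately have "N \<lhd> G"
    using normal_inv_iff by blast
  moreover have "N \<subseteq> H"
    unfolding N_def by (force dest: bspec[of _ _ \<one>])
  ultimately have "N = {\<one>}"
    using assms(1) unfolding core_free_def by blast
  moreover have "x \<in> N"
    using assms(2,3) mem_conjugate_iff[OF H] unfolding N_def by blast
  ultimately show ?thesis by blast
qed

lemma (in group) regular_tuple_order:
  assumes fin: "finite (carrier G)" and cf: "\<And>i. i < order G \<Longrightarrow> core_free G (H i)"
  shows "regular_tuple G (order G) H"
proof -
  have one: "\<one> \<in> conj_inter G k H g" if "k \<le> order G" and *: "\<And>i. i < k \<Longrightarrow> g i \<in> carrier G" for k g
  proof -
    have "\<one> \<in> conjugate G (H i) (g i)" if "i < k" for i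
    proof -
      have "subgroup (H i) G" "g i \<in> carrier G"
        using that *[of i] cf[of i] \<open>k \<le> order G\<close> unfolding core_free_def by simp_all
      then show ?thesis
        using mem_conjugate_iff[of "H i" "g i" \<one>] subgroup.one_closed by simp
    qed
    then show ?thesis unfolding conj_inter_def by auto
  qed
  have "\<exists>g. (\<forall>i<k. g i \<in> carrier G) \<and>
      (conj_inter G k H g = {\<one>} \<or> card (conj_inter G k H g) + k \<le> order G)"
    if "k \<le> order G" for k
    using that
  proof (induction k)
    case 0
    then show ?case by (auto simp: conj_inter_def order_def)
  next
    case (Suc k)
    then obtain g where g: "\<And>i. i < k \<Longrightarrow> g i \<in> carrier G"
      and D: "conj_inter G k H g = {\<one>} \<or> card (conj_inter G k H g) + k \<le> order G"
      by auto
    let ?D = "conj_inter G k H g"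
    have finD: "finite ?D"
      using fin unfolding conj_inter_def by blast
    have step: "conj_inter G (Suc k) H (g(k := a)) = ?D \<inter> conjugate G (H k) a" for a
      unfolding conj_inter_def by (auto simp: lessThan_Suc)
    show ?case
    proof (cases "?D = {\<one>}")
      case True
      let ?g = "g(k := \<one>)"
      have g': "?g i \<in> carrier G" if "i < Suc k" for i
        using g that by (auto simp: less_Suc_eq)
      have "conj_inter G (Suc k) H ?g = {\<one>}"
        using step[of \<one>] one[OF Suc.prems, of ?g] g' True by auto
      with g' show ?thesis by blast
    next
      case False
      then obtain x where x: "x \<in> ?D" "x \<noteq> \<one>"
        using one[of k g] g Suc.prems by auto
      then have "x \<in> carrier G" unfolding conj_inter_def by blast
      then obtain a where a: "a \<in> carrier G" "x \<notin> conjugate G (H k) a"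
        using core_free_inter_conjugates[of "H k" x] cf[of k] Suc.prems x by auto
      let ?g = "g(k := a)"
      have "conj_inter G (Suc k) H ?g \<subset> ?D"
        using step[of a] a x by blast
      then have "card (conj_inter G (Suc k) H ?g) < card ?D"
        using finD psubset_card_mono by blast
      then have "card (conj_inter G (Suc k) H ?g) + Suc k \<le> order G"
        using D False by linarith
      moreover have "\<forall>i<Suc k. ?g i \<in> carrier G"
        using g a by (auto simp: less_Suc_eq)
      ultimately show ?thesis by blast
    qed
  qed
  from this[OF order_refl] obtain g where g: "\<And>i. i < order G \<Longrightarrow> g i \<in> carrier G"
    and D: "conj_inter G (order G) H g = {\<one>} \<or>
      card (conj_inter G (order G) H g) + order G \<le> order G"
    by auto
  have "finite (conj_inter G (order G) H g)"
    using fin unfolding conj_inter_def by blast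
  then have "card (conj_inter G (order G) H g) \<noteq> 0"
    using one[of "order G" g] g by auto
  with D g show ?thesis unfolding regular_tuple_def by auto
qed

lemma (in group) regularity_number_attained:
  assumes "finite (carrier G)"
  shows "0 < regularity_number G" (is ?pos)
    and "(\<forall>i<regularity_number G. core_free G (H i)) \<Longrightarrow>
      regular_tuple G (regularity_number G) H"
proof -
  let ?P = "\<lambda>k. 0 < k \<and> (\<forall>H. (\<forall>i<k. core_free G (H i)) \<longrightarrow> regular_tuple G k H)"
  have "?P (order G)"
    using assms regular_tuple_order order_gt_0_iff_finite by blast
  then have "?P (regularity_number G)"
    unfolding regularity_number_def by (rule LeastI)
  then show ?pos and "(\<forall>i<regularity_number G. core_free G (H i)) \<Longrightarrow>
      regular_tuple G (regularity_number G) H"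
    by blast+
qed

lemma (in group) base_size_attained:
  assumes "finite (carrier G)" "core_free G H"
  shows "regular_tuple G (base_size G H) (\<lambda>_. H)" "base_size G H \<le> order G"
  using regular_tuple_order[OF assms(1), of "\<lambda>_. H"] assms(2)
  unfolding base_size_def by (auto intro: LeastI Least_le)

lemma (in group) base_number_attained:
  assumes "finite (carrier G)"
  shows "0 < base_number G" and "core_free G H \<Longrightarrow> base_size G H \<le> base_number G"
proof -
  let ?P = "\<lambda>k. 0 < k \<and> (\<forall>H. core_free G H \<longrightarrow> base_size G H \<le> k)"
  have "?P (order G)"
    using assms base_size_attained(2) order_gt_0_iff_finite by blast
  then have "?P (base_number G)"
    unfolding base_number_def by (rule LeastI)
  then show "0 < base_number G" and "core_free G H \<Longrightarrow> base_size G H \<le> base_number G"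
    by blast+
qed

end

theory Submission
  imports Defs "HOL-Analysis.Determinants" "HOL-Number_Theory.Number_Theory"
begin

text \<open>
  For a prime \<open>p\<close> with \<open>p mod 3 = 2\<close> the group \<open>G = SL\<^sub>3(p)\<close> has no scalars and equals \<open>PSL\<^sub>3(p)\<close>.
  Two points and two lines of the projective plane are always fixed by a nontrivial transvection
  or homology, so the stabilizers of a point (twice) and of a line (twice) form a nonregular
  4-tuple and \<open>R(G) > 4\<close>. On the other hand \<open>B(G) \<le> 4\<close>. A subgroup fixing a point or a line is
  handled by a frame. An irreducible proper subgroup \<open>H\<close> contains no transvection, because a
  transvection of an irreducible subgroup generates \<open>SL\<^sub>2(p)\<close> with one of its conjugates, and then
  all of \<open>G\<close>. Hence the stabilizer in \<open>H\<close> of a vector embeds into \<open>SL\<^sub>2(p)\<close>, and Dickson's class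
  equation bounds it by \<open>4p\<close>, so \<open>|H| \<le> 4p\<^sup>4\<close>. Finally the sum over \<open>x \<noteq> 1\<close> in \<open>H\<close> of the cubes of the
  probabilities that a random conjugate of \<open>x\<close> lies in \<open>H\<close> is less than 1, so four suitable
  conjugates of \<open>H\<close> intersect trivially.
\<close>

text \<open>The exponent three comes from taking \<open>H\<close> itself as the first of the four
  conjugates. An element with a cyclic vector has a centralizer of order about p^2; since
  \<open>card H\<close> is at most about p^4 and \<open>order SL\<close> about p^8, a random
  conjugate lies in \<open>H\<close> with probability about p^-2, and p^4 cubes of this sum to p^-2.
  A bound of p^5 on \<open>H\<close> would already be too weak. An element
  \<open>mat c + outer u f\<close> has a centralizer of order about p^4, for which this estimate
  says nothing. Its conjugates keep this shape and the same \<open>c\<close>, and \<open>H\<close>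
  has only about p^2 such elements for each \<open>c\<close>, so they are counted apart.

  Besides removing scalars, the congruence on \<open>p\<close> controls unipotent elements of vector
  stabilizers, where Dickson's count could otherwise fail. The bound 200 covers the constants: it
  gives \<open>1024 + 16384 * p < p ^ 3\<close> for the final sum and 120 < 4 p for the exceptional
  groups in Dickson's count.

  The theorem asks for infinitely many groups over one type. Hence the matrices have entries in
  ideals of one fixed ring, and the groups are copied to \<open>nat\<close> at the end.\<close>

hide_const (open) Divisibility.prime

section \<open>Prime fields as ideals\<close>

text \<open>
  Types cannot depend on the prime \<open>p\<close>. The field with \<open>p\<close> elements is
    therefore the ideal generated
  by an idempotent \<open>e\<close> of a commutative ring; its unit is \<open>e\<close>,
    not \<open>1\<close>.
\<close>

locale prime_ideal =
  fixes e :: "'a::comm_ring_1" and p :: nat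
  assumes idem: "e * e = e" and nz: "e \<noteq> 0" and char: "of_nat p * e = 0"
    and prime_p: "prime p"
begin

definition F :: "'a set" where "F = range (\<lambda>k::nat. of_nat k * e)"

lemma e_F [simp]: "e \<in> F"
  unfolding F_def by (rule range_eqI[of _ _ 1]) simp

lemma zero_F [simp]: "0 \<in> F"
  unfolding F_def by (rule range_eqI[of _ _ 0]) simp

lemma e_mult [simp]: "x \<in> F \<Longrightarrow> e * x = x" "x \<in> F \<Longrightarrow> x * e = x"
proof -
  show "x \<in> F \<Longrightarrow> x * e = x"
    unfolding F_def using idem by (auto simp: mult.assoc)
  then show "x \<in> F \<Longrightarrow> e * x = x" by (simp add: mult.commute)
qed

lemma e_left [simp]: "e * (e * x) = e * x"
  using idem by (simp add: mult.assoc[symmetric])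

lemma add_F [simp]: "x \<in> F \<Longrightarrow> y \<in> F \<Longrightarrow> x + y \<in> F"
  unfolding F_def by (auto simp: distrib_right[symmetric] of_nat_add[symmetric] simp del:
    of_nat_add)

lemma mult_F [simp]: "x \<in> F \<Longrightarrow> y \<in> F \<Longrightarrow> x * y \<in> F"
proof -
  assume "x \<in> F" "y \<in> F"
  then obtain j k where "x = of_nat j * e" "y = of_nat k * e" unfolding F_def by auto
  then have "x * y = of_nat (j * k) * (e * e)" (is "_ = ?r") by (simp add: ac_simps)
  also have "\<dots> \<in> F" unfolding F_def idem by (rule rangeI)
  finally show ?thesis .
qed

lemma of_nat_mod: "of_nat k * e = of_nat (k mod p) * e"
proof -
  have "of_nat k * e = of_nat (p * (k div p) + k mod p) * e" by simp
  also have "\<dots> = of_nat (k div p) * (of_nat p * e) + of_nat (k mod p) * e"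
    by (simp only: of_nat_add of_nat_mult) (simp add: algebra_simps)
  finally show ?thesis using char by simp
qed

lemma uminus_F [simp]: "x \<in> F \<Longrightarrow> - x \<in> F"
proof -
  assume "x \<in> F"
  then obtain k where x: "x = of_nat (k mod p) * e" unfolding F_def using of_nat_mod by auto
  have "k mod p \<le> p" using prime_p prime_gt_0_nat by (simp add: less_imp_le)
  then have "of_nat (p - k mod p) * e = of_nat p * e - x"
    unfolding x by (simp add: of_nat_diff left_diff_distrib)
  then have "- x = of_nat (p - k mod p) * e" using char by simp
  then show ?thesis unfolding F_def by auto
qed

lemma diff_F [simp]: "x \<in> F \<Longrightarrow> y \<in> F \<Longrightarrow> x - y \<in> F"
  using add_F[of x "- y"] uminus_F[of y] by simp

lemma F_inverse:
  assumes "x \<in> F" "x \<noteq> 0"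
  shows "\<exists>y\<in>F. x * y = e"
proof -
  obtain k where x: "x = of_nat k * e" using assms(1) unfolding F_def by auto
  have "\<not> p dvd k"
    using assms(2) x of_nat_mod[of k] by auto
  then have "coprime k p"
    using prime_p prime_imp_coprime_nat coprime_commute by blast
  then obtain j where "[k * j = 1] (mod p)" using cong_solve_coprime_nat by auto
  then have "of_nat (k * j) * e = of_nat 1 * e"
    using of_nat_mod[of "k * j"] of_nat_mod[of 1] by (simp only: cong_def)
  then have "x * (of_nat j * e) = e"
    unfolding x using idem by (simp add: ac_simps)
  then show ?thesis unfolding F_def by blast
qed

definition finv :: "'a \<Rightarrow> 'a" where "finv x = (SOME y. y \<in> F \<and> x * y = e)"

lemma finv:
  assumes "x \<in> F" "x \<noteq> 0"
  shows "finv x \<in> F" "x * finv x = e" "finv x * x = e"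
  using someI_ex[of "\<lambda>y. y \<in> F \<and> x * y = e"] F_inverse[OF assms]
  unfolding finv_def by (auto simp: mult.commute)

lemma finv_cancel [simp]:
  assumes "x \<in> F" "x \<noteq> 0" "y \<in> F"
  shows "x * (finv x * y) = y" "finv x * (x * y) = y" "y * (x * finv x) = y" "y * (finv x * x) = y"
  using finv[OF assms(1,2)] assms(3) by (simp_all add: mult.assoc[symmetric])

lemma F_no_zero_div:
  assumes "x \<in> F" "y \<in> F" "x * y = 0"
  shows "x = 0 \<or> y = 0"
proof (cases "x = 0")
  case False
  then have "y = finv x * (x * y)" using assms(1,2) finv_cancel(2)[of x y] by simp
  then show ?thesis unfolding assms(3) by simp
qed auto

lemma F_mult_eq_0 [simp]: "x \<in> F \<Longrightarrow> y \<in> F \<Longrightarrow> x * y =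
  0 \<longleftrightarrow> x = 0 \<or> y = 0"
  using F_no_zero_div by auto

lemma F_mult_cancel:
  assumes "c \<in> F" "x \<in> F" "y \<in> F" "c \<noteq> 0" "c * x = c * y"
  shows "x = y"
  using F_no_zero_div[of c "x - y"] assms by (simp add: right_diff_distrib)

lemma card_F: "card F = p"
proof -
  have "F = (\<lambda>k::nat. of_nat k * e) ` {..<p}"
    unfolding F_def
  proof (intro equalityI subsetI)
    fix x assume "x \<in> range (\<lambda>k::nat. of_nat k * e)"
    then obtain k where "x = of_nat (k mod p) * e" using of_nat_mod by auto
    then show "x \<in> (\<lambda>k::nat. of_nat k * e) ` {..<p}"
      using prime_gt_0_nat[OF prime_p] by (intro image_eqI[of _ _ "k mod p"]) auto
  qed auto
  moreover have "inj_on (\<lambda>k::nat. of_nat k * e) {..<p}"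
  proof (rule linorder_inj_onI)
    fix j k assume jk: "j < k" "j \<in> {..<p}" "k \<in> {..<p}"
    show "of_nat j * e \<noteq> of_nat k * e"
    proof
      assume "of_nat j * e = of_nat k * e"
      then have *: "of_nat (k - j) * e = 0" using jk by (simp add: of_nat_diff algebra_simps)
      have "\<not> p dvd (k - j)" using jk by (auto dest: dvd_imp_le)
      then have "coprime (k - j) p"
        using prime_p prime_imp_coprime_nat coprime_commute by blast
      then obtain i where i: "[(k - j) * i = 1] (mod p)" using cong_solve_coprime_nat by auto
      have "e = of_nat ((k - j) * i) * e"
        using i of_nat_mod[of "(k - j) * i"] of_nat_mod[of 1] unfolding cong_def
          by (metis mult_1 of_nat_1)
      also have "\<dots> = of_nat i * (of_nat (k - j) * e)" by (simp add: ac_simps)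
      finally show False using * nz by simp
    qed
  qed auto
  ultimately show ?thesis by (metis card_image card_lessThan)
qed

lemma finite_F [simp]: "finite F"
  using card_F prime_gt_0_nat[OF prime_p] card_ge_0_finite by metis

lemma of_nat_F [simp]: "of_nat k * e \<in> F" unfolding F_def by auto

lemma F_cases: assumes "x \<in> F" obtains k :: nat where "x = of_nat k * e"
  using assms unfolding F_def by auto

end

locale prime_ideal_2_mod_3 = prime_ideal +
  assumes p_mod_3: "p mod 3 = 2" and p_large: "p > 200"
begin

text \<open>Fermat gives \<open>a ^ (p - 1) * e = e\<close>, and \<open>p - 1\<close> is 1 modulo 3,
  so the cube condition leaves only \<open>a = e\<close>. The congruence on \<open>p\<close> enters
  the matrix arguments through this fact alone.\<close>

lemma cube_root_one:
  assumes "a \<in> F" "a * a * a = e"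
  shows "a = e"
proof -
  obtain k :: nat where a: "a = of_nat k * e" using assms(1) F_cases by blast
  have pow: "a ^ n * e = of_nat (k ^ n) * e" for n
  proof (induction n)
    case (Suc n)
    have "a ^ Suc n * e = a * (a ^ n * e)" by (simp add: ac_simps)
    also have "\<dots> = of_nat (k ^ Suc n) * (e * e)" unfolding Suc unfolding a
      by (simp add: ac_simps)
    finally show ?case using idem by simp
  qed simp
  have "a \<noteq> 0" using assms(2) nz by auto
  then have "\<not> p dvd k" using a of_nat_mod[of k] by auto
  then have "[k ^ (p - 1) = 1] (mod p)" using fermat_theorem[OF prime_p] by simp
  then have "a ^ (p - 1) * e = e"
    using pow[of "p - 1"] of_nat_mod[of "k ^ (p - 1)"] of_nat_mod[of 1] by (simp add: cong_def)
  moreover have "p - 1 = 3 * (p div 3) + 1" using p_mod_3 by presburger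
  moreover have "a ^ (3 * m) * e = e" for m
  proof (induction m)
    case (Suc m)
    have "a ^ (3 * Suc m) * e = (a * a * a) * (a ^ (3 * m) * e)"
      by (simp add: power_add eval_nat_numeral ac_simps)
    then show ?case using Suc assms(2) idem by simp
  qed simp
  ultimately have "a * (a ^ (3 * (p div 3)) * e) = e" by (simp add: ac_simps)
  with \<open>\<And>m. a ^ (3 * m) * e = e\<close> show ?thesis using assms(1) by simp
qed

lemma two_nz: "e + e \<noteq> 0"
proof
  assume "e + e = 0"
  then have 2: "of_nat 2 * e = 0" by (simp add: algebra_simps)
  have "odd p" using prime_p p_large prime_odd_nat by auto
  then obtain m where "p = 2 * m + 1" by (elim oddE)
  then have "of_nat p * e = of_nat m * (of_nat 2 * e) + e" by (simp add: algebra_simps)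
  then show False using 2 char nz by simp
qed

end

section \<open>Three-dimensional linear algebra\<close>

text \<open>Covectors are stored as vectors: \<open>dot f u\<close> is the value of \<open>f\<close>
  at \<open>u\<close>, and matrices act on covectors by \<open>v*\<close>. A point of the projective
  plane is given by a nonzero vector, a line by a nonzero covector.\<close>

definition dot :: "'a::comm_ring_1^3 \<Rightarrow> 'a^3 \<Rightarrow> 'a" where
  "dot f u = f$1 * u$1 + f$2 * u$2 + f$3 * u$3"

definition outer :: "'a::comm_ring_1^3 \<Rightarrow> 'a^3 \<Rightarrow> 'a^3^3" where
  "outer u f = (\<chi> i j. u$i * f$j)"

definition cross :: "'a::comm_ring_1^3 \<Rightarrow> 'a^3 \<Rightarrow> 'a^3" where
  "cross u v = vector [u$2 * v$3 - u$3 * v$2, u$3 * v$1 - u$1 * v$3, u$1 * v$2 - u$2 * v$1]"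

definition cols :: "'a::comm_ring_1^3 \<Rightarrow> 'a^3 \<Rightarrow> 'a^3 \<Rightarrow> 'a^3^3"
  where
  "cols u v w = (\<chi> i. vector [u$i, v$i, w$i])"

text \<open>The adjugate. It serves as an explicit inverse because the identity matrix here is
  \<open>mat e\<close>, so invertibility with respect to the ring unit \<open>1\<close> is of no
  help.\<close>

definition adj3 :: "'a::comm_ring_1^3^3 \<Rightarrow> 'a^3^3" where
  "adj3 A = vector [
    vector [A$2$2 * A$3$3 - A$2$3 * A$3$2, A$1$3 * A$3$2 - A$1$2 * A$3$3,
      A$1$2 * A$2$3 - A$1$3 * A$2$2],
    vector [A$2$3 * A$3$1 - A$2$1 * A$3$3, A$1$1 * A$3$3 - A$1$3 * A$3$1,
      A$1$3 * A$2$1 - A$1$1 * A$2$3],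
    vector [A$2$1 * A$3$2 - A$2$2 * A$3$1, A$1$2 * A$3$1 - A$1$1 * A$3$2,
      A$1$1 * A$2$2 - A$1$2 * A$2$1]]"

lemmas coords = vec_eq_iff forall_3 sum_3 matrix_matrix_mult_def matrix_vector_mult_def
  vector_matrix_mult_def mat_def det_3 dot_def outer_def cross_def cols_def transpose_def

lemma mul_adj3: "A ** adj3 A = mat (det A)" "adj3 A ** A = mat (det A)"
  by (simp_all add: coords adj3_def algebra_simps)

lemma outer_mul: "A ** outer u f = outer (A *v u) f" "outer u f ** A = outer u (f v* A)"
  "outer u f ** outer w g = outer (dot f w *s u) g"
  by (simp_all add: coords algebra_simps)

lemma outer_mul_vec: "outer u f *v w = dot f w *s u" "g v* outer u f = dot g u *s f"
  by (simp_all add: coords algebra_simps)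

lemma outer_add: "outer (u + v) f = outer u f + outer v f" "outer u (f + g) = outer u f + outer u g"
  "outer (c *s u) f = outer u (c *s f)"
  by (simp_all add: coords algebra_simps)

lemma dot_vec_mul: "dot (f v* A) u = dot f (A *v u)"
  by (simp add: coords algebra_simps)

lemma dot_linear: "dot f (u + v) = dot f u + dot f v" "dot (f + g) u = dot f u + dot g u"
  "dot f (u - v) = dot f u - dot f v" "dot (f - g) u = dot f u - dot g u"
  "dot (c *s f) u = c * dot f u" "dot f (c *s u) = c * dot f u"
  "dot f 0 = 0" "dot 0 u = 0" "dot (- f) u = - dot f u" "dot f (- u) = - dot f u"
  by (simp_all add: coords algebra_simps)

lemma dot_commute: "dot f u = dot u f"
  by (simp add: dot_def mult.commute)

lemma dot_cross: "dot (cross u v) u = 0" "dot (cross u v) v = 0"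
  by (simp_all add: coords algebra_simps)

text \<open>The Binet-Cauchy identity.\<close>

lemma dot_cross_cross: "dot (cross u v) (cross f g) = dot u f * dot v g - dot u g * dot v f"
  by (simp add: coords algebra_simps)

lemma cross_linear: "cross (c *s u) v = c *s cross u v" "cross u (c *s v) = c *s cross u v"
  "cross (u + w) v = cross u v + cross w v" "cross u (v + w) = cross u v + cross u w"
    "cross u u = 0" "cross u 0 = 0"
  by (simp_all add: coords algebra_simps)

lemma det_cols: "det (cols u v w) = dot (cross u v) w"
  by (simp add: coords algebra_simps)

lemma cols_mul: "cols u v w *v x = x$1 *s u + x$2 *s v + x$3 *s w"
  "A ** cols u v w = cols (A *v u) (A *v v) (A *v w)"
  "f v* cols u v w = vector [dot f u, dot f v, dot f w]"
  by (simp_all add: coords algebra_simps)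

text \<open>The matrix determinant lemma for a scalar plus a rank one matrix; it decides which
  transvections and homologies lie in \<open>SL\<close>.\<close>

lemma det_mat_outer: "det (mat s + outer u f) = s * s * s + s * s * dot f u"
  by (simp add: coords algebra_simps)

lemma vec_mul_transpose:
  fixes A :: "'a::comm_ring_1^3^3"
  shows "f v* transpose A = A *v f" "transpose A *v f = f v* A"
  by (simp_all add: vec_eq_iff vector_matrix_mult_def matrix_vector_mult_def transpose_def sum_3
    mult.commute)

context prime_ideal
begin

definition V :: "('a^3) set" where "V = {v. \<forall>i. v$i \<in> F}"
definition Mt :: "('a^3^3) set" where "Mt = {A. \<forall>i j. A$i$j \<in> F}"
definition SL :: "('a^3^3) monoid" where
  "SL = \<lparr>carrier = {A \<in> Mt. det A = e}, monoid.mult = (**), one = mat e\<rparr>"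

lemma V_iff: "v \<in> V \<longleftrightarrow> v$1 \<in> F \<and> v$2 \<in> F \<and> v$3 \<in> F"
  by (simp add: V_def forall_3)

lemma Mt_iff: "A \<in> Mt \<longleftrightarrow> A$1$1 \<in> F \<and> A$1$2 \<in> F \<and>
  A$1$3 \<in> F \<and> A$2$1 \<in> F \<and> A$2$2 \<in> F \<and> A$2$3 \<in> F
    \<and> A$3$1 \<in> F \<and> A$3$2 \<in> F \<and> A$3$3 \<in> F"
  by (auto simp add: Mt_def forall_3)


lemma V_closed [simp]: "u \<in> V \<Longrightarrow> v \<in> V \<Longrightarrow> u + v \<in> V"
  "u \<in> V \<Longrightarrow> v \<in> V \<Longrightarrow> u - v \<in> V"
  "u \<in> V \<Longrightarrow> - u \<in> V" "c \<in> F \<Longrightarrow>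
    u \<in> V \<Longrightarrow> c *s u \<in> V" "0 \<in> V"
  "u \<in> V \<Longrightarrow> v \<in> V \<Longrightarrow> cross u v \<in> V"
    "A \<in> Mt \<Longrightarrow> u \<in> V \<Longrightarrow> A *v u \<in> V"
      "A \<in> Mt \<Longrightarrow> u \<in> V \<Longrightarrow> u v* A \<in> V"
  by (simp_all add: V_iff Mt_iff coords)

lemma vector_V [simp]: "a \<in> F \<Longrightarrow> b \<in> F \<Longrightarrow>
  c \<in> F \<Longrightarrow> vector [a, b, c] \<in> V"
  by (simp add: V_iff)

lemma dot_F [simp]: "u \<in> V \<Longrightarrow> v \<in> V \<Longrightarrow> dot u v \<in> F"
  by (simp add: dot_def V_iff)

lemma Mt_closed [simp]: "A \<in> Mt \<Longrightarrow> B \<in> Mt \<Longrightarrow>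
  A ** B \<in> Mt" "c \<in> F \<Longrightarrow> mat c \<in> Mt"
  "A \<in> Mt \<Longrightarrow> B \<in> Mt \<Longrightarrow> A + B \<in> Mt"
    "A \<in> Mt \<Longrightarrow> B \<in> Mt \<Longrightarrow> A - B \<in> Mt"
  "u \<in> V \<Longrightarrow> v \<in> V \<Longrightarrow> outer u v \<in> Mt"
    "A \<in> Mt \<Longrightarrow> adj3 A \<in> Mt" "A \<in> Mt \<Longrightarrow>
      transpose A \<in> Mt"
  "u \<in> V \<Longrightarrow> v \<in> V \<Longrightarrow> w \<in> V \<Longrightarrow>
    cols u v w \<in> Mt"
  by (simp_all add: Mt_iff V_iff coords adj3_def)

lemma VI: "(\<And>i. v$i \<in> F) \<Longrightarrow> v \<in> V" by (simp add: V_def)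

lemma V_nth [simp]: "v \<in> V \<Longrightarrow> v$i \<in> F" by (simp add: V_def)

lemma Mt_nth [simp]: "A \<in> Mt \<Longrightarrow> A$i$j \<in> F" by (simp add: Mt_def)

lemma mat_e_mul [simp]: "A \<in> Mt \<Longrightarrow> mat e ** A = A"
  "A \<in> Mt \<Longrightarrow> A ** mat e = A"
  "v \<in> V \<Longrightarrow> mat e *v v = v" "v \<in> V \<Longrightarrow> v v* mat e = v"
  by (simp_all add: coords)

lemma e_scale [simp]: "v \<in> V \<Longrightarrow> e *s v = v"
  by (simp add: coords)

lemma carrier_SL: "A \<in> carrier SL \<longleftrightarrow> A \<in> Mt \<and> det A = e"
  and mult_SL [simp]: "A \<otimes>\<^bsub>SL\<^esub> B = A ** B"
    and one_SL [simp]: "\<one>\<^bsub>SL\<^esub> = mat e"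
  by (simp_all add: SL_def)

lemma SL_Mt [simp]: "A \<in> carrier SL \<Longrightarrow> A \<in> Mt" by (simp add: carrier_SL)

lemma det_mat_e [simp]: "det (mat e :: 'a^3^3) = e" using idem by (simp add: coords)

lemma adj3_SL: "A \<in> carrier SL \<Longrightarrow> adj3 A \<in> carrier SL"
proof -
  assume A: "A \<in> carrier SL"
  then have "det (A ** adj3 A) = det (mat e :: 'a^3^3)" by (simp add: mul_adj3 carrier_SL)
  moreover have "det (adj3 A) \<in> F" using A by (simp add: det_3)
  ultimately have "det (adj3 A) = e" using A by (simp add: det_mul carrier_SL)
  then show ?thesis using A by (simp add: carrier_SL)
qed

sublocale SL: group SL
proof (rule groupI)
  fix A B C assume "A \<in> carrier SL" "B \<in> carrier SL"
  then show "A \<otimes>\<^bsub>SL\<^esub> B \<in> carrier SL"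
    by (simp add: carrier_SL det_mul idem)
next
  show "\<one>\<^bsub>SL\<^esub> \<in> carrier SL" by (simp add: carrier_SL)
next
  fix A assume "A \<in> carrier SL"
  then show "\<exists>B\<in>carrier SL. B \<otimes>\<^bsub>SL\<^esub> A = \<one>\<^bsub>SL\<^esub>"
    by (intro bexI[of _ "adj3 A"]) (simp_all add: adj3_SL mul_adj3, simp add: carrier_SL)
qed (auto simp: matrix_mul_assoc)

lemma inv_SL: "A \<in> carrier SL \<Longrightarrow> inv\<^bsub>SL\<^esub> A = adj3 A"
  by (rule SL.inv_equality) (simp_all add: mul_adj3 adj3_SL, simp add: carrier_SL)

abbreviation SL_inv_prefix :: "'a^3^3 \<Rightarrow> 'a^3^3" ("inv'' _" [81] 80) where
  "inv' A \<equiv> inv\<^bsub>SL\<^esub> A"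

lemma SL_closed [simp]: "A \<in> carrier SL \<Longrightarrow>
  B \<in> carrier SL \<Longrightarrow> A ** B \<in> carrier SL" "mat e \<in> carrier SL"
  using SL.m_closed SL.one_closed by simp_all

lemma SL_inv [simp]:
  assumes "A \<in> carrier SL"
  shows "A ** inv' A = mat e" "inv' A ** A = mat e"
    "v \<in> V \<Longrightarrow> A *v (inv' A *v v) = v" "v \<in> V \<Longrightarrow>
      inv' A *v (A *v v) = v"
    "v \<in> V \<Longrightarrow> (v v* inv' A) v* A = v" "v \<in> V \<Longrightarrow>
      (v v* A) v* inv' A = v"
proof -
  show 1: "A ** inv' A = mat e" "inv' A ** A = mat e"
    using assms by (simp_all add: inv_SL mul_adj3 carrier_SL)
  show "v \<in> V \<Longrightarrow> A *v (inv' A *v v) = v" "v \<in> V \<Longrightarrow>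
    inv' A *v (A *v v) = v"
    "v \<in> V \<Longrightarrow> (v v* inv' A) v* A = v" "v \<in> V \<Longrightarrow>
      (v v* A) v* inv' A = v"
    by (simp_all add: matrix_vector_mul_assoc vector_matrix_mul_assoc 1)
qed

lemma SL_vec_0 [simp]: "A \<in> carrier SL \<Longrightarrow> v \<in> V \<Longrightarrow>
  A *v v = 0 \<longleftrightarrow> v = 0"
  by (metis SL_inv(4) matrix_vector_mult_0_right)

lemma SL_covec_0 [simp]: "A \<in> carrier SL \<Longrightarrow> v \<in> V \<Longrightarrow>
  v v* A = 0 \<longleftrightarrow> v = 0"
  by (metis SL_inv(6) vector_matrix_mult_0)

lemma V_scale_0 [simp]: "c \<in> F \<Longrightarrow> v \<in> V \<Longrightarrow> c *s v =
  0 \<longleftrightarrow> c = 0 \<or> v = 0"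
  by (auto simp: coords)

lemma finite_V [simp]: "finite V" and card_V: "card V = p ^ 3"
proof -
  have "bij_betw (\<lambda>(a,b,c). vector [a, b, c] :: 'a^3) (F \<times> F \<times> F) V"
    by (rule bij_betw_byWitness[of _ "\<lambda>v. (v$1, v$2, v$3)"]) (auto simp: coords)
  then show "finite V" "card V = p ^ 3"
    using bij_betw_finite bij_betw_same_card by (fastforce simp: card_cartesian_product card_F
      eval_nat_numeral)+
qed

lemma finite_Mt [simp]: "finite Mt"
proof -
  have "Mt \<subseteq> (\<lambda>(u,v,w). cols u v w) ` (V \<times> V \<times> V)"
  proof
    fix A assume "A \<in> Mt"
    then show "A \<in> (\<lambda>(u,v,w). cols u v w) ` (V \<times> V \<times> V)"
      by (intro image_eqI[of _ _ "(column 1 A, column 2 A,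
        column 3 A)"]) (auto simp: column_def coords intro!: VI)
  qed
  then show ?thesis by (rule finite_subset) auto
qed

lemma finite_SL [simp]: "finite (carrier SL)"
  by (rule finite_subset[OF _ finite_Mt]) auto

abbreviation e1 :: "'a^3" where "e1 \<equiv> vector [e, 0, 0]"
abbreviation e2 :: "'a^3" where "e2 \<equiv> vector [0, e, 0]"
abbreviation e3 :: "'a^3" where "e3 \<equiv> vector [0, 0, e]"

lemma cols_e: "u \<in> V \<Longrightarrow> v \<in> V \<Longrightarrow>
  w \<in> V \<Longrightarrow> cols u v w *v e1 = u"
  "u \<in> V \<Longrightarrow> v \<in> V \<Longrightarrow> w \<in> V \<Longrightarrow>
    cols u v w *v e2 = v"
  "u \<in> V \<Longrightarrow> v \<in> V \<Longrightarrow> w \<in> V \<Longrightarrow>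
    cols u v w *v e3 = w"
  by (simp_all add: cols_mul)

lemma dot_e [simp]: "u \<in> V \<Longrightarrow> dot u e1 = u$1"
  "u \<in> V \<Longrightarrow> dot u e2 = u$2" "u \<in> V \<Longrightarrow> dot u e3 = u$3"
  "u \<in> V \<Longrightarrow> dot e1 u = u$1" "u \<in> V \<Longrightarrow> dot e2 u = u$2"
    "u \<in> V \<Longrightarrow> dot e3 u = u$3"
  by (simp_all add: dot_def)

text \<open>A nonzero coordinate of \<open>u\<close> supplies the factor \<open>k\<close>; the
  vanishing minors show that the same factor works in all coordinates.\<close>

lemma cross_eq_0:
  assumes "u \<in> V" "w \<in> V" "cross u w = 0" "u \<noteq> 0"
  shows "\<exists>k\<in>F. w = k *s u"
proof -
  have eq: "u$2 * w$3 = u$3 * w$2" "u$3 * w$1 = u$1 * w$3" "u$1 * w$2 = u$2 * w$1"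
    using assms(3) by (simp_all add: coords)
  obtain i where i: "u$i \<noteq> 0" using assms(4) by (auto simp: vec_eq_iff)
  have all: "u$i * w$j = u$j * w$i" for j
    using eq exhaust_3[of i] exhaust_3[of j] by (auto simp: mult.commute)
  have "w = (finv (u$i) * w$i) *s u"
  proof (subst vec_eq_iff, intro allI)
    fix j
    have "w$j = finv (u$i) * (u$i * w$j)" using i assms by simp
    then show "w $ j = ((finv (u$i) * w$i) *s u) $ j" unfolding all by (simp add: ac_simps)
  qed
  then show ?thesis using i assms finv(1) by (metis V_nth mult_F)
qed

lemma dot_dual:
  assumes "f \<in> V" "f \<noteq> 0"
  shows "\<exists>w\<in>V. dot f w = e"
proof -
  obtain i where i: "f$i \<noteq> 0" using assms(2) by (auto simp: vec_eq_iff)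
  have "dot f (\<chi> j. if j = i then finv (f$i) else 0) = e"
    using exhaust_3[of i] finv(2)[OF V_nth[OF assms(1)] i] by (auto simp: dot_def)
  moreover have "(\<chi> j. if j = i then finv (f$i) else 0) \<in> V"
    using finv(1)[OF V_nth[OF assms(1)] i] by (intro VI) simp
  ultimately show ?thesis by blast
qed

lemma dot_all_0:
  assumes "f \<in> V" "\<And>w. w \<in> V \<Longrightarrow> dot f w = 0"
  shows "f = 0"
  using dot_dual[of f] assms nz by auto

lemma cols_SL:
  assumes "u \<in> V" "w \<in> V" "z \<in> V" "dot (cross u w) z = e"
  shows "cols u w z \<in> carrier SL"
  using assms by (simp add: carrier_SL det_cols)

text \<open>The determinant is linear in the third column, which can therefore normalize it without
  rescaling \<open>u\<close> or \<open>w\<close>.\<close>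

lemma exists_cols:
  assumes "u \<in> V" "w \<in> V" "cross u w \<noteq> 0"
  shows "\<exists>z\<in>V. dot (cross u w) z = e \<and> cols u w z \<in> carrier SL"
  using dot_dual[of "cross u w"] cols_SL assms by auto

lemma cols_coords:
  assumes "u \<in> V" "w \<in> V" "z \<in> V" "dot (cross u w) z = e" "x \<in> V"
  shows "\<exists>a\<in>F. \<exists>b\<in>F. \<exists>c\<in>F. x = a *s u + b *s w + c *s z"
proof -
  let ?g = "cols u w z"
  have g: "?g \<in> carrier SL" using cols_SL assms by simp
  let ?y = "inv' ?g *v x"
  have "?y \<in> V" using g assms by simp
  moreover have "x = ?y$1 *s u + ?y$2 *s w + ?y$3 *s z"
    using SL_inv(3)[OF g assms(5)] by (simp only: cols_mul)
  ultimately show ?thesis using V_nth by metis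
qed

lemma exists_indep:
  assumes "u \<in> V" "u \<noteq> 0"
  shows "\<exists>w\<in>V. cross u w \<noteq> 0"
proof -
  have "cross u e1 \<noteq> 0 \<or> cross u e2 \<noteq> 0 \<or> cross u e3 \<noteq> 0"
    using assms by (auto simp: coords)
  moreover have "e1 \<in> V" "e2 \<in> V" "e3 \<in> V" by simp_all
  ultimately show ?thesis by blast
qed

lemma plane_coords:
  assumes "u \<in> V" "w \<in> V" "cross u w \<noteq> 0" "x \<in> V" "dot (cross u w) x = 0"
  shows "\<exists>a\<in>F. \<exists>b\<in>F. x = a *s u + b *s w"
proof -
  obtain z where z: "z \<in> V" "dot (cross u w) z = e" using exists_cols assms by blast
  then obtain a b c where abc: "a \<in> F" "b \<in> F" "c \<in> F" "x = a *s u + b *s w + c *s z"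
    using cols_coords assms by blast
  then have "c = 0" using assms(5) z by (simp add: dot_linear dot_cross)
  then show ?thesis using abc by auto
qed

text \<open>Subtracting \<open>dot f z *s cross u w\<close> from \<open>f\<close> leaves a covector
  that kills the basis \<open>u\<close>, \<open>w\<close>, \<open>z\<close>.\<close>

lemma plane_covector:
  assumes "u \<in> V" "w \<in> V" "cross u w \<noteq> 0" "f \<in> V" "dot f u = 0" "dot f w = 0"
  shows "\<exists>k\<in>F. f = k *s cross u w"
proof -
  obtain z where z: "z \<in> V" "dot (cross u w) z = e" using exists_cols assms by blast
  have "f - dot f z *s cross u w = 0"
  proof (rule dot_all_0)
    fix x assume "x \<in> V"
    then obtain a b c where "a \<in> F" "b \<in> F" "c \<in> F" "x = a *s u + b *s w + c *s z"
      using cols_coords z assms by blast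
    then show "dot (f - dot f z *s cross u w) x = 0"
      using assms z by (simp add: dot_linear dot_cross mult.commute)
  qed (use assms z in simp)
  then show ?thesis using assms z by (metis dot_F right_minus_eq)
qed

text \<open>The line through two points or, read dually, the common point of two lines. The case
  distinctions admit equal points and zero vectors.\<close>

lemma exists_perp2:
  assumes "u \<in> V" "w \<in> V"
  shows "\<exists>f\<in>V. f \<noteq> 0 \<and> dot f u = 0 \<and> dot f w = 0"
proof (cases "cross u w = 0")
  case False
  then show ?thesis using assms dot_cross by (intro bexI[of _ "cross u w"]) auto
next
  case True
  have *: "\<exists>f\<in>V. f \<noteq> 0 \<and> dot f x = 0" if "x \<in> V" for x
  proof (cases "x = 0")
    case False
    then obtain y where "y \<in> V" "cross x y \<noteq> 0"
      using exists_indep \<open>x \<in> V\<close> by blast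
    then show ?thesis using \<open>x \<in> V\<close> dot_cross
      by (intro bexI[of _ "cross x y"]) auto
  next
    case True
    have "e1 \<noteq> 0" using nz by (simp add: coords)
    then show ?thesis using True by (intro bexI[of _ e1]) (auto simp: dot_linear)
  qed
  show ?thesis
  proof (cases "u = 0")
    case True
    then show ?thesis using *[of w] assms by (auto simp: dot_linear)
  next
    case False
    then obtain k where "k \<in> F" "w = k *s u" using cross_eq_0 True assms by blast
    then show ?thesis using *[of u] assms by (auto simp: dot_linear)
  qed
qed

lemma SL_transitive:
  assumes "u \<in> V" "u \<noteq> 0"
  shows "\<exists>g\<in>carrier SL. g *v e1 = u"
proof -
  obtain w where w: "w \<in> V" "cross u w \<noteq> 0" using exists_indep assms by blast
  then obtain z where "z \<in> V" "cols u w z \<in> carrier SL" using exists_cols assms by blast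
  then show ?thesis using cols_e w assms by blast
qed

end

section \<open>Transvections, generation and simplicity\<close>

lemma mat_mul_add: "(A + B) ** C = A ** C + B ** C" "C ** (A + B) = C ** A + C ** B"
  for A B C :: "'a::comm_ring_1^3^3"
  by (simp_all add: coords algebra_simps)

lemma mat_vec_scale: "A *v (c *s u) = c *s (A *v u)" "(c *s u) v* A = c *s (u v* A)"
  "c *s (d *s u) = (c * d) *s u"
  for A :: "'a::comm_ring_1^3^3"
  by (simp_all add: coords algebra_simps)

context prime_ideal
begin

text \<open>The map sending \<open>w\<close> to \<open>w + dot f w *s u\<close>. It is a
  transvection with centre \<open>u\<close> and axis the kernel of \<open>f\<close> only if
  \<open>dot f u = 0\<close>; this is left to the lemmas.\<close>

definition transv :: "'a^3 \<Rightarrow> 'a^3 \<Rightarrow> 'a^3^3"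
  where "transv u f = mat e + outer u f"

lemma subgroup_SL:
  assumes "subgroup H SL"
  shows "\<And>a b. a \<in> H \<Longrightarrow> b \<in> H \<Longrightarrow> a ** b \<in> H"
    "\<And>a. a \<in> H \<Longrightarrow> inv' a \<in> H" "mat e \<in> H"
    "\<And>a. a \<in> H \<Longrightarrow> a \<in> carrier SL"
  using subgroup.m_closed[OF assms] subgroup.m_inv_closed[OF assms] subgroup.one_closed[OF assms]
    subgroup.mem_carrier[OF assms] by simp_all

lemma transv_Mt [simp]: "u \<in> V \<Longrightarrow> f \<in> V \<Longrightarrow>
  transv u f \<in> Mt"
  by (simp add: transv_def)

lemma transv_SL: "u \<in> V \<Longrightarrow> f \<in> V \<Longrightarrow> dot f u =
  0 \<Longrightarrow> transv u f \<in> carrier SL"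
  by (simp add: carrier_SL transv_def det_mat_outer idem)

lemma transv_vec:
  "w \<in> V \<Longrightarrow> transv u f *v w = w + dot f w *s u"
  "w \<in> V \<Longrightarrow> w v* transv u f = w + dot w u *s f"
  by (simp_all add: transv_def matrix_vector_mult_add_rdistrib vector_matrix_mult_add_rdistrib
    outer_mul_vec)

lemma transv_mul:
  "A \<in> Mt \<Longrightarrow> A ** transv u f = A + outer (A *v u) f"
    "A \<in> Mt \<Longrightarrow> transv u f ** A = A + outer u (f v* A)"
  by (simp_all add: transv_def mat_mul_add mat_mul_add outer_mul)

lemma transv_conj:
  assumes "A \<in> carrier SL" "u \<in> V" "f \<in> V"
  shows "A ** transv u f ** inv' A = transv (A *v u) (f v* inv' A)"
  using assms by (simp add: transv_mul mat_mul_add outer_mul) (simp add: transv_def)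

lemma transv_mult_axis: "u \<in> V \<Longrightarrow> w \<in> V \<Longrightarrow>
  f \<in> V \<Longrightarrow> dot f w = 0 \<Longrightarrow> transv u f ** transv w f =
    transv (u + w) f"
  by (simp add: transv_mul transv_vec) (simp add: transv_def outer_add)

lemma transv_mult_center: "u \<in> V \<Longrightarrow> g \<in> V \<Longrightarrow>
  f \<in> V \<Longrightarrow> dot f u = 0 \<Longrightarrow> transv u f ** transv u g =
    transv u (f + g)"
  by (simp add: transv_mul transv_vec) (simp add: transv_def outer_add)

lemma transv_scale: "transv (c *s u) f = transv u (c *s f)"
  by (simp add: transv_def outer_add)

lemma outer_0: "outer 0 f = 0" "outer u 0 = 0"
  by (simp_all add: coords)

lemma outer_eq_0: "u \<in> V \<Longrightarrow> f \<in> V \<Longrightarrow> outer u f =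
  0 \<longleftrightarrow> u = 0 \<or> f = 0"
proof
  assume *: "u \<in> V" "f \<in> V" "outer u f = 0"
  show "u = 0 \<or> f = 0"
  proof (rule ccontr)
    assume "\<not> (u = 0 \<or> f = 0)"
    then obtain i j where "u$i \<noteq> 0" "f$j \<noteq> 0" by (auto simp: vec_eq_iff)
    moreover have "u$i * f$j = outer u f $ i $ j" by (simp add: outer_def)
    ultimately show False using * by simp
  qed
qed (auto simp: outer_0)

lemma transv_eq_one: "u \<in> V \<Longrightarrow> f \<in> V \<Longrightarrow> transv u f =
  mat e \<longleftrightarrow> u = 0 \<or> f = 0"
  using outer_eq_0[of u f] by (simp add: transv_def)

lemma transv_inv:
  assumes "u \<in> V" "f \<in> V" "dot f u = 0"
  shows "inv' (transv u f) = transv u (- f)"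
proof (rule SL.inv_equality)
  show "transv u (- f) \<otimes>\<^bsub>SL\<^esub> transv u f = \<one>\<^bsub>SL\<^esub>"
    using transv_mult_center[of u f "- f"] assms by (simp add: dot_linear) (simp add: transv_def
      outer_0)
qed (use assms in \<open>auto intro: transv_SL simp: dot_linear\<close>)

text \<open>Every scalar of a prime field is a natural multiple of the unit, so the rescaled
  transvections are powers of the given one.\<close>

lemma transv_multiple_mem:
  assumes H: "subgroup H SL" and uf: "u \<in> V" "f \<in> V" "dot f u = 0"
    and "transv u f \<in> H" "k \<in> F"
  shows "transv (k *s u) f \<in> H" "transv u (k *s f) \<in> H"
proof -
  have "transv ((of_nat n * e) *s u) f \<in> H" for n
  proof (induction n)
    case 0
    then show ?case using subgroup_SL(3)[OF H] by (simp add: transv_def outer_0)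
  next
    case (Suc n)
    have "transv u f ** transv ((of_nat n * e) *s u) f = transv (u + (of_nat n * e) *s u) f"
      by (rule transv_mult_axis) (use uf in \<open>auto simp: dot_linear\<close>)
    also have "u + (of_nat n * e) *s u = (of_nat (Suc n) * e) *s u"
      using uf by (simp add: vec_eq_iff distrib_right)
    finally show ?case using subgroup_SL(1)[OF H assms(5) Suc] by simp
  qed
  then show "transv (k *s u) f \<in> H" using F_cases[OF assms(6)] by metis
  then show "transv u (k *s f) \<in> H" by (simp add: transv_scale)
qed

lemma e123_V: "e1 \<in> V" "e2 \<in> V" "e3 \<in> V" by simp_all

lemma e123_nz: "e1 \<noteq> 0" "e2 \<noteq> 0" "e3 \<noteq> 0"
  using nz by (auto simp: vec_eq_iff forall_3)

text \<open>Gaussian elimination. Elements of \<open>H\<close> carry the first column to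
  \<open>e1\<close> (relation \<open>R\<close>), then the second column to \<open>e2\<close> while
  fixing \<open>e1\<close> (relation \<open>S\<close>). The remaining matrix is a product of two of
  the given generators.\<close>

lemma elementary_generate:
  assumes H: "subgroup H SL"
    and E: "\<And>k. k \<in> F \<Longrightarrow> transv (k *s e1) e2 \<in> H"
      "\<And>k. k \<in> F \<Longrightarrow> transv (k *s e2) e1 \<in> H"
      "\<And>k. k \<in> F \<Longrightarrow> transv (k *s e1) e3 \<in> H"
        "\<And>k. k \<in> F \<Longrightarrow> transv (k *s e3) e1 \<in> H"
      "\<And>k. k \<in> F \<Longrightarrow> transv (k *s e2) e3 \<in> H"
        "\<And>k. k \<in> F \<Longrightarrow> transv (k *s e3) e2 \<in> H"
  shows "H = carrier SL"
proof -
  define R where "R v w = (\<exists>h\<in>H. h *v v = w)" for v w :: "'a^3"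
  define S where "S v w = (\<exists>h\<in>H. h *v e1 = e1 \<and> h *v v = w)" for v w :: "'a^3"
  have R_trans: "R u v \<Longrightarrow> R v w \<Longrightarrow> R u w" for u v w
    unfolding R_def using subgroup_SL(1)[OF H] by (metis matrix_vector_mul_assoc)
  have S_trans: "S u v \<Longrightarrow> S v w \<Longrightarrow> S u w" for u v w
    unfolding S_def using subgroup_SL(1)[OF H] by (metis matrix_vector_mul_assoc)
  have step: "transv (k *s u) f *v v = v + (k * dot f v) *s u" if "v \<in> V" for k u f v
    using that by (simp add: transv_vec vec_eq_iff ac_simps)
  have R12: "R (vector [a, b, c]) (vector [a + k * b, b, c])"
    and R21: "R (vector [a, b, c]) (vector [a, b + k * a, c])"
    and R13: "R (vector [a, b, c]) (vector [a + k * c, b, c])"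
      and R31: "R (vector [a, b, c]) (vector [a, b, c + k * a])"
    if "a \<in> F" "b \<in> F" "c \<in> F" "k \<in> F" for a b c k
    unfolding R_def
    by (rule bexI[OF _ E(1)[OF that(4)]] bexI[OF _ E(2)[OF that(4)]] bexI[OF _ E(3)[OF that(4)]]
      bexI[OF _ E(4)[OF that(4)]];
        use that in \<open>simp add: step vec_eq_iff forall_3\<close>)+
  have S12: "S (vector [a, b, c]) (vector [a + k * b, b, c])"
    and S23: "S (vector [a, b, c]) (vector [a, b + k * c, c])"
      and S32: "S (vector [a, b, c]) (vector [a, b, c + k * b])"
    if "a \<in> F" "b \<in> F" "c \<in> F" "k \<in> F" for a b c k
    unfolding S_def
    by (rule bexI[OF _ E(1)[OF that(4)]] bexI[OF _ E(5)[OF that(4)]] bexI[OF _ E(6)[OF that(4)]];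
        use that in \<open>simp add: step vec_eq_iff forall_3\<close>)+
  have clear: "R (vector [e, b, c]) e1" if "b \<in> F" "c \<in> F" for b c
    using R_trans[of "vector [e, b, c]" "vector [e, 0, c]" e1] R21[of e b c "- b"] R31[of e 0 c
      "- c"] that by simp
  have R2: "R (vector [a, b, c]) e1" if "a \<in> F" "b \<in> F" "c \<in> F" "b \<noteq> 0" for a b c
  proof -
    \<comment> \<open>The multiplier makes the first coordinate equal to \<open>e\<close>, which
      then clears the other two.\<close>
    have "a + ((e - a) * finv b) * b = e"
      using that finv(1,3)[of b] by (simp add: mult.assoc)
    then have "R (vector [a, b, c]) (vector [e, b, c])"
      using R12[of a b c "(e - a) * finv b"] that finv(1)[of b] by simp
    then show ?thesis using clear R_trans that by blast
  qed
  have R3: "R (vector [a, b, c]) e1" if "a \<in> F" "b \<in> F" "c \<in> F" "c \<noteq> 0" for a b c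
  proof -
    have "a + ((e - a) * finv c) * c = e"
      using that finv(1,3)[of c] by (simp add: mult.assoc)
    then have "R (vector [a, b, c]) (vector [e, b, c])"
      using R13[of a b c "(e - a) * finv c"] that finv(1)[of c] by simp
    then show ?thesis using clear R_trans that by blast
  qed
  have R1: "R (vector [a, 0, 0]) e1" if "a \<in> F" "a \<noteq> 0" for a
    using R_trans[of "vector [a, 0, 0]" "vector [a, a, 0]" e1] R21[of a 0 0 e] R2[of a a 0] that
      by simp
  have to_e1: "R v e1" if "v \<in> V" "v \<noteq> 0" for v
  proof -
    have "v = vector [v$1, v$2, v$3]" by (simp add: vec_eq_iff forall_3)
    moreover have "v$1 \<noteq> 0 \<or> v$2 \<noteq> 0 \<or> v$3 \<noteq> 0" using that
      by (auto simp: vec_eq_iff forall_3)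
    ultimately show ?thesis using R1[of "v$1"] R2[of "v$1" "v$2" "v$3"] R3[of "v$1" "v$2"
      "v$3"] that
      by (metis V_nth)
  qed
  have clear': "S (vector [a, e, c]) e2" if "a \<in> F" "c \<in> F" for a c
    using S_trans[of "vector [a, e, c]" "vector [0, e, c]" e2] S12[of a e c "- a"] S32[of 0 e c
      "- c"] that by simp
  have S3: "S (vector [a, b, c]) e2" if "a \<in> F" "b \<in> F" "c \<in> F" "c \<noteq> 0" for a b c
  proof -
    have "b + ((e - b) * finv c) * c = e"
      using that finv(1,3)[of c] by (simp add: mult.assoc)
    then have "S (vector [a, b, c]) (vector [a, e, c])"
      using S23[of a b c "(e - b) * finv c"] that finv(1)[of c] by simp
    then show ?thesis using clear' S_trans that by blast
  qed
  have S2: "S (vector [a, b, 0]) e2" if "a \<in> F" "b \<in> F" "b \<noteq> 0" for a b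
    using S_trans[of "vector [a, b, 0]" "vector [a, b, b]" e2] S32[of a b 0 e] S3[of a b b] that
      by simp
  have to_e2: "S v e2" if "v \<in> V" "v$2 \<noteq> 0 \<or> v$3 \<noteq> 0" for v
  proof -
    have "v = vector [v$1, v$2, v$3]" by (simp add: vec_eq_iff forall_3)
    then show ?thesis using S2[of "v$1" "v$2"] S3[of "v$1" "v$2" "v$3"] that
      by (metis V_nth)
  qed
  have last: "C \<in> H" if C: "C \<in> carrier SL" "C *v e1 = e1" "C *v e2 = e2" for C
  proof -
    have m: "C \<in> Mt" "det C = e" using C by (auto simp: carrier_SL)
    have 1: "C$1$1 = e" "C$2$1 = 0" "C$3$1 = 0" "C$1$2 = 0" "C$2$2 = e" "C$3$2 = 0"
      using C(2,3) m by (simp_all add: vec_eq_iff forall_3 matrix_vector_mult_def sum_3)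
    then have 2: "C$3$3 = e" using m by (simp add: det_3)
    have "transv (C$1$3 *s e1) e3 ** transv (C$2$3 *s e2) e3 = C"
      using 1 2 m by (simp add: transv_def coords idem)
    then show ?thesis using subgroup_SL(1)[OF H E(3)[of "C$1$3"] E(5)[of "C$2$3"]] m by simp
  qed
  have cancel: "A \<in> H" if "h \<in> H" "h ** A \<in> H" "A \<in> carrier SL" for h A
  proof -
    have "inv' h ** (h ** A) \<in> H" using subgroup_SL[OF H] that by blast
    moreover have "inv' h ** (h ** A) = A"
      using subgroup_SL(4)[OF H that(1)] that(3) by (simp add: matrix_mul_assoc)
    ultimately show ?thesis by simp
  qed
  have "A \<in> H" if A: "A \<in> carrier SL" for A
  proof -
    obtain h where h: "h \<in> H" "h *v (A *v e1) = e1"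
      using to_e1[of "A *v e1"] A e123_nz e123_V unfolding R_def by auto
    let ?B = "h ** A"
    have B: "?B \<in> carrier SL" "?B *v e1 = e1"
      using h A subgroup_SL(4)[OF H] by (auto simp: matrix_vector_mul_assoc)
    \<comment> \<open>Otherwise the first two columns of an invertible matrix would be
      proportional.\<close>
    have "(?B *v e2)$2 \<noteq> 0 \<or> (?B *v e2)$3 \<noteq> 0"
    proof (rule ccontr)
      assume "\<not> ?thesis"
      then have "?B *v e2 = (?B *v e2)$1 *s (?B *v e1)" unfolding B(2) using B(1)
        by (simp add: vec_eq_iff forall_3)
      then have "?B *v (e2 - (?B *v e2)$1 *s e1) = 0"
        by (simp add: matrix_vector_mult_diff_distrib mat_vec_scale)
      then have "e2 - (?B *v e2)$1 *s e1 = 0" using B(1) by (subst (asm) SL_vec_0) auto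
      then show False using nz by (simp add: vec_eq_iff forall_3)
    qed
    then obtain k where k: "k \<in> H" "k *v e1 = e1" "k *v (?B *v e2) = e2"
      using to_e2[of "?B *v e2"] B(1) unfolding S_def by auto
    have "k ** ?B \<in> H"
      by (rule last) (use k B subgroup_SL(4)[OF H] in \<open>auto simp:
        matrix_vector_mul_assoc[symmetric]\<close>)
    then have "?B \<in> H" using cancel k B by blast
    then show "A \<in> H" using cancel h A by blast
  qed
  then show ?thesis using subgroup_SL(4)[OF H] by auto
qed

lemma transv_std:
  assumes "u \<in> V" "f \<in> V" "u \<noteq> 0" "f \<noteq> 0" "dot f u = 0"
  shows "\<exists>g\<in>carrier SL. g *v e1 = u \<and> f v* g = e2"
proof -
  obtain w where w: "w \<in> V" "dot f w = e" using dot_dual assms by blast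
  have "cross u w \<noteq> 0"
  proof
    assume "cross u w = 0"
    then obtain k where "k \<in> F" "w = k *s u" using cross_eq_0 assms w by blast
    then show False using w assms nz by (simp add: dot_linear)
  qed
  then obtain z where z: "z \<in> V" "dot (cross u w) z = e" using exists_cols assms w by blast
  let ?z = "z - dot f z *s w"
  have "cols u w ?z \<in> carrier SL"
    by (rule cols_SL) (use assms w z in \<open>auto simp: dot_linear dot_cross\<close>)
  moreover have "f v* cols u w ?z = e2" using w z assms by (simp add: cols_mul dot_linear)
  ultimately show ?thesis using cols_e(1)[of u w ?z] assms w z by auto
qed

text \<open>Both are conjugate to \<open>transv e1 e2\<close>. No scalar invariant survives in
  dimension three, because the third basis vector in \<open>transv_std\<close> is free to absorb the
  determinant.\<close>

lemma transv_conjugate: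
  assumes "u \<in> V" "f \<in> V" "u \<noteq> 0" "f \<noteq> 0" "dot f u = 0" "u' \<in> V"
    "f' \<in> V" "u' \<noteq> 0" "f' \<noteq> 0" "dot f' u' = 0"
  shows "\<exists>g\<in>carrier SL. g ** transv u f ** inv' g = transv u' f'"
proof -
  obtain g where g: "g \<in> carrier SL" "g *v e1 = u" "f v* g = e2"
    using transv_std assms(1-5) by blast
  obtain h where h: "h \<in> carrier SL" "h *v e1 = u'" "f' v* h = e2"
    using transv_std assms(6-10) by blast
  let ?k = "h ** inv' g"
  have k: "?k \<in> carrier SL" using g h SL.inv_closed by simp
  have "inv' ?k = g ** inv' h"
    using SL.inv_mult_group[of h "inv' g"] g h by simp
  then have "f v* inv' ?k = e2 v* inv' h"
    using g h by (simp add: vector_matrix_mul_assoc[symmetric])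
  also have "\<dots> = f'" using SL_inv(6)[OF h(1) assms(7)] h by simp
  finally have 1: "f v* inv' ?k = f'" .
  have "inv' g *v u = e1" using SL_inv(4)[OF g(1), of e1] g by simp
  then have "?k *v u = u'" using h by (simp add: matrix_vector_mul_assoc[symmetric])
  then show ?thesis using transv_conj[OF k assms(1,2)] 1 k by metis
qed

lemma normal_with_transvection:
  assumes N: "N \<lhd> SL" and uf: "u \<in> V" "f \<in> V" "u \<noteq> 0" "f \<noteq> 0"
    "dot f u = 0" "transv u f \<in> N"
  shows "N = carrier SL"
proof (rule elementary_generate)
  show H: "subgroup N SL" using N normal_imp_subgroup by blast
  have *: "transv u' f' \<in> N" if "u' \<in> V" "f' \<in> V" "f' \<noteq> 0" "dot f' u' = 0"
    for u' f'
  proof (cases "u' = 0")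
    case True
    then show ?thesis using subgroup_SL(3)[OF H] by (simp add: transv_def outer_0)
  next
    case False
    then obtain g where g: "g \<in> carrier SL" "g ** transv u f ** inv' g = transv u' f'"
      using transv_conjugate[OF uf(1-5), of u' f'] \<open>u' \<in> V\<close> \<open>f' \<in>
        V\<close> \<open>f' \<noteq> 0\<close> \<open>dot f' u' = 0\<close> by blast
    then show ?thesis using normal.inv_op_closed2[OF N g(1) uf(6)] by simp
  qed
  show "transv (k *s e1) e2 \<in> N" "transv (k *s e2) e1 \<in> N" "transv (k *s e1) e3 \<in> N"
    "transv (k *s e3) e1 \<in> N"
    "transv (k *s e2) e3 \<in> N" "transv (k *s e3) e2 \<in> N" if k: "k \<in> F" for k
    by (rule *; use k e123_nz in \<open>simp add: dot_linear\<close>)+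
qed

end

context prime_ideal_2_mod_3
begin

text \<open>The commutator of \<open>y\<close> with a transvection centred at \<open>u\<close> is
  again of this kind. If all these commutators are trivial, then \<open>y\<close> acts as
  \<open>c\<close> modulo \<open>u\<close>, so \<open>c * c * c = e\<close>, hence
  \<open>c = e\<close>, and \<open>y\<close> itself is a transvection.\<close>

lemma normal_with_eigenvector:
  assumes N: "N \<lhd> SL" and y: "y \<in> N" "y \<noteq> mat e"
    and u: "u \<in> V" "u \<noteq> 0" "c \<in> F" "y *v u = c *s u"
  shows "N = carrier SL"
proof -
  have H: "subgroup N SL" using N normal_imp_subgroup by blast
  have yS: "y \<in> carrier SL" using y subgroup_SL(4)[OF H] by blast
  have iyS: "inv' y \<in> carrier SL" using yS by simp
  have "c \<noteq> 0" using u yS SL_vec_0[of y u] by auto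
  have iu: "inv' y *v u = finv c *s u"
  proof -
    have "y *v (finv c *s u) = u"
      using u finv[of c] \<open>c \<noteq> 0\<close> by (simp add: mat_vec_scale)
    then show ?thesis using SL_inv(4)[OF yS, of "finv c *s u"] u finv[of c] \<open>c \<noteq>
      0\<close> by simp
  qed
  show ?thesis
  proof (cases "\<exists>g\<in>V. dot g u = 0 \<and> c *s (g v* inv' y) \<noteq> g")
    case True
    then obtain g where g: "g \<in> V" "dot g u = 0" "c *s (g v* inv' y) \<noteq> g" by blast
    let ?g = "g v* inv' y"
    have gV: "?g \<in> V" using g iyS by simp
    have gu: "dot ?g u = 0" using g u iu by (simp add: dot_vec_mul dot_linear)
    have t: "transv u g \<in> carrier SL" using transv_SL g u by simp
    have "inv' y \<in> N" using subgroup_SL(2)[OF H] y by blast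
    then have "transv u g ** inv' y ** inv' transv u g \<in> N"
      using normal.inv_op_closed2[OF N t] by simp
    then have "y ** (transv u g ** inv' y ** inv' transv u g) \<in> N"
      using subgroup_SL(1)[OF H] y by blast
    also have "y ** (transv u g ** inv' y ** inv' transv u g) =
      (y ** transv u g ** inv' y) ** inv' transv u g"
      by (simp add: matrix_mul_assoc)
    also have "\<dots> = transv u (c *s ?g) ** transv u (- g)"
      using transv_conj[OF yS u(1) g(1)] transv_inv[OF u(1) g(1,2)] u by (simp add: transv_scale)
    also have "\<dots> = transv u (c *s ?g + - g)"
      by (rule transv_mult_center) (use u g gV gu in \<open>auto simp: dot_linear\<close>)
    finally show ?thesis
      by (intro normal_with_transvection[OF N u(1)]) (use u g gV gu in \<open>auto simp:
        dot_linear\<close>)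
  next
    case False
    have inv: "g v* y = c *s g" if "g \<in> V" "dot g u = 0" for g
    proof -
      have "g v* y = (c *s (g v* inv' y)) v* y" using False that by simp
      also have "\<dots> = c *s ((g v* inv' y) v* y)" by (simp add: coords algebra_simps)
      finally show ?thesis using yS that by simp
    qed
    obtain w where w: "w \<in> V" "cross u w \<noteq> 0" using exists_indep u by blast
    then obtain z where z: "z \<in> V" "dot (cross u w) z = e" using exists_cols u by blast
    let ?g = "cols u w z"
    have g: "?g \<in> carrier SL" using cols_SL u w z by simp
    have zw: "dot (cross u z) w = - e"
      using z by (simp add: dot_def cross_def algebra_simps eq_neg_iff_add_eq_0)
    have ev: "\<exists>a\<in>F. y *v x = a *s u + c *s x" if "x = w \<or> x = z" for x
    proof -
      have x: "x \<in> V" using that w z by auto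
      obtain a b d where abd: "a \<in> F" "b \<in> F" "d \<in> F"
        "y *v x = a *s u + b *s w + d *s z"
        using cols_coords[OF u(1) w(1) z(1,2), of "y *v x"] x yS by auto
      have "dot (cross u w) (y *v x) = c * dot (cross u w) x"
        using inv[of "cross u w"] u w by (simp add: dot_vec_mul[symmetric] dot_cross dot_linear)
      then have d: "d = c * dot (cross u w) x" using abd z by (simp add: dot_linear dot_cross)
      have "dot (cross u z) (y *v x) = c * dot (cross u z) x"
        using inv[of "cross u z"] u z by (simp add: dot_vec_mul[symmetric] dot_cross dot_linear)
      then have b: "- b = c * dot (cross u z) x" using abd zw by (simp add: dot_linear dot_cross)
      have "b *s w + d *s z = c *s x"
        using that
      proof
        assume "x = w" then show ?thesis using b d zw u by (simp add: dot_cross)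
      next
        assume "x = z" then show ?thesis using b d z u by (simp add: dot_cross)
      qed
      then show ?thesis using abd by (auto simp: add.assoc)
    qed
    obtain a where a: "a \<in> F" "y *v w = a *s u + c *s w" using ev by blast
    obtain b where b: "b \<in> F" "y *v z = b *s u + c *s z" using ev by blast
    have yg: "y ** ?g = cols (c *s u) (a *s u + c *s w) (b *s u + c *s z)"
      unfolding cols_mul(2) u(4) a(2) b(2) ..
    have "det (y ** ?g) = e" using g yS by (simp add: carrier_SL det_mul)
    then have "c * c * c * dot (cross u w) z = e"
      unfolding yg det_cols by (simp add: cross_linear dot_linear dot_cross algebra_simps)
    then have "c = e" using cube_root_one[of c] u z by simp
    let ?h = "vector [0, a, b] v* inv' ?g"
    have h: "?h \<in> V" using a b g by simp
    have hg: "?h v* ?g = vector [0, a, b]" using g a b by simp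
    have "transv u ?h ** ?g = ?g + outer u (vector [0, a, b])" using g hg by (simp add: transv_mul)
    also have "\<dots> = y ** ?g" unfolding yg \<open>c = e\<close> using u w z a b
      by (simp add: coords algebra_simps)
    finally have "transv u ?h ** ?g ** inv' ?g = y ** ?g ** inv' ?g" by simp
    then have y_transv: "y = transv u ?h" using g yS h u by (simp add: matrix_mul_assoc[symmetric])
    have tN: "transv u ?h \<in> N" using y(1) by (simp only: y_transv[symmetric])
    have "transv u ?h \<noteq> mat e" using y(2) by (simp only: y_transv[symmetric]
      not_False_eq_True)
    then have "?h \<noteq> 0" using transv_eq_one[OF u(1) h] by blast
    moreover have "dot ?h u = 0"
      using arg_cong[OF hg, of "\<lambda>v. v$1"] u w z h by (simp add: cols_mul)
    ultimately show ?thesis by (rule normal_with_transvection[OF N u(1) h u(2) _ _ tN])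
  qed
qed

text \<open>If every vector were an eigenvector, the basis vectors would make \<open>x\<close>
  diagonal and their sums would make it scalar; then \<open>cube_root_one\<close> applies.\<close>

lemma nonscalar:
  assumes "x \<in> carrier SL" "x \<noteq> mat e"
  shows "\<exists>u\<in>V. cross u (x *v u) \<noteq> 0"
proof (rule ccontr)
  assume "\<not> ?thesis"
  then have *: "cross u (x *v u) = 0" if "u \<in> V" for u using that by blast
  have m: "x \<in> Mt" "det x = e" using assms by (auto simp: carrier_SL)
  have 1: "x$2$1 = 0" "x$3$1 = 0" "x$1$2 = 0" "x$3$2 = 0" "x$1$3 = 0" "x$2$3 = 0"
    using *[of e1] *[of e2] *[of e3] m by (simp_all add: coords)
  have 2: "x$2$2 = x$1$1" "x$3$3 = x$1$1"
    using *[of "e1 + e2"] *[of "e1 + e3"] m 1 by (simp_all add: coords)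
  then have "x$1$1 * x$1$1 * x$1$1 = e" using m 1 by (simp add: det_3)
  then have "x$1$1 = e" by (rule cube_root_one[OF Mt_nth[OF m(1)]])
  then have "x = mat e" using 1 2 by (simp add: coords)
  then show False using assms by simp
qed

theorem simple_SL: "simple_group SL"
proof (unfold_locales)
  have "transv e1 e2 \<in> carrier SL" by (rule transv_SL) (simp_all add: dot_def)
  moreover have "transv e1 e2 \<noteq> mat e" using transv_eq_one[of e1 e2] e123_nz by simp
  ultimately have "{mat e} \<subset> carrier SL" by auto
  then have "card {mat e :: 'a^3^3} < order SL" unfolding order_def
    by (intro psubset_card_mono) auto
  then show "1 < order SL" by simp
next
  fix N assume N: "N \<lhd> SL"
  have H: "subgroup N SL" using N normal_imp_subgroup by blast
  show "N = carrier SL \<or> N = {\<one>\<^bsub>SL\<^esub>}"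
  proof (rule ccontr)
    assume a: "\<not> ?thesis"
    then obtain x where x: "x \<in> N" "x \<noteq> mat e" using subgroup_SL(3)[OF H] by auto
    have xS: "x \<in> carrier SL" using x subgroup_SL(4)[OF H] by blast
    have ixS: "inv' x \<in> carrier SL" using xS by simp
    obtain u where u: "u \<in> V" "cross u (x *v u) \<noteq> 0" using nonscalar xS x by blast
    have unz: "u \<noteq> 0" using u by (auto simp: coords)
    \<comment> \<open>The transvection \<open>transv u f\<close> fixes both \<open>u\<close> and
      \<open>inv' x *v u\<close>, so its commutator with \<open>x\<close> fixes
      \<open>u\<close>.\<close>
    obtain f where f: "f \<in> V" "f \<noteq> 0" "dot f u = 0" "dot f (inv' x *v u) = 0"
      using exists_perp2[of u "inv' x *v u"] u ixS by auto
    let ?t = "transv u f"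
    have t: "?t \<in> carrier SL" using transv_SL u f by simp
    let ?y = "x ** (?t ** inv' x ** inv' ?t)"
    have "inv' x \<in> N" using subgroup_SL(2)[OF H] x by blast
    then have "?t ** inv' x ** inv' ?t \<in> N"
      using normal.inv_op_closed2[OF N t] by simp
    then have y: "?y \<in> N" using subgroup_SL(1)[OF H] x by blast
    have "?y *v u = e *s u"
    proof -
      have 1: "inv' ?t *v u = u" using transv_inv[OF u(1) f(1,3)] f u
        by (simp add: transv_vec dot_linear)
      have 2: "?t *v (inv' x *v u) = inv' x *v u" using f u ixS by (simp add: transv_vec)
      show ?thesis using 1 2 xS u by (simp add: matrix_vector_mul_assoc[symmetric])
    qed
    \<comment> \<open>If \<open>x\<close> commuted with the transvection, it would preserve its
      centre, but \<open>u\<close> is not an eigenvector of \<open>x\<close>.\<close>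
    moreover have "?y \<noteq> mat e"
    proof
      assume "?y = mat e"
      then have "?y ** ?t = mat e ** ?t" by simp
      moreover have "?y ** ?t = x ** ?t ** inv' x ** (inv' ?t ** ?t)"
        by (simp only: matrix_mul_assoc)
      ultimately have "x ** ?t ** inv' x = ?t" using t xS ixS by simp
      then have o: "outer (x *v u) (f v* inv' x) = outer u f"
        using transv_conj[OF xS u(1) f(1)] by (simp add: transv_def)
      obtain w where w: "w \<in> V" "dot f w = e" using dot_dual f by blast
      have "outer (x *v u) (f v* inv' x) *v w = outer u f *v w" unfolding o ..
      then have "dot (f v* inv' x) w *s (x *v u) = u" using w u by (simp add: outer_mul_vec)
      then have "cross u (x *v u) = cross (dot (f v* inv' x) w *s (x *v u)) (x *v u)" by simp
      then show False using u(2) by (simp add: cross_linear)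
    qed
    ultimately have "N = carrier SL" using normal_with_eigenvector[OF N y _ u(1) unz e_F] by blast
    then show False using a by simp
  qed
qed

end

text \<open>This is a conjugate of \<open>H\<close> written as a preimage; passing to it amounts to
  a change of basis in the arguments about matrices.\<close>

lemma (in group) conj_closed_subgroup:
  assumes "subgroup H G" "g \<in> carrier G"
  shows "subgroup {x \<in> carrier G. g \<otimes> x \<otimes> inv g \<in> H} G"
proof (rule subgroupI)
  show "{x \<in> carrier G. g \<otimes> x \<otimes> inv g \<in> H} \<noteq> {}"
    using assms subgroup.one_closed[OF assms(1)] by (auto intro!: exI[of _ \<one>])
  show "inv a \<in> {x \<in> carrier G. g \<otimes> x \<otimes> inv g \<in> H}"
    if "a \<in> {x \<in> carrier G. g \<otimes> x \<otimes> inv g \<in> H}" for a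
  proof -
    have "g \<otimes> inv a \<otimes> inv g = inv (g \<otimes> a \<otimes> inv g)"
      using assms that by (simp add: inv_mult_group m_assoc)
    then show ?thesis using that subgroup.m_inv_closed[OF assms(1)] by simp
  qed
  show "a \<otimes> b \<in> {x \<in> carrier G. g \<otimes> x \<otimes> inv g \<in> H}"
    if "a \<in> {x \<in> carrier G. g \<otimes> x \<otimes> inv g \<in> H}"
      "b \<in> {x \<in> carrier G. g \<otimes> x \<otimes> inv g \<in> H}" for a b
  proof -
    have "g \<otimes> (a \<otimes> b) \<otimes> inv g = (g \<otimes> a \<otimes> inv g) \<otimes>
      (g \<otimes> b \<otimes> inv g)"
      using assms that by (simp add: m_assoc mult_inv_cancel)
    then show ?thesis using that subgroup.m_closed[OF assms(1)] by simp
  qed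
qed auto

section \<open>Irreducible subgroups with transvections\<close>

context prime_ideal
begin

definition point_stab :: "'a^3 \<Rightarrow> ('a^3^3) set" where
  "point_stab u = {g \<in> carrier SL. \<exists>k\<in>F. g *v u = k *s u}"

definition line_stab :: "'a^3 \<Rightarrow> ('a^3^3) set" where
  "line_stab f = {g \<in> carrier SL. \<exists>k\<in>F. f v* g = k *s f}"

text \<open>Irreducibility without subspaces: no orbit of a nonzero vector lies in a plane. For
  subgroups in dimension three this excludes exactly the invariant points and lines.\<close>

definition acts_irred :: "('a^3^3) set \<Rightarrow> bool" where
  "acts_irred H \<longleftrightarrow> (\<forall>u\<in>V. \<forall>f\<in>V. u \<noteq> 0
    \<longrightarrow> f \<noteq> 0 \<longrightarrow> (\<exists>h\<in>H. dot f (h *v u) \<noteq> 0))"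

lemma acts_irredD: "acts_irred H \<Longrightarrow> u \<in> V \<Longrightarrow>
  f \<in> V \<Longrightarrow> u \<noteq> 0 \<Longrightarrow> f \<noteq> 0 \<Longrightarrow>
    \<exists>h\<in>H. dot f (h *v u) \<noteq> 0"
  unfolding acts_irred_def by blast

text \<open>Some orbit lies in the kernel of \<open>f\<close>. Either all its vectors are multiples
  of \<open>u\<close>, which is then an invariant point, or two of them span that kernel, which is
  then an invariant line.\<close>

lemma reducible_cases:
  assumes H: "subgroup H SL" and "\<not> acts_irred H"
  shows "(\<exists>u\<in>V. u \<noteq> 0 \<and> H \<subseteq> point_stab u) \<or>
    (\<exists>f\<in>V. f \<noteq> 0 \<and> H \<subseteq> line_stab f)"
proof -
  obtain u f where uf: "u \<in> V" "f \<in> V" "u \<noteq> 0" "f \<noteq> 0"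
    "\<And>h. h \<in> H \<Longrightarrow> dot f (h *v u) = 0"
    using assms(2) unfolding acts_irred_def by blast
  have HS: "h \<in> carrier SL" if "h \<in> H" for h using subgroup_SL(4)[OF H that] .
  show ?thesis
  proof (cases "\<forall>h\<in>H. cross u (h *v u) = 0")
    case True
    have "H \<subseteq> point_stab u"
    proof
      fix h assume h: "h \<in> H"
      then show "h \<in> point_stab u" using cross_eq_0[of u "h *v u"] True uf HS
        unfolding point_stab_def by auto
    qed
    then show ?thesis using uf by blast
  next
    case False
    then obtain h0 where h0: "h0 \<in> H" "cross u (h0 *v u) \<noteq> 0" by blast
    let ?c = "cross u (h0 *v u)"
    have w: "h0 *v u \<in> V" using HS[OF h0(1)] uf by simp
    have c: "?c \<in> V" using w uf by simp
    have "dot f u = 0" using uf(5)[OF subgroup_SL(3)[OF H]] uf by simp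
    then obtain m where m: "m \<in> F" "f = m *s ?c"
      using plane_covector[OF uf(1) w h0(2) uf(2)] uf(5)[OF h0(1)] by blast
    have "m \<noteq> 0" using m uf by auto
    have ch: "dot ?c (h *v u) = 0" if "h \<in> H" for h
    proof -
      have "m * dot ?c (h *v u) = 0" using uf(5)[OF that] unfolding m(2) by (simp add: dot_linear)
      then show ?thesis using F_no_zero_div[of m "dot ?c (h *v u)"] m \<open>m \<noteq> 0\<close>
        c uf HS[OF that] by simp
    qed
    have "H \<subseteq> line_stab ?c"
    proof
      fix k assume k: "k \<in> H"
      have "dot (?c v* k) u = 0" using ch[OF k] by (simp add: dot_vec_mul)
      moreover have "dot (?c v* k) (h0 *v u) = 0"
        using ch[OF subgroup_SL(1)[OF H k h0(1)]] by (simp add: dot_vec_mul matrix_vector_mul_assoc)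
      ultimately have "\<exists>j\<in>F. ?c v* k = j *s ?c"
        by (intro plane_covector[OF uf(1) w h0(2)]) (use c HS[OF k] in auto)
      then show "k \<in> line_stab ?c" using HS[OF k] unfolding line_stab_def by simp
    qed
    then show ?thesis using c h0 by blast
  qed
qed

lemma transv_conj_mem:
  assumes H: "subgroup H SL" and "h \<in> H" "transv u f \<in> H" "u \<in> V" "f \<in> V"
  shows "transv (h *v u) (f v* inv' h) \<in> H"
  using transv_conj[OF subgroup_SL(4)[OF H assms(2)] assms(4,5)] subgroup_SL(1,2)[OF H] assms
    by metis

lemma dot_invariant:
  assumes "h \<in> carrier SL" "u \<in> V"
  shows "dot (f v* inv' h) (h *v u) = dot f u"
  using assms by (simp add: dot_vec_mul)

text \<open>Elimination in the span of \<open>e1\<close> and \<open>e2\<close>. The conditions on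
  \<open>e3\<close>, as a vector and as a covector, ensure that conjugation by \<open>s\<close>
  respects the block decomposition.\<close>

lemma block_transitive:
  assumes H: "subgroup H SL" and E: "\<And>k. k \<in> F \<Longrightarrow>
    transv (k *s e1) e2 \<in> H" "\<And>k. k \<in> F \<Longrightarrow> transv (k *s e2) e1 \<in> H"
    and m: "m \<in> V" "m$3 = 0" "m \<noteq> 0"
  shows "\<exists>s\<in>H. s *v e1 = m \<and> s *v e3 = e3 \<and> e3 v* s = e3"
proof -
  define R where "R v w = (\<exists>h\<in>H. h *v v = w \<and> h *v e3 = e3 \<and> e3 v* h =
    e3)" for v w :: "'a^3"
  have R_trans: "R u w" if "R u v" "R v w" for u v w
  proof -
    obtain g h where g: "g \<in> H" "g *v u = v" "g *v e3 = e3" "e3 v* g = e3"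
      and h: "h \<in> H" "h *v v = w" "h *v e3 = e3" "e3 v* h = e3"
        using \<open>R u v\<close> \<open>R v w\<close> unfolding R_def by blast
    then show ?thesis unfolding R_def
      by (intro bexI[of _ "h ** g"])
        (auto simp: matrix_vector_mul_assoc[symmetric] vector_matrix_mul_assoc[symmetric]
          subgroup_SL(1)[OF H])
  qed
  have step: "transv (k *s u) f *v v = v + (k * dot f v) *s u"
    "v v* transv (k *s u) f = v + (dot v u * k) *s f"
    if "v \<in> V" for k u f v
    using that by (simp_all add: transv_vec dot_linear vec_eq_iff ac_simps)
  have R12: "R (vector [a, b, 0]) (vector [a + k * b, b, 0])"
    and R21: "R (vector [a, b, 0]) (vector [a, b + k * a, 0])"
    if "a \<in> F" "b \<in> F" "k \<in> F" for a b k
    unfolding R_def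
    by (rule bexI[OF _ E(1)[OF that(3)]] bexI[OF _ E(2)[OF that(3)]];
        use that in \<open>simp add: step vec_eq_iff forall_3\<close>)+
  have R2: "R e1 (vector [a, b, 0])" if "a \<in> F" "b \<in> F" "b \<noteq> 0" for a b
  proof -
    have "e + ((a - e) * finv b) * b = a"
      using that finv(1,3)[of b] by (simp add: mult.assoc)
    then have "R (vector [e, b, 0]) (vector [a, b, 0])"
      using R12[of e b "(a - e) * finv b"] that finv(1)[of b] by simp
    moreover have "R e1 (vector [e, b, 0])" using R21[of e 0 b] that by simp
    ultimately show ?thesis using R_trans by blast
  qed
  have R1: "R e1 (vector [a, 0, 0])" if "a \<in> F" "a \<noteq> 0" for a
    using R_trans[of e1 "vector [a, a, 0]" "vector [a, 0, 0]"] R2[of a a] R21[of a a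
      "- e"] that by simp
  have "m = vector [m$1, m$2, 0]" using m by (simp add: vec_eq_iff forall_3)
  moreover have "m$1 \<noteq> 0 \<or> m$2 \<noteq> 0" using m by (auto simp: vec_eq_iff forall_3)
  ultimately have "R e1 m" using R1[of "m$1"] R2[of "m$1" "m$2"] m by (metis V_nth)
  then show ?thesis unfolding R_def by blast
qed

text \<open>\<open>H\<close> contains \<open>SL\<^sub>2\<close> acting on the first two
  coordinates.\<close>

lemma block_extend:
  assumes H: "subgroup H SL" and E: "\<And>k. k \<in> F \<Longrightarrow>
    transv (k *s e1) e2 \<in> H" "\<And>k. k \<in> F \<Longrightarrow> transv (k *s e2) e1 \<in> H"
    and t: "u \<in> V" "f \<in> V" "dot f u = 0" "transv u f \<in> H" "u \<noteq> 0"
      "f$3 \<noteq> 0" and k: "k \<in> F"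
  shows "transv (k *s e1) e3 \<in> H" "transv (k *s e2) e3 \<in> H"
proof -
  note HS = subgroup_SL[OF H]
  \<comment> \<open>These are all the transvections of the block: they come from
    \<open>transv e1 e2\<close> by conjugation with block elements and by taking powers.\<close>
  have W: "transv m (k *s cross m e3) \<in> H" if m: "m \<in> V" "m$3 = 0" "m \<noteq> 0"
    and k: "k \<in> F" for m k
  proof -
    obtain s where s: "s \<in> H" "s *v e1 = m" "s *v e3 = e3" "e3 v* s = e3"
      using block_transitive[OF H E m] by blast
    have sS: "s \<in> carrier SL" using HS s by blast
    let ?h = "e2 v* inv' s"
    have hV: "?h \<in> V" using sS by simp
    have "transv e1 e2 \<in> H" using E(1)[of e] by simp
    then have t: "transv m ?h \<in> H" using transv_conj_mem[OF H s(1), of e1 e2] s(2) by simp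
    have c: "cross m e3 \<noteq> 0" using m by (auto simp: coords)
    have d: "dot ?h m = 0" "dot ?h e3 = 0"
      using dot_invariant[OF sS, of e1 e2] dot_invariant[OF sS, of e3 e2] s
        by (simp_all add: dot_def)
    then obtain c where c: "c \<in> F" "?h = c *s cross m e3"
      using plane_covector[of m e3 ?h] m c hV by auto
    have "?h \<noteq> 0" using sS e123_nz by simp
    then have "c \<noteq> 0" using c by auto
    have "transv m ((k * finv c) *s ?h) \<in> H"
      by (rule transv_multiple_mem(2)[OF H]) (use m hV d t k c \<open>c \<noteq> 0\<close>
        finv(1) in auto)
    also have "(k * finv c) *s ?h = (k * (finv c * c)) *s cross m e3"
      unfolding c(2) mat_vec_scale(3) by (simp add: ac_simps)
    finally show ?thesis using finv(3)[of c] c \<open>c \<noteq> 0\<close> k by simp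
  qed
  \<comment> \<open>If the centre lies in the plane of the block, a transvection from
    \<open>W\<close> cancels the first two coordinates of \<open>f\<close> and leaves a multiple of
    \<open>e3\<close>; conjugation then moves the centre freely in the plane.\<close>
  have case1: "transv m e3 \<in> H" if u: "u \<in> V" "f \<in> V" "dot f u = 0"
    "transv u f \<in> H" "u \<noteq> 0" "f$3 \<noteq> 0" "u$3 = 0"
      and m: "m \<in> V" "m$3 = 0" "m \<noteq> 0" for u f m
  proof -
    let ?f = "f - f$3 *s e3"
    have fV: "?f \<in> V" using u by simp
    have "dot ?f u = 0" "dot ?f e3 = 0" using u by (simp_all add: dot_linear)
    moreover have "cross u e3 \<noteq> 0" using u by (auto simp: coords)
    ultimately obtain c where c: "c \<in> F" "?f = c *s cross u e3"
      using plane_covector[of u e3 ?f] u fV by auto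
    have "transv u ((- c) *s cross u e3) \<in> H" by (rule W) (use u c in auto)
    then have "transv u f ** transv u ((- c) *s cross u e3) \<in> H" using HS u by blast
    also have "transv u f ** transv u ((- c) *s cross u e3) = transv u (f + (- c) *s cross u e3)"
      by (rule transv_mult_center) (use u c in auto)
    also have "f + (- c) *s cross u e3 = f - ?f" unfolding c(2) by (simp add: vec_eq_iff)
    also have "\<dots> = f$3 *s e3" by simp
    finally have ts: "transv u (f$3 *s e3) \<in> H" .
    have "transv u (finv (f$3) *s (f$3 *s e3)) \<in> H"
      by (rule transv_multiple_mem(2)[OF H _ _ _ ts]) (use u finv(1)[of
        "f$3"] in \<open>auto simp: dot_linear\<close>)
    then have t: "transv u e3 \<in> H" using u finv(3)[of "f$3"] by (simp add: mat_vec_scale)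
    obtain s1 where s1: "s1 \<in> H" "s1 *v e1 = u" "s1 *v e3 = e3" "e3 v* s1 = e3"
      using block_transitive[OF H E] u by blast
    obtain s2 where s2: "s2 \<in> H" "s2 *v e1 = m" "s2 *v e3 = e3" "e3 v* s2 = e3"
      using block_transitive[OF H E m] by blast
    have S: "s1 \<in> carrier SL" "s2 \<in> carrier SL" using HS s1 s2 by auto
    have "inv' s1 *v u = e1" using SL_inv(4)[OF S(1), of e1] s1 by simp
    moreover have "e3 v* inv' (inv' s1) = e3" using s1 S by simp
    ultimately have "transv e1 e3 \<in> H" using transv_conj_mem[OF H HS(2)[OF s1(1)] t] u by simp
    moreover have "e3 v* inv' s2 = e3" using SL_inv(6)[OF S(2), of e3] s2 by simp
    ultimately show ?thesis using transv_conj_mem[OF H s2(1), of e1 e3] s2 by simp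
  qed
  have all: "transv m e3 \<in> H" if m: "m \<in> V" "m$3 = 0" "m \<noteq> 0" for m
  proof (cases "u$3 = 0")
    case True
    then show ?thesis using case1[OF t] m by blast
  next
    case False
    \<comment> \<open>A centre outside the plane is exchanged for \<open>?m\<close>, which lies in
      the plane and in the kernel of \<open>f\<close>. The block transvection \<open>?s\<close>
      centred at \<open>?m\<close> fixes \<open>f\<close> and moves \<open>u\<close> by a nonzero
      multiple of \<open>?m\<close>, so the conjugate of \<open>transv u f\<close> times its inverse
      is centred at \<open>?m\<close>.\<close>
    let ?m = "cross f e3"
    have mV: "?m \<in> V" "?m$3 = 0" using t by (simp_all add: cross_def)
    have m0: "?m \<noteq> 0"
    proof
      assume "?m = 0"
      then have "f$1 = 0" "f$2 = 0" using t by (auto simp: coords)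
      then have "f$3 * u$3 = 0" using t(3) by (simp add: dot_def)
      then show False using False t by simp
    qed
    let ?x = "cross ?m e3"
    have xV: "?x \<in> V" using mV by simp
    have xu: "dot ?x u = f$3 * u$3"
    proof -
      have "dot ?x u = dot (- f) u + f$3 * u$3" using t(1,2) by (simp add: coords algebra_simps)
      then show ?thesis using t by (simp add: dot_linear)
    qed
    have xm: "dot ?x ?m = 0" "dot f ?m = 0" by (simp_all add: dot_cross dot_commute[of f])
    let ?s = "transv ?m ?x"
    have s: "?s \<in> H" using W[OF mV m0, of e] xV by simp
    have "inv' ?s = transv ?m (- ?x)" using transv_inv mV xV xm by simp
    then have "f v* inv' ?s = f" using t xm by (simp add: transv_vec)
    then have "transv (u + dot ?x u *s ?m) f \<in> H"
      using transv_conj_mem[OF H s t(4) t(1,2)] t by (simp add: transv_vec)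
    moreover have "transv ((- e) *s u) f \<in> H" by (rule transv_multiple_mem[OF H]) (use t in
      auto)
    ultimately have "transv (u + dot ?x u *s ?m) f ** transv ((- e) *s u) f \<in> H" using HS
      by blast
    also have "transv (u + dot ?x u *s ?m) f ** transv ((- e) *s u) f =
      transv (u + dot ?x u *s ?m + (- e) *s u) f"
      by (rule transv_mult_axis) (use t mV xV in \<open>auto simp: dot_linear\<close>)
    also have "u + dot ?x u *s ?m + (- e) *s u = dot ?x u *s ?m"
      using t mV xV by (simp add: vec_eq_iff)
    finally have ts: "transv (dot ?x u *s ?m) f \<in> H" .
    have "transv (finv (dot ?x u) *s (dot ?x u *s ?m)) f \<in> H"
      by (rule transv_multiple_mem(1)[OF H _ _ _ ts]) (use t mV xV xu xm False finv(1)[of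
        "dot ?x u"] in \<open>auto simp: dot_linear\<close>)
    then have "transv ?m f \<in> H" using finv(3)[of "dot ?x u"] t xV xu False mV
      by (simp add: mat_vec_scale)
    then show ?thesis using case1[of ?m f m] t mV m0 xm m by blast
  qed
  show "transv (k *s e1) e3 \<in> H" "transv (k *s e2) e3 \<in> H"
    by (rule transv_multiple_mem(1)[OF H]; use all[of e1] all[of e2] k e123_nz in \<open>simp
      add: dot_def\<close>)+
qed

lemma transpose_SL: "A \<in> carrier SL \<Longrightarrow> transpose A \<in> carrier SL"
  by (simp add: carrier_SL det_transpose)

lemma transpose_inv_SL: "A \<in> carrier SL \<Longrightarrow> inv' (transpose A) =
  transpose (inv' A)"
proof (rule SL.inv_equality)
  assume A: "A \<in> carrier SL"
  have "transpose (inv' A) ** transpose A = transpose (A ** inv' A)"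
    by (simp only: matrix_transpose_mul)
  then show "transpose (inv' A) \<otimes>\<^bsub>SL\<^esub> transpose A =
    \<one>\<^bsub>SL\<^esub>" using A by (simp add: transpose_mat)
qed (auto intro: transpose_SL)

lemma transpose_transv: "transpose (transv u f) = transv f u"
  by (simp add: transv_def coords algebra_simps)

text \<open>Irreducibility conjugates \<open>transv e1 e2\<close> to a transvection whose covector
  involves \<open>e3\<close>, and \<open>block_extend\<close> yields the root groups in the last
  column. Those in the last row follow by duality.\<close>

lemma block_irreducible:
  assumes H: "subgroup H SL" and E: "\<And>k. k \<in> F \<Longrightarrow>
    transv (k *s e1) e2 \<in> H" "\<And>k. k \<in> F \<Longrightarrow> transv (k *s e2) e1 \<in> H"
    and acts_irred: "acts_irred H"
  shows "H = carrier SL"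
proof (rule elementary_generate[OF H E])
  note HS = subgroup_SL[OF H]
  have t: "transv e1 e2 \<in> H" using E(1)[of e] by simp
  obtain h where h: "h \<in> H" "dot e2 (h *v e3) \<noteq> 0"
    using acts_irredD[OF acts_irred, of e3 e2] e123_nz by auto
  have hS: "h \<in> carrier SL" using h HS by blast
  have t1: "transv (inv' h *v e1) (e2 v* h) \<in> H"
    using transv_conj_mem[OF H HS(2)[OF h(1)] t] hS by simp
  have d1: "dot (e2 v* h) (inv' h *v e1) = 0" using hS by (simp add: dot_vec_mul)
  have n1: "(e2 v* h)$3 \<noteq> 0" using h hS dot_e(3)[of "e2 v* h"] by (simp add: dot_vec_mul)
  show "transv (k *s e1) e3 \<in> H" "transv (k *s e2) e3 \<in> H" if "k \<in> F" for k
    using block_extend[OF H E _ _ d1 t1 _ n1 that] hS e123_nz by auto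
  \<comment> \<open>Transposition exchanges centres and axes, and the block is symmetric, so
    \<open>block_extend\<close> applies to the transposed subgroup as well.\<close>
  define T where "T = {x \<in> carrier SL. transpose x \<in> H}"
  have T: "subgroup T SL"
  proof (rule SL.subgroupI)
    show "T \<noteq> {}" unfolding T_def using HS(3)
      by (auto intro!: exI[of _ "mat e"] simp: transpose_mat)
  qed (auto simp: T_def transpose_inv_SL[symmetric] matrix_transpose_mul HS(1,2))
  have TE: "transv (k *s e1) e2 \<in> T" "transv (k *s e2) e1 \<in> T" if "k \<in> F" for k
  proof -
    have "transv (k *s e1) e2 \<in> carrier SL" "transv (k *s e2) e1 \<in> carrier SL"
      by (rule transv_SL; use that in \<open>simp add: dot_def\<close>)+
    then show "transv (k *s e1) e2 \<in> T" "transv (k *s e2) e1 \<in> T"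
      unfolding T_def using E that by (simp_all add: transpose_transv transv_scale[symmetric])
  qed
  obtain g where g: "g \<in> H" "dot e3 (g *v e1) \<noteq> 0"
    using acts_irredD[OF acts_irred, of e1 e3] e123_nz by auto
  have gS: "g \<in> carrier SL" using g HS by blast
  have t2: "transv (g *v e1) (e2 v* inv' g) \<in> H" using transv_conj_mem[OF H g(1) t] by simp
  have d2: "dot (g *v e1) (e2 v* inv' g) = 0"
    using dot_invariant[OF gS, of e1 e2] by (simp add: dot_commute)
  have t2T: "transv (e2 v* inv' g) (g *v e1) \<in> T"
    unfolding T_def using t2 d2 gS by (auto intro!: transv_SL simp: transpose_transv)
  have n2: "(g *v e1)$3 \<noteq> 0" using g gS dot_e(6)[of "g *v e1"] by simp
  have "transv (k *s e1) e3 \<in> T" "transv (k *s e2) e3 \<in> T" if "k \<in> F" for k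
    using block_extend[OF T TE _ _ d2 t2T _ n2 that] gS e123_nz by auto
  then show "transv (k *s e3) e1 \<in> H" "transv (k *s e3) e2 \<in> H" if "k \<in> F" for k
    unfolding T_def using that by (simp_all add: transpose_transv transv_scale)
qed

text \<open>Two transvections generate a block of type SL_2 as soon as neither centre lies on the
  axis of the other. The main work is to find such a pair in \<open>H\<close>.\<close>

theorem irreducible_with_transvection:
  assumes H: "subgroup H SL" and acts_irred: "acts_irred H"
    and t: "u \<in> V" "f \<in> V" "u \<noteq> 0" "f \<noteq> 0" "dot f u = 0" "transv u f \<in> H"
  shows "H = carrier SL"
proof -
  note HS = subgroup_SL[OF H]
  have "\<exists>w g. w \<in> V \<and> g \<in> V \<and> dot g w = 0 \<and>
    transv w g \<in> H \<and> dot f w \<noteq> 0 \<and> dot g u \<noteq> 0"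
  proof -
    obtain h where h: "h \<in> H" "dot f (h *v u) \<noteq> 0" using acts_irredD acts_irred t
      by blast
    have hS: "h \<in> carrier SL" using h HS by blast
    define w where "w = h *v u"
    define g where "g = f v* inv' h"
    have V: "w \<in> V" "g \<in> V" using hS t unfolding w_def g_def by auto
    have gw: "dot g w = 0" unfolding w_def g_def using dot_invariant[OF hS t(1)] t by simp
    have wg: "transv w g \<in> H" unfolding w_def g_def
      using transv_conj_mem[OF H h(1) t(6)] t by simp
    have fw: "dot f w \<noteq> 0" using h unfolding w_def by simp
    show ?thesis
    proof (cases "dot g u = 0")
      case False
      then show ?thesis using V gw wg fw by blast
    next
      case True
      \<comment> \<open>Only one of the two conditions holds. The commutator with \<open>?t\<close>
        then produces a transvection with centre \<open>u\<close> and covector \<open>g\<close>, and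
        its conjugate by \<open>h\<close> keeps the centre \<open>w\<close> but has the new covector
        \<open>g'\<close>.\<close>
      let ?t = "transv u f"
      have "inv' ?t = transv u (- f)" using transv_inv t by simp
      then have "g v* inv' ?t = g" using V True by (simp add: transv_vec)
      then have "transv (w + dot f w *s u) g \<in> H"
        using transv_conj_mem[OF H t(6) wg V] V by (simp add: transv_vec)
      moreover have "transv ((- e) *s w) g \<in> H"
        by (rule transv_multiple_mem[OF H]) (use V gw wg in auto)
      ultimately have "transv (w + dot f w *s u) g ** transv ((- e) *s w) g \<in> H" using HS
        by blast
      also have "transv (w + dot f w *s u) g ** transv ((- e) *s w) g =
        transv (w + dot f w *s u + (- e) *s w) g"
        by (rule transv_mult_axis) (use t V gw in \<open>auto simp: dot_linear\<close>)
      also have "w + dot f w *s u + (- e) *s w = dot f w *s u"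
        using t V by (simp add: vec_eq_iff)
      finally have ts: "transv (dot f w *s u) g \<in> H" .
      have "transv (finv (dot f w) *s (dot f w *s u)) g \<in> H"
        by (rule transv_multiple_mem(1)[OF H _ _ _ ts]) (use t V fw True finv(1)[of
          "dot f w"] in \<open>auto simp: dot_linear\<close>)
      then have ug: "transv u g \<in> H" using finv(3)[of "dot f w"] t V fw
        by (simp add: mat_vec_scale)
      define g' where "g' = g v* inv' h"
      have g': "g' \<in> V" "dot g' w = 0" "transv w g' \<in> H"
        unfolding g'_def w_def using hS V dot_invariant[OF hS t(1),
          of g] True transv_conj_mem[OF H h(1) ug t(1) V(2)] by auto
      have c0: "cross u w \<noteq> 0"
      proof
        assume "cross u w = 0"
        then obtain k where "k \<in> F" "w = k *s u" using cross_eq_0 t V by blast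
        then show False using fw t by (simp add: dot_linear)
      qed
      \<comment> \<open>If \<open>g'\<close> failed too, then \<open>g\<close> and \<open>g'\<close>
        would both kill \<open>u\<close> and \<open>w\<close> and be proportional; undoing
        \<open>h\<close> would make \<open>g\<close> proportional to \<open>f\<close>, although
        \<open>g\<close> vanishes at \<open>w\<close> and \<open>f\<close> does not.\<close>
      have "dot g' u \<noteq> 0"
      proof
        assume "dot g' u = 0"
        then obtain b where b: "b \<in> F" "g' = b *s cross u w"
          using plane_covector[OF t(1) V(1) c0 g'(1)] g' by blast
        obtain a where a: "a \<in> F" "g = a *s cross u w"
          using plane_covector[OF t(1) V(1) c0 V(2)] True gw by blast
        have "g \<noteq> 0" unfolding g_def using hS t by simp
        then have "a \<noteq> 0" using a by auto
        then have "g' = (b * finv a) *s g" unfolding b(2) a(2) using a b finv(3)[of a]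
          by (simp add: mat_vec_scale mult.assoc)
        then have "g' v* h = (b * finv a) *s (g v* h)" by (simp add: mat_vec_scale)
        then have gf: "g = (b * finv a) *s f" unfolding g'_def using hS V t by (simp add: g_def)
        then have "(b * finv a) * dot f w = 0" using gw by (simp add: dot_linear)
        then have "b * finv a = 0" using F_no_zero_div[of "b * finv a"
          "dot f w"] a b \<open>a \<noteq> 0\<close> finv(1)[of a] t V fw by auto
        then have "g = 0" using gf by (simp add: vec_eq_iff)
        then show False using \<open>g \<noteq> 0\<close> by simp
      qed
      then show ?thesis using g' V fw by blast
    qed
  qed
  then obtain w g where wg: "w \<in> V" "g \<in> V" "dot g w = 0" "transv w g \<in> H"
    "dot f w \<noteq> 0" "dot g u \<noteq> 0" by blast
  \<comment> \<open>The intersection of the two axes completes \<open>u\<close>, \<open>w\<close> to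
    a basis in which the two transvections generate the block on the first two coordinates.\<close>
  let ?z = "cross f g"
  have zV: "?z \<in> V" using t wg by simp
  have d: "dot (cross u w) ?z = - (dot g u * dot f w)"
    using t wg by (simp add: dot_cross_cross dot_commute[of u] dot_commute[of w])
  have dF: "dot (cross u w) ?z \<in> F" "dot (cross u w) ?z \<noteq> 0" using t wg d by auto
  let ?y = "finv (dot (cross u w) ?z) *s ?z"
  have yV: "?y \<in> V" using zV finv(1)[OF dF] by simp
  have fy: "dot f ?y = 0" "dot g ?y = 0"
    by (simp_all add: dot_linear dot_commute[of _ "cross f g"] dot_cross)
  let ?c = "cols u w ?y"
  have c: "?c \<in> carrier SL"
    by (rule cols_SL) (use t wg yV finv(3)[OF dF] in \<open>auto simp: dot_linear\<close>)
  have ic: "inv' ?c \<in> carrier SL" using c by simp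
  let ?K = "{x \<in> carrier SL. ?c \<otimes>\<^bsub>SL\<^esub> x \<otimes>\<^bsub>SL\<^esub>
    inv' ?c \<in> H}"
  have "?K = carrier SL"
  proof (rule block_irreducible)
    show "subgroup ?K SL" using SL.conj_closed_subgroup[OF H c] .
    have cov: "h v* inv' ?c = finv k *s l" if "l v* ?c = k *s h" "k \<in> F" "k \<noteq> 0"
      "h \<in> V" "l \<in> V" for h l k
    proof -
      have "l = (l v* ?c) v* inv' ?c" using SL_inv(6)[OF c that(5)] by (rule sym)
      also have "\<dots> = k *s (h v* inv' ?c)" unfolding that(1) by (simp add: mat_vec_scale)
      finally have "finv k *s l = finv k *s (k *s (h v* inv' ?c))" by (rule arg_cong)
      also have "\<dots> = h v* inv' ?c" using finv(3)[of k] that ic by (simp add: mat_vec_scale)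
      finally show ?thesis by simp
    qed
    have f2: "e2 v* inv' ?c = finv (dot f w) *s f"
      by (rule cov) (use t wg fy in \<open>auto simp: cols_mul vec_eq_iff forall_3\<close>)
    have g1: "e1 v* inv' ?c = finv (dot g u) *s g"
      by (rule cov) (use t wg fy in \<open>auto simp: cols_mul vec_eq_iff forall_3\<close>)
    show "transv (k *s e1) e2 \<in> ?K" if "k \<in> F" for k
    proof -
      have "transv (k *s e1) e2 \<in> carrier SL" by (rule transv_SL) (use that in \<open>auto
        simp: dot_def\<close>)
      moreover have "transv (k *s u) (finv (dot f w) *s f) \<in> H"
        unfolding transv_scale mat_vec_scale(3)
        by (rule transv_multiple_mem[OF H]) (use t wg that finv(1)[of "dot f w"] in auto)
      ultimately show ?thesis
        using transv_conj[OF c, of "k *s e1" e2] that cols_e(1)[OF t(1) wg(1) yV] f2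
          by (simp add: mat_vec_scale)
    qed
    show "transv (k *s e2) e1 \<in> ?K" if "k \<in> F" for k
    proof -
      have "transv (k *s e2) e1 \<in> carrier SL" by (rule transv_SL) (use that in \<open>auto
        simp: dot_def\<close>)
      moreover have "transv (k *s w) (finv (dot g u) *s g) \<in> H"
        unfolding transv_scale mat_vec_scale(3)
        by (rule transv_multiple_mem[OF H]) (use t wg that finv(1)[of "dot g u"] in auto)
      ultimately show ?thesis
        using transv_conj[OF c, of "k *s e2" e1] that cols_e(2)[OF t(1) wg(1) yV] g1
          by (simp add: mat_vec_scale)
    qed
    show "acts_irred ?K"
      unfolding acts_irred_def
    proof (intro ballI impI)
      fix v l assume v: "v \<in> V" "l \<in> V" "v \<noteq> 0" "l \<noteq> 0"
      obtain h where h: "h \<in> H" "dot (l v* inv' ?c) (h *v (?c *v v)) \<noteq> 0"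
        using acts_irredD[OF acts_irred, of "?c *v v" "l v* inv' ?c"] v c ic by auto
      have hS: "h \<in> carrier SL" using h HS by blast
      let ?h = "inv' ?c ** h ** ?c"
      have "?c ** ?h ** inv' ?c = (?c ** inv' ?c) ** h ** (?c ** inv' ?c)"
        by (simp only: matrix_mul_assoc)
      then have "?h \<in> ?K" using c ic hS h by simp
      moreover have "dot l (?h *v v) \<noteq> 0"
        using h(2) by (simp add: dot_vec_mul matrix_vector_mul_assoc[symmetric])
      ultimately show "\<exists>h\<in>?K. dot l (h *v v) \<noteq> 0" by blast
    qed
  qed
  moreover have "inv' ?c ** x ** ?c \<in> carrier SL" if "x \<in> carrier SL" for x
    using c ic that by simp
  ultimately have "?c ** (inv' ?c ** x ** ?c) ** inv' ?c \<in> H" if "x \<in> carrier SL"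
    for x using that by auto
  moreover have "?c ** (inv' ?c ** x ** ?c) ** inv' ?c =
    (?c ** inv' ?c) ** x ** (?c ** inv' ?c)" for x
    by (simp only: matrix_mul_assoc)
  ultimately have "x \<in> H" if "x \<in> carrier SL" for x using c that by simp
  then show ?thesis using HS(4) by blast
qed

end

section \<open>Regularity number and reducible subgroups\<close>

lemma (in group) one_conj_inter:
  assumes "\<And>i. i < k \<Longrightarrow> subgroup (H i) G"
    "\<And>i. i < k \<Longrightarrow> g i \<in> carrier G"
  shows "\<one> \<in> conj_inter G k H g"
proof -
  have "\<one> \<in> conjugate G (H i) (g i)" if "i < k" for i
    using mem_conjugate_iff[OF assms(1,2)[OF that], of \<one>] subgroup.one_closed[OF assms(1)[OF
      that]] assms(2)[OF that]
    by simp
  then show ?thesis unfolding conj_inter_def by auto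
qed

lemma (in group) regular_tuple_mono:
  assumes "regular_tuple G k H" "k \<le> l" "\<And>i. i < l \<Longrightarrow> subgroup (H i) G"
  shows "regular_tuple G l H"
proof -
  obtain g where g: "\<forall>i<k. g i \<in> carrier G" "conj_inter G k H g = {\<one>}"
    using assms(1) unfolding regular_tuple_def by blast
  define g' where "g' i = (if i < k then g i else \<one>)" for i
  have g': "g' i \<in> carrier G" for i using g unfolding g'_def by simp
  have "conj_inter G l H g' \<subseteq> conj_inter G k H g"
    using assms(2) unfolding conj_inter_def g'_def by (fastforce intro: less_le_trans)
  moreover have "\<one> \<in> conj_inter G l H g'"
    by (rule one_conj_inter) (use assms(3) g' in auto)
  ultimately have "conj_inter G l H g' = {\<one>}" using g by blast
  then show ?thesis using g' unfolding regular_tuple_def by blast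
qed

lemma (in simple_group) core_free_iff: "core_free G H \<longleftrightarrow> subgroup H G \<and>
  H \<noteq> carrier G"
proof
  assume "core_free G H"
  moreover have "carrier G \<lhd> G"
    by (auto simp: normal_inv_iff subgroup_self)
  ultimately show "subgroup H G \<and> H \<noteq> carrier G"
    using simple_not_triv unfolding core_free_def by blast
next
  assume H: "subgroup H G \<and> H \<noteq> carrier G"
  show "core_free G H"
    unfolding core_free_def
  proof (intro conjI allI impI)
    fix N assume N: "N \<lhd> G \<and> N \<subseteq> H"
    then have "N \<noteq> carrier G" using H subgroup.subset by blast
    then show "N = {\<one>}" using N no_real_normal_subgroup by blast
  qed (use H in blast)
qed

context prime_ideal
begin

lemma eigen_inv:
  assumes g: "g \<in> carrier SL" and "u \<in> V" "u \<noteq> 0" "k \<in> F"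
  shows "g *v u = k *s u \<Longrightarrow> inv' g *v u = finv k *s u \<and> finv k \<in> F"
    "u v* g = k *s u \<Longrightarrow> u v* inv' g = finv k *s u \<and> finv k \<in> F"
proof -
  have ig: "inv' g \<in> carrier SL" using g by simp
  show "inv' g *v u = finv k *s u \<and> finv k \<in> F" if eq: "g *v u = k *s u"
  proof -
    have k: "k \<noteq> 0" using eq SL_vec_0[OF g, of u] assms by auto
    have "u = inv' g *v (g *v u)" using SL_inv(4)[OF g assms(2)] by (rule sym)
    also have "\<dots> = k *s (inv' g *v u)" unfolding eq by (simp add: mat_vec_scale)
    finally have "finv k *s u = finv k *s (k *s (inv' g *v u))" by (rule arg_cong)
    then show ?thesis using finv(1,3)[OF assms(4) k] ig assms(2) by (simp add: mat_vec_scale)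
  qed
  show "u v* inv' g = finv k *s u \<and> finv k \<in> F" if eq: "u v* g = k *s u"
  proof -
    have k: "k \<noteq> 0" using eq SL_covec_0[OF g, of u] assms by auto
    have "u = (u v* g) v* inv' g" using SL_inv(6)[OF g assms(2)] by (rule sym)
    also have "\<dots> = k *s (u v* inv' g)" unfolding eq by (simp add: mat_vec_scale)
    finally have "finv k *s u = finv k *s (k *s (u v* inv' g))" by (rule arg_cong)
    then show ?thesis using finv(1,3)[OF assms(4) k] ig assms(2) by (simp add: mat_vec_scale)
  qed
qed

lemma subgroup_point_stab:
  assumes "u \<in> V" "u \<noteq> 0"
  shows "subgroup (point_stab u) SL" "subgroup (line_stab u) SL"
proof -
  show "subgroup (point_stab u) SL"
  proof (rule SL.subgroupI)
    show "point_stab u \<noteq> {}" unfolding point_stab_def using assms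
      by (auto intro!: exI[of _ "mat e"] bexI[of _ e])
    show "inv' a \<in> point_stab u" if "a \<in> point_stab u" for a
      using that eigen_inv(1)[OF _ assms] unfolding point_stab_def by auto
    show "a \<otimes>\<^bsub>SL\<^esub> b \<in> point_stab u"
      if ab: "a \<in> point_stab u" "b \<in> point_stab u" for a b
    proof -
      obtain j k where jk: "j \<in> F" "k \<in> F" "a *v u = j *s u" "b *v u = k *s u"
        "a \<in> carrier SL" "b \<in> carrier SL"
        using ab unfolding point_stab_def by blast
      then have "(a ** b) *v u = (k * j) *s u" by (simp add: matrix_vector_mul_assoc[symmetric]
        mat_vec_scale)
      then show ?thesis unfolding point_stab_def using jk by (auto intro!: bexI[of _ "k * j"])
    qed
  qed (auto simp: point_stab_def)
  show "subgroup (line_stab u) SL"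
  proof (rule SL.subgroupI)
    show "line_stab u \<noteq> {}" unfolding line_stab_def using assms
      by (auto intro!: exI[of _ "mat e"] bexI[of _ e])
    show "inv' a \<in> line_stab u" if "a \<in> line_stab u" for a
      using that eigen_inv(2)[OF _ assms] unfolding line_stab_def by auto
    show "a \<otimes>\<^bsub>SL\<^esub> b \<in> line_stab u"
      if ab: "a \<in> line_stab u" "b \<in> line_stab u" for a b
    proof -
      obtain j k where jk: "j \<in> F" "k \<in> F" "u v* a = j *s u" "u v* b = k *s u"
        "a \<in> carrier SL" "b \<in> carrier SL"
        using ab unfolding line_stab_def by blast
      then have "u v* (a ** b) = (j * k) *s u" by (simp add: vector_matrix_mul_assoc[symmetric]
        mat_vec_scale)
      then show ?thesis unfolding line_stab_def using jk by (auto intro!: bexI[of _ "j * k"])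
    qed
  qed (auto simp: line_stab_def)
qed

lemma point_stab_proper: "point_stab e1 \<noteq> carrier SL" "line_stab e1 \<noteq> carrier SL"
proof -
  have "transv e2 e1 \<in> carrier SL" "transv e1 e2 \<in> carrier SL" by (rule transv_SL; simp)+
  moreover have "transv e2 e1 \<notin> point_stab e1" "transv e1 e2 \<notin> line_stab e1"
    unfolding point_stab_def line_stab_def using nz by (auto simp: transv_vec vec_eq_iff forall_3)
  ultimately show "point_stab e1 \<noteq> carrier SL" "line_stab e1 \<noteq> carrier SL" by auto
qed

text \<open>With the convention that a conjugate is \<open>inv g H g\<close>, the conjugated
  stabilizers belong to the point \<open>inv' g *v e1\<close> and to the line
  \<open>e1 v* g\<close>.\<close>

lemma mem_conjugate_point_stab:
  assumes "g \<in> carrier SL" "x \<in> carrier SL" "k \<in> F"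
  shows "x *v (inv' g *v e1) = k *s (inv' g *v e1) \<Longrightarrow>
    x \<in> conjugate SL (point_stab e1) g"
    "(e1 v* g) v* x = k *s (e1 v* g) \<Longrightarrow> x \<in> conjugate SL (line_stab e1) g"
proof -
  have ig: "inv' g \<in> carrier SL" using assms by simp
  show "x \<in> conjugate SL (point_stab e1) g" if "x *v (inv' g *v e1) = k *s (inv' g *v e1)"
  proof -
    have "(g ** x ** inv' g) *v e1 = k *s e1"
      using that assms by (simp add: matrix_vector_mul_assoc[symmetric] mat_vec_scale)
    then have "g ** x ** inv' g \<in> point_stab e1" unfolding point_stab_def using assms ig by auto
    then show ?thesis using SL.mem_conjugate_iff[OF subgroup_point_stab(1)] assms e123_nz by simp
  qed
  show "x \<in> conjugate SL (line_stab e1) g" if "(e1 v* g) v* x = k *s (e1 v* g)"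
  proof -
    have "e1 v* (g ** x ** inv' g) = k *s e1"
      using that assms by (simp add: vector_matrix_mul_assoc[symmetric] mat_vec_scale)
    then have "g ** x ** inv' g \<in> line_stab e1" unfolding line_stab_def using assms ig by auto
    then show ?thesis using SL.mem_conjugate_iff[OF subgroup_point_stab(2)] assms e123_nz by simp
  qed
qed

end

context prime_ideal_2_mod_3
begin

text \<open>The element has the line through the two points as axis and the common point of the two
  lines as centre. It is a transvection or a scaled homology, according to whether the centre lies
  on the axis.\<close>

lemma two_points_two_lines:
  assumes V: "u1 \<in> V" "u2 \<in> V" "f1 \<in> V" "f2 \<in> V" and "u1 \<noteq> 0"
  shows "\<exists>x\<in>carrier SL. x \<noteq> mat e \<and> (\<exists>k\<in>F. x *v u1 =
    k *s u1 \<and> x *v u2 = k *s u2 \<and> f1 v* x = k *s f1 \<and> f2 v* x = k *s f2)"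
proof -
  obtain f where f: "f \<in> V" "f \<noteq> 0" "dot f u1 = 0" "dot f u2 = 0"
    using exists_perp2[OF V(1,2)] by blast
  obtain w where w: "w \<in> V" "w \<noteq> 0" "dot f1 w = 0" "dot f2 w = 0"
    using exists_perp2[OF V(3,4)] dot_commute by metis
  show ?thesis
  proof (cases "dot f w = 0")
    case True
    show ?thesis
      by (rule bexI[of _ "transv w f"]) (use True f w V in \<open>auto simp: transv_eq_one
        transv_vec intro: transv_SL intro!: bexI[of _ e]\<close>)
  next
    case False
    \<comment> \<open>Any scalar other than \<open>0\<close> and \<open>e\<close> would do.\<close>
    define a where "a = e + e"
    have a: "a \<in> F" "a \<noteq> 0" "a \<noteq> e" unfolding a_def
      using two_nz nz add_F[OF e_F e_F] by simp_all
    \<comment> \<open>Solves \<open>a * a * a + a * a * dot f w * m = e\<close>, which is the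
      condition that the determinant be \<open>e\<close>.\<close>
    define m where "m = finv (a * a * dot f w) * (e - a * a * a)"
    have d: "a * a * dot f w \<in> F" "a * a * dot f w \<noteq> 0" using a f w False by auto
    have m: "m \<in> F" unfolding m_def using finv(1)[OF d] a by simp
    let ?x = "mat a + outer (m *s w) f"
    have "det ?x = a * a * a + (a * a * dot f w) * m"
      by (simp add: det_mat_outer dot_linear algebra_simps)
    also have "(a * a * dot f w) * m = (a * a * dot f w * finv (a * a * dot f w)) * (e - a * a * a)"
      unfolding m_def by (simp only: mult.assoc)
    also have "\<dots> = e - a * a * a" using finv(2)[OF d] a by simp
    finally have x: "?x \<in> carrier SL" using a m f w by (simp add: carrier_SL)
    have vec: "?x *v v = a *s v" if "v \<in> V" "dot f v = 0" for v
      using that by (simp add: matrix_vector_mult_add_rdistrib outer_mul_vec) (simp add: coords)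
    have covec: "g v* ?x = a *s g" if "g \<in> V" "dot g w = 0" for g
      using that by (simp add: vector_matrix_mult_add_rdistrib outer_mul_vec dot_linear) (simp
        add: coords)
    have "?x \<noteq> mat e"
    proof
      assume "?x = mat e"
      then have "a *s u1 = e *s u1" using vec[OF V(1) f(3)] V by simp
      then have "(a - e) *s u1 = 0" by (simp add: vec_eq_iff left_diff_distrib)
      then show False using a assms(5) V by simp
    qed
    then show ?thesis using x vec covec a V f w by (intro bexI[OF _ x]) auto
  qed
qed

lemma regularity_number_SL: "regularity_number SL > 4"
proof (rule ccontr)
  assume "\<not> regularity_number SL > 4"
  then have le: "regularity_number SL \<le> 4" by simp
  define H where "H i = (if i < (2::nat) then point_stab e1 else line_stab e1)" for i
  have sub: "subgroup (H i) SL" for i using subgroup_point_stab e123_nz unfolding H_def by simp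
  have cf: "core_free SL (H i)" for i
    using simple_group.core_free_iff[OF simple_SL] sub point_stab_proper unfolding H_def by simp
  have "regular_tuple SL (regularity_number SL) H"
    using SL.regularity_number_attained(2)[OF finite_SL] cf by blast
  then have "regular_tuple SL 4 H" using SL.regular_tuple_mono le sub by blast
  then obtain g where g: "\<forall>i<4. g i \<in> carrier SL"
    and triv: "conj_inter SL 4 H g = {mat e}"
    unfolding regular_tuple_def by auto
  have gS: "g 0 \<in> carrier SL" "g 1 \<in> carrier SL" "g 2 \<in> carrier SL"
    "g 3 \<in> carrier SL" using g by auto
  have V: "inv' g 0 *v e1 \<in> V" "inv' g 1 *v e1 \<in> V" "e1 v* g 2 \<in> V"
    "e1 v* g 3 \<in> V" "inv' g 0 *v e1 \<noteq> 0"
    using gS e123_nz by simp_all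
  obtain x k where x: "x \<in> carrier SL" "x \<noteq> mat e" and k: "k \<in> F"
    "x *v (inv' g 0 *v e1) = k *s (inv' g 0 *v e1)" "x *v (inv' g 1 *v e1) = k *s (inv' g 1 *v e1)"
    "(e1 v* g 2) v* x = k *s (e1 v* g 2)" "(e1 v* g 3) v* x = k *s (e1 v* g 3)"
    using two_points_two_lines[OF V] by blast
  have "x \<in> conjugate SL (H i) (g i)" if "i < 4" for i
  proof -
    have "i = 0 \<or> i = 1 \<or> i = 2 \<or> i = 3" using that by auto
    then show ?thesis using mem_conjugate_point_stab[OF _ x(1) k(1)] gS k unfolding H_def by auto
  qed
  then have "x \<in> conj_inter SL 4 H g" using x unfolding conj_inter_def by auto
  then show False using triv x by simp
qed

lemma regular_tupleI:
  assumes H: "subgroup H SL" and g: "\<And>i. i < k \<Longrightarrow> g i \<in> carrier SL"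
    and "\<And>x. x \<in> carrier SL \<Longrightarrow> (\<And>i. i < k \<Longrightarrow>
      g i ** x ** inv' (g i) \<in> H) \<Longrightarrow> x = mat e"
  shows "regular_tuple SL k (\<lambda>_. H)"
proof -
  have "conj_inter SL k (\<lambda>_. H) g \<subseteq> {mat e}"
  proof
    fix x assume x: "x \<in> conj_inter SL k (\<lambda>_. H) g"
    then have xS: "x \<in> carrier SL" unfolding conj_inter_def by simp
    have "g i ** x ** inv' (g i) \<in> H" if "i < k" for i
      using x that SL.mem_conjugate_iff[OF H g[OF that] xS] unfolding conj_inter_def by auto
    then show "x \<in> {mat e}" using assms(3) xS by blast
  qed
  moreover have "\<one>\<^bsub>SL\<^esub> \<in> conj_inter SL k (\<lambda>_. H) g"
    by (rule SL.one_conj_inter) (use H g in auto)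
  ultimately have "conj_inter SL k (\<lambda>_. H) g = {\<one>\<^bsub>SL\<^esub>}" by auto
  then show ?thesis using g unfolding regular_tuple_def by blast
qed

text \<open>A projective frame: four points, no three on a line. The constant continuation from
  index 3 on keeps every value nonzero.\<close>

definition frame :: "nat \<Rightarrow> 'a^3" where
  "frame i = (if i = 0 then e1 else if i = 1 then e2 else if i = 2 then e3 else e1 + e2 + e3)"

lemma frame: "frame i \<in> V" "frame i \<noteq> 0"
  unfolding frame_def using nz by (auto simp: vec_eq_iff forall_3)

text \<open>The three coordinate points make \<open>x\<close> diagonal, the fourth makes it scalar,
  and \<open>cube_root_one\<close> finishes.\<close>

lemma frame_stabilizer:
  assumes "x \<in> carrier SL" and "\<And>i. i < 4 \<Longrightarrow>
    \<exists>k\<in>F. x *v frame i = k *s frame i"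
  shows "x = mat e"
proof -
  have m: "x \<in> Mt" "det x = e" using assms by (auto simp: carrier_SL)
  obtain a b c d where k: "a \<in> F" "b \<in> F" "c \<in> F" "d \<in> F"
    "x *v e1 = a *s e1" "x *v e2 = b *s e2" "x *v e3 = c *s e3"
      "x *v (e1 + e2 + e3) = d *s (e1 + e2 + e3)"
    using assms(2)[of 0] assms(2)[of 1] assms(2)[of 2] assms(2)[of 3] unfolding frame_def by auto
  have 1: "x$1$1 = a" "x$2$1 = 0" "x$3$1 = 0" "x$1$2 = 0" "x$2$2 = b" "x$3$2 = 0" "x$1$3 = 0"
    "x$2$3 = 0" "x$3$3 = c"
    using k m by (simp_all add: vec_eq_iff forall_3 matrix_vector_mult_def sum_3)
  have 2: "a = d" "b = d" "c = d"
    using k(8) 1 k(1-4) by (simp_all add: vec_eq_iff forall_3 matrix_vector_mult_def sum_3)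
  have "d * d * d = e" using m(2) 1 2 by (simp add: det_3)
  then have "d = e" using cube_root_one k(4) by blast
  then show ?thesis using 1 2 by (simp add: coords)
qed

text \<open>As \<open>SL\<close> is transitive on nonzero vectors, the four conjugates can be made
  to fix the four points of the frame. The case of a line is the transposed one.\<close>

lemma reducible_regular:
  assumes H: "subgroup H SL" and u: "u \<in> V" "u \<noteq> 0"
    and "H \<subseteq> point_stab u \<or> H \<subseteq> line_stab u"
  shows "regular_tuple SL 4 (\<lambda>_. H)"
proof -
  have trans: "\<exists>g\<in>carrier SL. g *v v = w" if v: "v \<in> V" "v \<noteq> 0"
    and w: "w \<in> V" "w \<noteq> 0" for v w
  proof -
    obtain g h where gh: "g \<in> carrier SL" "g *v e1 = v" "h \<in> carrier SL" "h *v e1 = w"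
      using SL_transitive[OF v] SL_transitive[OF w] by blast
    have "inv' g *v v = e1" using SL_inv(4)[OF gh(1), of e1] gh by simp
    then have "(h ** inv' g) *v v = w" using gh by (simp add: matrix_vector_mul_assoc[symmetric])
    moreover have "h ** inv' g \<in> carrier SL" using gh by simp
    ultimately show ?thesis by blast
  qed
  from assms(4) show ?thesis
  proof
    assume sub: "H \<subseteq> point_stab u"
    have "\<exists>g\<in>carrier SL. g *v frame i = u" for i by (rule trans) (use frame u in auto)
    then obtain g where g: "\<And>i. g i \<in> carrier SL" "\<And>i. g i *v frame i = u" by metis
    show ?thesis
    proof (rule regular_tupleI[OF H g(1)])
      fix x assume x: "x \<in> carrier SL" "\<And>i. i < 4 \<Longrightarrow>
        g i ** x ** inv' (g i) \<in> H"
      show "x = mat e"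
      proof (rule frame_stabilizer[OF x(1)])
        fix i :: nat assume "i < 4"
        then obtain k where k: "k \<in> F" "(g i ** x ** inv' (g i)) *v u = k *s u"
          using x(2)[of i] sub unfolding point_stab_def by blast
        have iu: "inv' (g i) *v u = frame i" using SL_inv(4)[OF g(1) frame(1), of i i]
          unfolding g(2) .
        have xf: "x *v frame i \<in> V" using x frame by simp
        have "x *v frame i = inv' (g i) *v (g i *v (x *v (inv' (g i) *v u)))"
          unfolding iu using SL_inv(4)[OF g(1) xf] by simp
        also have "\<dots> = inv' (g i) *v (k *s u)" unfolding k(2)[symmetric]
          by (simp add: matrix_vector_mul_assoc matrix_mul_assoc)
        also have "\<dots> = k *s frame i" by (simp add: mat_vec_scale iu)
        finally show "\<exists>k\<in>F. x *v frame i = k *s frame i" using k by blast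
      qed
    qed
  next
    assume sub: "H \<subseteq> line_stab u"
    have "\<exists>g\<in>carrier SL. u v* g = frame i" for i
    proof -
      obtain h where "h \<in> carrier SL" "h *v u = frame i" using trans[OF u frame] by blast
      then show ?thesis by (intro bexI[of _ "transpose h"]) (auto simp: vec_mul_transpose
        transpose_SL)
    qed
    then obtain g where g: "\<And>i. g i \<in> carrier SL" "\<And>i. u v* g i = frame i" by metis
    show ?thesis
    proof (rule regular_tupleI[OF H g(1)])
      fix x assume x: "x \<in> carrier SL" "\<And>i. i < 4 \<Longrightarrow>
        g i ** x ** inv' (g i) \<in> H"
      have "transpose x = mat e"
      proof (rule frame_stabilizer[OF transpose_SL[OF x(1)]])
        fix i :: nat assume "i < 4"
        then obtain k where k: "k \<in> F" "u v* (g i ** x ** inv' (g i)) = k *s u"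
          using x(2)[of i] sub unfolding line_stab_def by blast
        have xf: "frame i v* x \<in> V" using x frame by simp
        have "frame i v* x = (u v* (g i ** x ** inv' (g i))) v* g i"
          using SL_inv(5)[OF g(1) xf] g(2)[of i] by (simp add: vector_matrix_mul_assoc[symmetric])
        also have "\<dots> = k *s frame i" unfolding k(2) by (simp add: mat_vec_scale g(2))
        finally show "\<exists>k\<in>F. transpose x *v frame i = k *s frame i" using k
          by (auto simp: vec_mul_transpose)
      qed
      then have "transpose (transpose x) = transpose (mat e)" by simp
      then show "x = mat e" by (simp add: transpose_mat)
    qed
  qed
qed

end

text \<open>The equation of the spherical triangle groups: the triple (2, 2, m) gives
  \<open>N = 2 * m\<close>, and (2, 3, 3), (2, 3, 4), (2, 3, 5) give 12, 24 and 60.\<close>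

lemma three_term_bound:
  fixes m1 m2 m3 N :: nat
  assumes "2 \<le> m1" "m1 \<le> m2" "m2 \<le> m3" "0 < N" "1 / real m1 + 1 / real m2 + 1 / real
    m3 = 1 + 2 / real N"
  shows "N \<le> max 60 (2 * m3)"
proof -
  have pos: "2 / real N > 0" using assms by simp
  have a: "1 / real m2 \<le> 1 / real m1" "1 / real m3 \<le> 1 / real m2"
    using assms by (simp_all add: frac_le)
  have "m1 = 2"
  proof (rule ccontr)
    assume "m1 \<noteq> 2"
    then have "1 / real m1 \<le> 1 / 3" using assms by (intro frac_le) auto
    then show False using a assms(5) pos by linarith
  qed
  then have m1: "1 / real m1 = 1 / 2" by simp
  consider "m2 = 2" | "m2 = 3" | "m2 \<ge> 4" using assms \<open>m1 = 2\<close> by linarith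
  then show ?thesis
  proof cases
    case 1
    then have "1 / real m3 = 2 / real N" using assms(5) m1 by simp
    then have "real N = 2 * real m3" using assms by (simp add: field_simps)
    then show ?thesis by linarith
  next
    case 2
    then have eq: "1 / real m3 = 1 / 6 + 2 / real N" using assms(5) m1 by simp
    then have "1 / real m3 > 1 / 6" using pos by simp
    then have "m3 < 6" using assms by (simp add: field_simps)
    then have "m3 = 3 \<or> m3 = 4 \<or> m3 = 5" using assms 2 by linarith
    then show ?thesis using eq assms(4) by (auto simp: field_simps)
  next
    case 3
    then have "1 / real m2 \<le> 1 / 4" by (intro frac_le) auto
    then show ?thesis using a(2) assms(5) m1 pos by linarith
  qed
qed

lemma three_term_bound_unsorted:
  fixes m1 m2 m3 N M :: nat
  assumes "2 \<le> m1" "2 \<le> m2" "2 \<le> m3" "m1 \<le> M" "m2 \<le> M" "m3 \<le> M" "0 < N"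
    "1 / real m1 + 1 / real m2 + 1 / real m3 = 1 + 2 / real N"
  shows "N \<le> max 60 (2 * M)"
proof -
  have *: "N \<le> max 60 (2 * M)" if "2 \<le> a" "a \<le> b" "b \<le> c" "c \<le> M"
    "1 / real a + 1 / real b + 1 / real c = 1 + 2 / real N" for a b c
    using three_term_bound[of a b c N] that assms(7) by auto
  consider "m1 \<le> m2 \<and> m2 \<le> m3" | "m1 \<le> m3 \<and> m3 \<le> m2" |
    "m2 \<le> m1 \<and> m1 \<le> m3"
    | "m2 \<le> m3 \<and> m3 \<le> m1" | "m3 \<le> m1 \<and> m1 \<le> m2" |
      "m3 \<le> m2 \<and> m2 \<le> m1" by linarith
  then show ?thesis
  proof cases
    case 1 show ?thesis by (rule *[of m1 m2 m3]) (use assms 1 in auto)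
  next
    case 2 show ?thesis by (rule *[of m1 m3 m2]) (use assms 2 in auto)
  next
    case 3 show ?thesis by (rule *[of m2 m1 m3]) (use assms 3 in auto)
  next
    case 4 show ?thesis by (rule *[of m2 m3 m1]) (use assms 4 in auto)
  next
    case 5 show ?thesis by (rule *[of m3 m1 m2]) (use assms 5 in auto)
  next
    case 6 show ?thesis by (rule *[of m3 m2 m1]) (use assms 6 in auto)
  qed
qed

text \<open>Either \<open>m1 = 2\<close> and \<open>N = 2 * m2\<close>, or \<open>m1 = 3\<close>,
  \<open>m2 = 2\<close> and \<open>N = 12\<close>, the tetrahedral case.\<close>

lemma two_term_bound:
  fixes m1 m2 N :: nat
  assumes "2 \<le> m1" "2 \<le> m2" "0 < N" "1 / real m1 + 1 / (2 * real m2) = 1 / 2 + 1 / real N"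
  shows "N \<le> max 60 (2 * m2)"
proof -
  have pos: "1 / real N > 0" using assms by simp
  consider "m1 = 2" | "m1 = 3" | "m1 \<ge> 4" using assms by linarith
  then show ?thesis
  proof cases
    case 1
    then have "1 / (2 * real m2) = 1 / real N" using assms(4) by simp
    then have "real N = 2 * real m2" using assms by (simp add: field_simps)
    then show ?thesis by linarith
  next
    case 2
    then have eq: "1 / (2 * real m2) = 1 / 6 + 1 / real N" using assms(4) by simp
    then have "1 / (2 * real m2) > 1 / 6" using pos by simp
    then have "m2 < 3" using assms by (simp add: field_simps)
    then have "m2 = 2" using assms by linarith
    then show ?thesis using eq assms(3) by (auto simp: field_simps)
  next
    case 3
    have "1 / (2 * real m2) \<le> 1 / (2 * real 2)" using assms by (intro frac_le) auto
    moreover have "1 / real m1 \<le> 1 / 4" using 3 by (intro frac_le) auto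
    ultimately show ?thesis using assms(4) pos by linarith
  qed
qed

text \<open>
  This is Dickson's count of the maximal cyclic subgroups of a finite subgroup of
    \<open>PGL\<^sub>2\<close>:
  the class of each noncentral centralizer contributes \<open>(1 - 1/m)/f\<close> with \<open>f
    \<in> {1, 2}\<close>
  to the class equation, so there are at most three classes.
\<close>

lemma (in group) commuting_transitive_order_bound:
  assumes fin: "finite (carrier G)"
    and Z: "subgroup Z G" "\<And>z x. z \<in> Z \<Longrightarrow>
      x \<in> carrier G \<Longrightarrow> z \<otimes> x = x \<otimes> z"
    and ct: "\<And>x y w. \<lbrakk>x \<in> carrier G - Z; y \<in> carrier G - Z; w \<in> carrier
      G - Z;
        x \<otimes> y = y \<otimes> x; y \<otimes> w = w \<otimes> y\<rbrakk> \<Longrightarrow>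
          x \<otimes> w = w \<otimes> x"
    and centr: "\<And>x. x \<in> carrier G - Z \<Longrightarrow>
      card {y \<in> carrier G. x \<otimes> y = y \<otimes> x} \<le> B"
    and conj: "\<And>x. x \<in> carrier G - Z \<Longrightarrow>
        card {y \<in> carrier G. x \<otimes> y = y \<otimes> x \<and>
          (\<exists>g\<in>carrier G. y = g \<otimes> x \<otimes> inv g)} \<le> 2"
  shows "order G \<le> max (60 * card Z) (max (card Z) (2 * B))"
proof -
  define n where "n = order G"
  define z where "z = card Z"
  define C where "C x = {y \<in> carrier G. x \<otimes> y = y \<otimes> x}" for x
  \<comment> \<open>The union of the conjugates of \<open>C x\<close>, without \<open>Z\<close>.
    These sets partition the noncentral elements.\<close>
  define U where "U x = {w \<in> carrier G - Z. \<exists>g\<in>carrier G. g \<otimes> w \<otimes>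
    inv g \<in> C x}" for x
  have Zc: "z' \<in> carrier G" if "z' \<in> Z" for z' using subgroup.mem_carrier[OF Z(1) that] .
  have zpos: "z > 0" unfolding z_def
    using subgroup.one_closed[OF Z(1)] finite_subset[OF subgroup.subset[OF Z(1)] fin]
      by (auto simp: card_gt_0_iff)
  have unconj: "inv g \<otimes> (g \<otimes> x \<otimes> inv g) \<otimes> g = x"
    if "g \<in> carrier G" "x \<in> carrier G" for g x
    using that by (simp add: m_assoc mult_inv_cancel)
  have cj_cj: "h \<otimes> (g \<otimes> x \<otimes> inv g) \<otimes> inv h =
    (h \<otimes> g) \<otimes> x \<otimes> inv (h \<otimes> g)"
    if "g \<in> carrier G" "h \<in> carrier G" "x \<in> carrier G" for g h x
    using that by (simp add: m_assoc inv_mult_group)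
  have cj_mult: "(g \<otimes> x \<otimes> inv g) \<otimes> (g \<otimes> y \<otimes> inv g) =
    g \<otimes> (x \<otimes> y) \<otimes> inv g"
    if "g \<in> carrier G" "x \<in> carrier G" "y \<in> carrier G" for g x y
    using that by (simp add: m_assoc mult_inv_cancel)
  have cj_inj: "x = y" if "g \<in> carrier G" "x \<in> carrier G" "y \<in> carrier G"
    "g \<otimes> x \<otimes> inv g = g \<otimes> y \<otimes> inv g" for g x y
    by (metis unconj that)
  have cjz: "g \<otimes> a \<otimes> inv g = a" if "g \<in> carrier G" "a \<in> Z" for g a
  proof -
    have "g \<otimes> a = a \<otimes> g" using Z(2)[of a g] that by simp
    then show ?thesis using that Zc[of a] by (simp add: m_assoc)
  qed
  have cjZ: "g \<otimes> x \<otimes> inv g \<in> Z \<longleftrightarrow> x \<in> Z"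
    if "g \<in> carrier G" "x \<in> carrier G" for g x
  proof
    assume a: "g \<otimes> x \<otimes> inv g \<in> Z"
    have "inv g \<otimes> (g \<otimes> x \<otimes> inv g) \<otimes> inv (inv g) =
      g \<otimes> x \<otimes> inv g"
      by (rule cjz) (use a that in auto)
    then have "x = g \<otimes> x \<otimes> inv g" using unconj[OF that] that(1) by (metis inv_inv)
    then show "x \<in> Z" using a by (rule ssubst)
  qed (use cjz that in simp)
  have Ciff: "y \<in> C x \<longleftrightarrow> y \<in> carrier G \<and> x \<otimes> y =
    y \<otimes> x" for x y unfolding C_def by simp
  have Csub: "subgroup (C x) G" if "x \<in> carrier G" for x
  proof (rule subgroupI)
    show "C x \<noteq> {}" unfolding C_def using that by (auto intro!: exI[of _ \<one>])
    show "a \<otimes> b \<in> C x" if ab: "a \<in> C x" "b \<in> C x" for a b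
    proof -
      have c: "a \<in> carrier G" "b \<in> carrier G" "x \<otimes> a = a \<otimes> x"
        "x \<otimes> b = b \<otimes> x"
        using ab unfolding C_def by auto
      have "x \<otimes> (a \<otimes> b) = a \<otimes> x \<otimes> b"
        using c \<open>x \<in> carrier G\<close> by (simp add: m_assoc[symmetric])
      also have "\<dots> = a \<otimes> b \<otimes> x" using c \<open>x \<in> carrier G\<close>
        by (simp add: m_assoc)
      finally show ?thesis using c unfolding C_def by simp
    qed
    show "inv a \<in> C x" if a: "a \<in> C x" for a
    proof -
      have c: "a \<in> carrier G" "x \<otimes> a = a \<otimes> x" using a unfolding C_def by auto
      have "inv a \<otimes> x = inv a \<otimes> (x \<otimes> a) \<otimes> inv a"
        using c(1) \<open>x \<in> carrier G\<close> by (simp add: m_assoc)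
      also have "\<dots> = x \<otimes> inv a" unfolding c(2)
        using c(1) \<open>x \<in> carrier G\<close> by (simp add: m_assoc mult_inv_cancel)
      finally show ?thesis using c unfolding C_def by simp
    qed
  qed (auto simp: C_def)
  have fC: "finite (C x)" for x unfolding C_def using fin by simp
  have ZC: "Z \<subseteq> C x" if "x \<in> carrier G" for x
    using Z(2)[symmetric] Zc that unfolding C_def by auto
  have xC: "x \<in> C x" if "x \<in> carrier G" for x using that unfolding C_def by simp
  have Csubset: "C y \<subseteq> C x" if "x \<in> carrier G - Z" "y \<in> carrier G - Z"
    "y \<in> C x" for x y
  proof
    fix w assume w: "w \<in> C y"
    show "w \<in> C x"
    proof (cases "w \<in> Z")
      case True then show ?thesis using ZC that by auto
    next
      case False
      then show ?thesis using ct[of x y w] that w unfolding C_def by simp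
    qed
  qed
  have Csym: "x \<in> C y" if "y \<in> C x" "x \<in> carrier G" for x y using that
    unfolding C_def by simp
  have Ceq: "C y = C x" if "x \<in> carrier G - Z" "y \<in> carrier G - Z" "y \<in> C x" for x y
    using Csubset[of x y] Csubset[of y x] Csym[of y x] that by auto
  have Ccj: "g \<otimes> y \<otimes> inv g \<in> C (g \<otimes> x \<otimes> inv g)"
    if "y \<in> C x" "x \<in> carrier G" "g \<in> carrier G" for g x y
  proof -
    have y: "y \<in> carrier G" "x \<otimes> y = y \<otimes> x" using that unfolding C_def by auto
    then show ?thesis using that cj_mult[of g x y] cj_mult[of g y x] unfolding Ciff by simp
  qed
  \<comment> \<open>For noncentral \<open>w\<close> in \<open>C x\<close> this set does not depend
    on \<open>w\<close>, since commuting is transitive outside \<open>Z\<close>. It is the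
    normalizer of \<open>C x\<close>.\<close>
  define T where "T x w = {g \<in> carrier G. g \<otimes> w \<otimes> inv g \<in> C x}" for x w
  have T_sub: "T x w \<subseteq> T x x" if "x \<in> carrier G - Z" "w \<in> C x"
    "w \<notin> Z" for x w
  proof
    fix g assume "g \<in> T x w"
    then have g: "g \<in> carrier G" "g \<otimes> w \<otimes> inv g \<in> C x" unfolding T_def
      by auto
    have w: "w \<in> carrier G" using that unfolding C_def by simp
    have "x \<in> C w" using Csym that by simp
    then have "g \<otimes> x \<otimes> inv g \<in> C (g \<otimes> w \<otimes> inv g)"
      using Ccj w g by simp
    also have "C (g \<otimes> w \<otimes> inv g) = C x" by (rule Ceq) (use that g w cjZ in auto)
    finally show "g \<in> T x x" using g unfolding T_def by simp
  qed
  have T_eq: "T x w = T x x" if "x \<in> carrier G - Z" "w \<in> C x" "w \<notin> Z" for x w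
  proof
    show "T x w \<subseteq> T x x" using T_sub that by simp
    have w: "w \<in> carrier G" using that unfolding C_def by simp
    have "C w = C x" using Ceq that w by simp
    then have "T x x = T w x" "T x w = T w w" unfolding T_def by simp_all
    moreover have "T w x \<subseteq> T w w" by (rule T_sub) (use Csym that w in auto)
    ultimately show "T x x \<subseteq> T x w" by simp
  qed
  \<comment> \<open>The index of \<open>C x\<close> in its normalizer, by \<open>cardT\<close>
    below.\<close>
  define f where "f x = card {y \<in> C x. \<exists>g\<in>carrier G. y =
    g \<otimes> x \<otimes> inv g}" for x
  have f12: "f x = 1 \<or> f x = 2" if "x \<in> carrier G - Z" for x
  proof -
    have "f x \<le> 2" using conj[OF that] unfolding f_def C_def by (simp add: conj_assoc)
    moreover have "x = \<one> \<otimes> x \<otimes> inv \<one>" using that by simp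
    then have "x \<in> {y \<in> C x. \<exists>g\<in>carrier G. y =
      g \<otimes> x \<otimes> inv g}" using xC that by blast
    then have "f x \<noteq> 0" using fC[of x] unfolding f_def by (auto simp: card_eq_0_iff)
    ultimately show ?thesis by linarith
  qed
  have cardT: "card (T x x) = f x * card (C x)" if x: "x \<in> carrier G - Z" for x
  proof -
    let ?Y = "{y \<in> C x. \<exists>g\<in>carrier G. y = g \<otimes> x \<otimes> inv g}"
    have "T x x = (\<Union>y\<in>?Y. {g \<in> carrier G. g \<otimes> x \<otimes> inv g =
      y})" unfolding T_def by auto
    moreover have "card (\<Union>y\<in>?Y. {g \<in> carrier G. g \<otimes> x \<otimes> inv g = y}) =
       (\<Sum>y\<in>?Y. card {g \<in> carrier G. g \<otimes> x \<otimes> inv g = y})"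
      by (rule card_UN_disjoint) (use fin fC in auto)
    moreover have "card {g \<in> carrier G. g \<otimes> x \<otimes> inv g = y} = card (C x)"
      if yY: "y \<in> ?Y" for y
    proof -
      obtain h where h: "h \<in> carrier G" "y = h \<otimes> x \<otimes> inv h" using yY by auto
      have xc: "x \<in> carrier G" using x by simp
      have "bij_betw (\<lambda>c. h \<otimes> c) (C x) {g \<in> carrier G. g \<otimes> x
        \<otimes> inv g = y}"
      proof (rule bij_betw_byWitness[of _ "\<lambda>g. inv h \<otimes> g"])
        show "\<forall>a\<in>C x. inv h \<otimes> (h \<otimes> a) = a" using h
          by (auto simp: C_def mult_inv_cancel)
        show "\<forall>a\<in>{g \<in> carrier G. g \<otimes> x \<otimes> inv g =
          y}. h \<otimes> (inv h \<otimes> a) = a"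
          using h by (auto simp: mult_inv_cancel)
        show "(\<otimes>) h ` C x \<subseteq> {g \<in> carrier G. g \<otimes> x \<otimes> inv g =
          y}"
        proof safe
          fix c assume c: "c \<in> C x"
          then have cc: "c \<in> carrier G" "c \<otimes> x = x \<otimes> c" unfolding C_def by auto
          then have "c \<otimes> x \<otimes> inv c = x" using xc by (simp add: m_assoc)
          then show "h \<otimes> c \<otimes> x \<otimes> inv (h \<otimes> c) = y"
            "h \<otimes> c \<in> carrier G"
            using cj_cj[of c h x] h cc xc by auto
        qed
        show "(\<otimes>) (inv h) ` {g \<in> carrier G. g \<otimes> x \<otimes> inv g =
          y} \<subseteq> C x"
        proof safe
          fix g assume g: "g \<in> carrier G" "y = g \<otimes> x \<otimes> inv g"
          let ?c = "inv h \<otimes> g"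
          have "?c \<otimes> x \<otimes> inv ?c = inv h \<otimes> (g \<otimes> x \<otimes> inv g)
            \<otimes> inv (inv h)"
            using cj_cj[of g "inv h" x] g h xc by simp
          also have "\<dots> = x" using g h unconj[of h x] xc by simp
          finally have "?c \<otimes> x \<otimes> inv ?c \<otimes> ?c = x \<otimes> ?c" by simp
          then have "?c \<otimes> x = x \<otimes> ?c" using h g xc by (simp add: m_assoc)
          then show "?c \<in> C x" using h g unfolding C_def by simp
        qed
      qed
      then show ?thesis by (simp add: bij_betw_same_card)
    qed
    ultimately show ?thesis unfolding f_def by simp
  qed
  have cardTw: "card (T x w) = f x * card (C x)" if x: "x \<in> carrier G - Z"
    and w: "w \<in> U x" for x w
  proof -
    obtain h where h: "h \<in> carrier G" "h \<otimes> w \<otimes> inv h \<in> C x"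
      "w \<in> carrier G" "w \<notin> Z"
      using w unfolding U_def by auto
    let ?w = "h \<otimes> w \<otimes> inv h"
    have "bij_betw (\<lambda>g. g \<otimes> h) (T x ?w) (T x w)"
    proof (rule bij_betw_byWitness[of _ "\<lambda>g. g \<otimes> inv h"])
      show "(\<lambda>g. g \<otimes> h) ` T x ?w \<subseteq> T x w"
        using h cj_cj unfolding T_def by auto
      show "(\<lambda>g. g \<otimes> inv h) ` T x w \<subseteq> T x ?w"
      proof safe
        fix g assume g: "g \<in> T x w"
        then have gc: "g \<in> carrier G" unfolding T_def by simp
        have "g \<otimes> inv h \<otimes> ?w \<otimes> inv (g \<otimes> inv h) =
          g \<otimes> inv h \<otimes> h \<otimes> w \<otimes> inv (g \<otimes> inv h \<otimes> h)"
          using cj_cj[of h "g \<otimes> inv h" w] gc h by simp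
        also have "g \<otimes> inv h \<otimes> h = g" using gc h by (simp add: m_assoc)
        finally show "g \<otimes> inv h \<in> T x ?w" using g gc h unfolding T_def by simp
      qed
    qed (use h in \<open>auto simp: T_def m_assoc\<close>)
    then have "card (T x w) = card (T x ?w)" by (simp add: bij_betw_same_card)
    also have "T x ?w = T x x" by (rule T_eq) (use x h cjZ in auto)
    finally show ?thesis using cardT x by simp
  qed
  \<comment> \<open>Double count of the pairs of \<open>w\<close> in \<open>U x\<close> and
    \<open>g\<close> with \<open>g\<close> conjugating \<open>w\<close> into \<open>C x\<close>:
    each \<open>w\<close> has \<open>f x * card (C x)\<close> partners, each \<open>g\<close> has
    \<open>card (C x) - z\<close>.\<close>
  have cardU: "card (U x) * (f x * card (C x)) = n * (card (C x) - z)"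
    if x: "x \<in> carrier G - Z" for x
  proof -
    have fU: "finite (U x)" unfolding U_def using fin by simp
    have ind: "card {a \<in> A. P a} = (\<Sum>a\<in>A. if P a then 1 else 0)" if "finite A"
      for A :: "'a set" and P
      using that by (simp add: sum.If_cases Int_def)
    have "card (U x) * (f x * card (C x)) = (\<Sum>w\<in>U x. card (T x w))" using cardTw x by simp
    also have "\<dots> = (\<Sum>w\<in>U x. \<Sum>g\<in>carrier G. if g \<otimes> w \<otimes> inv
      g \<in> C x then 1 else 0)"
      unfolding T_def ind[OF fin] ..
    also have "\<dots> = (\<Sum>g\<in>carrier G. \<Sum>w\<in>U x. if g \<otimes> w \<otimes> inv
      g \<in> C x then 1 else 0)"
      by (rule sum.swap)
    also have "\<dots> = (\<Sum>g\<in>carrier G. card {w \<in> U x. g \<otimes> w \<otimes> inv g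
      \<in> C x})"
      unfolding ind[OF fU] ..
    also have "\<dots> = (\<Sum>g\<in>carrier G. card (C x) - z)"
    proof (rule sum.cong)
      fix g assume g: "g \<in> carrier G"
      have "bij_betw (\<lambda>w. g \<otimes> w \<otimes> inv g) {w \<in> U x. g \<otimes> w
        \<otimes> inv g \<in> C x} (C x - Z)"
      proof (rule bij_betw_imageI)
        show "inj_on (\<lambda>w. g \<otimes> w \<otimes> inv g) {w \<in> U x. g \<otimes> w
          \<otimes> inv g \<in> C x}"
          using cj_inj g unfolding U_def by (intro inj_onI) auto
        show "(\<lambda>w. g \<otimes> w \<otimes> inv g) ` {w \<in> U x. g \<otimes> w \<otimes>
          inv g \<in> C x} = C x - Z"
        proof (intro equalityI subsetI)
          fix y assume "y \<in> (\<lambda>w. g \<otimes> w \<otimes> inv g) ` {w \<in> U x. g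
            \<otimes> w \<otimes> inv g \<in> C x}"
          then show "y \<in> C x - Z" using cjZ g unfolding U_def by auto
        next
          fix y assume y: "y \<in> C x - Z"
          then have yc: "y \<in> carrier G" unfolding C_def by simp
          let ?w = "inv g \<otimes> y \<otimes> g"
          have w: "g \<otimes> ?w \<otimes> inv g = y" using unconj[of "inv g" y] g yc by simp
          have "?w \<in> carrier G" using g yc by simp
          moreover have "?w \<notin> Z" using cjZ[of g ?w] w y g yc by simp
          ultimately have "?w \<in> U x" unfolding U_def using w y g by (auto intro!: bexI[of _ g])
          then show "y \<in> (\<lambda>w. g \<otimes> w \<otimes> inv g) ` {w \<in> U x. g
            \<otimes> w \<otimes> inv g \<in> C x}"
            using w y by (intro image_eqI[of _ _ ?w]) auto
        qed
      qed
      then have "card {w \<in> U x. g \<otimes> w \<otimes> inv g \<in> C x} = card (C x - Z)"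
        by (rule bij_betw_same_card)
      also have "\<dots> = card (C x) - z"
        unfolding z_def using ZC[of x] x fC[of x] by (intro card_Diff_subset) (auto intro:
          finite_subset)
      finally show "card {w \<in> U x. g \<otimes> w \<otimes> inv g \<in> C x} = card (C x) - z" .
    qed simp
    also have "\<dots> = n * (card (C x) - z)" unfolding n_def order_def by simp
    finally show ?thesis .
  qed
  have disj: "U x \<inter> U y = {}" if x: "x \<in> carrier G - Z"
    and y: "y \<in> carrier G - Z" and "y \<notin> U x" for x y
  proof (rule ccontr)
    assume "U x \<inter> U y \<noteq> {}"
    then obtain w g h where w: "w \<in> carrier G - Z" "g \<in> carrier G" "h \<in> carrier G"
      "g \<otimes> w \<otimes> inv g \<in> C x" "h \<otimes> w \<otimes> inv h \<in> C y"
        unfolding U_def by auto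
    let ?k = "g \<otimes> inv h"
    have "?k \<otimes> y \<otimes> inv ?k \<in> C (?k \<otimes> (h \<otimes> w \<otimes> inv h)
      \<otimes> inv ?k)"
      by (rule Ccj) (use Csym w y in auto)
    also have "?k \<otimes> (h \<otimes> w \<otimes> inv h) \<otimes> inv ?k =
      g \<otimes> w \<otimes> inv g"
      using cj_cj[of h ?k w] w by (simp add: m_assoc)
    also have "C (g \<otimes> w \<otimes> inv g) = C x" by (rule Ceq) (use x w cjZ in auto)
    finally have "y \<in> U x" unfolding U_def using y w by auto
    then show False using that by simp
  qed
  \<comment> \<open>By Lagrange the orders of \<open>C x\<close> and of \<open>G\<close> are
    multiples of \<open>z\<close>. The quotients \<open>m\<close> and \<open>N\<close> used below
    are orders modulo \<open>Z\<close>.\<close>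
  have div: "\<exists>m. card J = z * m" if J: "subgroup J G" "Z \<subseteq> J" for J
  proof -
    have "group (G\<lparr>carrier := J\<rparr>)" using J subgroup_imp_group by blast
    moreover have "subgroup Z (G\<lparr>carrier := J\<rparr>)" using J Z(1) subgroup_incl by blast
    ultimately have "card (rcosets\<^bsub>G\<lparr>carrier := J\<rparr>\<^esub> Z) * card Z =
      order (G\<lparr>carrier := J\<rparr>)"
      by (rule group.lagrange)
    then have "card J = z * card (rcosets\<^bsub>G\<lparr>carrier := J\<rparr>\<^esub> Z)"
      unfolding z_def order_def by (simp add: mult.commute)
    then show ?thesis ..
  qed
  obtain N where N: "n = z * N"
    using div[OF subgroup_self subgroup.subset[OF Z(1)]] unfolding n_def order_def by auto
  have npos: "n > 0" unfolding n_def using fin order_gt_0_iff_finite by simp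
  have Npos: "N > 0" using N npos by (cases N) auto
  define M where "M = B div z"
  define t where "t x = real (card (U x)) / real n" for x
  \<comment> \<open>Here \<open>k\<close> is \<open>f x\<close>. If it is 2, the normalizer has
    order \<open>2 * m\<close> modulo \<open>Z\<close>, which gives \<open>2 * m\<close> at most
    \<open>N\<close>.\<close>
  have t: "\<exists>m k. 2 \<le> m \<and> m \<le> M \<and> (k = 1 \<or> k = 2 \<and>
    2 * m \<le> N) \<and> t x = (1 - 1 / real m) / real k"
    if x: "x \<in> carrier G - Z" for x
  proof -
    obtain m where m: "card (C x) = z * m" using div[OF Csub ZC] x by auto
    have "z < card (C x)" unfolding z_def
      by (rule psubset_card_mono) (use fC ZC[of x] xC[of x] x in auto)
    then have m2: "2 \<le> m" using m by (cases "m = 0 \<or> m = 1") auto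
    have "z * m \<le> B" using centr[OF x] m unfolding C_def by simp
    then have "m \<le> M" unfolding M_def using zpos
      by (simp add: less_eq_div_iff_mult_less_eq mult.commute)
    moreover have "f x = 1 \<or> f x = 2 \<and> 2 * m \<le> N"
    proof -
      have "card (T x x) \<le> n" unfolding n_def order_def T_def using fin
        by (intro card_mono) auto
      then have "z * (f x * m) \<le> z * N" using cardT[OF x] m N by (simp add: ac_simps)
      then show ?thesis using f12[OF x] zpos by auto
    qed
    moreover have "t x = (1 - 1 / real m) / real (f x)"
    proof -
      have "real (card (U x)) * (real (f x) * (real z * real m)) =
        real n * (real z * real m - real z)"
      proof -
        have "real (card (U x) * (f x * (z * m))) = real (n * (z * m - z))"
          using cardU[OF x] m by simp
        moreover have "real (z * m - z) = real z * real m - real z" using m2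
          by (simp add: of_nat_diff)
        ultimately show ?thesis by simp
      qed
      then have "real z * (real (card (U x)) * (real (f x) * real m)) =
        real z * (real n * (real m - 1))"
        by (simp add: algebra_simps)
      then have "real (card (U x)) * (real (f x) * real m) = real n * (real m - 1)"
        using zpos by simp
      moreover have "real (f x) \<noteq> 0" using f12[OF x] by auto
      ultimately show ?thesis unfolding t_def using m2 npos by (simp add: field_simps)
    qed
    ultimately show ?thesis using m2 by blast
  qed
  \<comment> \<open>All shares together give \<open>1 - 1 / real N\<close>, which is less than 1, so
    there are at most three classes.\<close>
  have t4: "t x \<ge> 1 / 4" if x: "x \<in> carrier G - Z" for x
  proof -
    obtain m k where mk: "2 \<le> m" "k = 1 \<or> k = (2::nat)"
      "t x = (1 - 1 / real m) / real k" using t[OF x] by auto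
    have "1 / real m \<le> 1 / 2" using mk by (intro frac_le) auto
    moreover have "t x = 1 - 1 / real m \<or> t x = (1 - 1 / real m) / 2" using mk by auto
    moreover have "1 / 4 \<le> 1 - r \<and> 1 / 4 \<le> (1 - r) / 2" if "r \<le> 1 / 2"
      for r :: real using that by simp
    ultimately show ?thesis by metis
  qed
  have cardall: "real (card (carrier G - Z)) / n = 1 - 1 / real N"
  proof -
    have "card (carrier G - Z) = n - z" unfolding n_def z_def order_def
      using subgroup.subset[OF Z(1)] fin by (intro card_Diff_subset) (auto intro: finite_subset)
    moreover have "z \<le> n" using N Npos by simp
    ultimately have "real (card (carrier G - Z)) = real n - real z" by (simp add: of_nat_diff)
    then show ?thesis using N npos Npos zpos by (simp add: field_simps)
  qed
  have cardsub: "real (card A) / n \<le> 1 - 1 / real N" if "A \<subseteq> carrier G - Z" for A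
  proof -
    have "card A \<le> card (carrier G - Z)" using that fin by (intro card_mono) auto
    then show ?thesis unfolding cardall[symmetric] using npos by (intro divide_right_mono) auto
  qed
  have Usub: "U x \<subseteq> carrier G - Z" for x unfolding U_def by auto
  have fU: "finite (U x)" for x using fin Usub finite_subset by (metis finite_Diff)
  have goal: "order G \<le> max (60 * card Z) (max (card Z) (2 * B))" if "N \<le> max 60 (2 * M)"
  proof -
    have "z * M \<le> B" unfolding M_def by (rule times_div_less_eq_dividend)
    moreover have "n \<le> z * max 60 (2 * M)" using N that by simp
    then have "n \<le> max (60 * z) (2 * (z * M))" by (auto simp: max_def split: if_splits)
    ultimately show ?thesis unfolding n_def z_def by (auto simp: max_def split: if_splits)
  qed
  show ?thesis
  proof (cases "carrier G - Z = {}")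
    case True
    then show ?thesis using subgroup.subset[OF Z(1)] unfolding order_def
      by (simp add: subset_antisym)
  next
    case False
    then obtain x1 where x1: "x1 \<in> carrier G - Z" by auto
    obtain m1 k1 where 1: "2 \<le> m1" "m1 \<le> M" "k1 = 1 \<or> k1 = 2 \<and> 2 * m1 \<le> N"
      "t x1 = (1 - 1 / real m1) / real k1"
      using t[OF x1] by blast
    have half: "1 / real m \<le> 1 / 2" if "2 \<le> m" for m :: nat using that
      by (intro frac_le) auto
    have Npos': "1 / real N > 0" using Npos by simp
    show ?thesis
    proof (cases "carrier G - Z = U x1")
      case True
      then have "t x1 = 1 - 1 / real N" using cardall unfolding t_def by simp
      \<comment> \<open>With \<open>k1 = 2\<close> the share is below one half, whereas
        \<open>N\<close> is at least 4 and the total at least three quarters.\<close>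
      have "k1 = 1"
      proof (rule ccontr)
        assume "k1 \<noteq> 1"
        then have k: "k1 = 2" "2 * m1 \<le> N" using 1 by auto
        then have "1 / real N \<le> 1 / 4" using 1 by (intro frac_le) auto
        moreover have "(1 - 1 / real m1) / 2 = 1 - 1 / real N"
          using 1 k \<open>t x1 = 1 - 1 / real N\<close> by simp
        moreover have "False" if "(1 - a) / 2 = 1 - b" "b \<le> 1 / 4" "a > 0"
          for a b :: real using that by (simp add: field_simps)
        ultimately show False using 1 by (metis divide_pos_pos less_le_trans of_nat_0_less_iff
          pos2 zero_less_one)
      qed
      then have "1 / real m1 = 1 / real N" using 1 \<open>t x1 = 1 - 1 / real N\<close> by simp
      then have "N = m1" using 1 Npos by simp
      then show ?thesis using 1 goal by auto
    next
      case False
      then obtain x2 where x2: "x2 \<in> carrier G - Z" "x2 \<notin> U x1" using Usub by blast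
      obtain m2 k2 where 2: "2 \<le> m2" "m2 \<le> M" "k2 = 1 \<or> k2 = 2 \<and>
        2 * m2 \<le> N" "t x2 = (1 - 1 / real m2) / real k2"
        using t[OF x2(1)] by blast
      have c12: "card (U x1 \<union> U x2) = card (U x1) + card (U x2)"
        by (rule card_Un_disjoint) (use fU disj x1 x2 in auto)
      show ?thesis
      proof (cases "carrier G - Z = U x1 \<union> U x2")
        case True
        then have s: "t x1 + t x2 = 1 - 1 / real N"
          using cardall c12 unfolding t_def by (simp add: add_divide_distrib)
        have *: "N \<le> max 60 (2 * M)" if "2 \<le> a" "2 \<le> b" "b \<le> M"
          "1 - 1 / real a + (1 - 1 / real b) / 2 = 1 - 1 / real N" for a b
        proof -
          have "1 / real a + 1 / (2 * real b) = 1 / 2 + 1 / real N" using that(4)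
            by (simp add: field_simps)
          then have "N \<le> max 60 (2 * b)" using two_term_bound that Npos by blast
          then show ?thesis using that by auto
        qed
        \<comment> \<open>Both \<open>1 / (2 * real m1)\<close> and \<open>1 / (2 * real m2)\<close>
          are at least \<open>1 / real N\<close>, so two shares of index 2 sum to at most
          \<open>1 - 2 / real N\<close>.\<close>
        have both: False if "k1 = 2" "k2 = 2"
        proof -
          have "2 * m1 \<le> N" "2 * m2 \<le> N" using 1 2 that by auto
          then have "1 / real N \<le> 1 / (2 * real m1)" "1 / real N \<le> 1 / (2 * real m2)"
            using 1(1) 2(1) by (auto intro!: frac_le)
          then show False using s 1(4) 2(4) that Npos' by (simp add: field_simps)
        qed
        show ?thesis
        proof (cases "k1 = 1")
          case True
          show ?thesis
          proof (cases "k2 = 1")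
            case True
            then show ?thesis using s 1(4) 2(4) \<open>k1 =
              1\<close> half[OF 1(1)] half[OF 2(1)] Npos' by simp
          next
            case False
            then show ?thesis using s 1 2 True by (intro goal *[of m1 m2]) auto
          qed
        next
          case False
          then have "k2 = 1" using 1 2 both by blast
          then show ?thesis using s 1 2 False by (intro goal *[of m2 m1]) auto
        qed
      next
        case False
        then obtain x3 where x3: "x3 \<in> carrier G - Z" "x3 \<notin> U x1"
          "x3 \<notin> U x2" using Usub by blast
        obtain m3 k3 where 3: "2 \<le> m3" "m3 \<le> M" "k3 = 1 \<or> k3 = 2 \<and>
          2 * m3 \<le> N" "t x3 = (1 - 1 / real m3) / real k3"
          using t[OF x3(1)] by blast
        have c123: "card (U x1 \<union> U x2 \<union> U x3) =
          card (U x1) + card (U x2) + card (U x3)"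
          unfolding c12[symmetric] by (rule card_Un_disjoint) (use fU disj x1 x2 x3 in auto)
        have le: "t x1 + t x2 + t x3 \<le> 1 - 1 / real N"
          using cardsub[of "U x1 \<union> U x2 \<union> U x3"] c123 Usub unfolding t_def
            by (simp add: add_divide_distrib)
        show ?thesis
        proof (cases "carrier G - Z = U x1 \<union> U x2 \<union> U x3")
          case True
          then have s: "t x1 + t x2 + t x3 = 1 - 1 / real N"
            using cardall c123 unfolding t_def by (simp add: add_divide_distrib)
          \<comment> \<open>One class of index 1 takes at least one half and the other two at least
            a quarter each, which exceeds the total. Hence all three indices are 2.\<close>
          have t2: "1 / 2 \<le> (1 - 1 / real m) / real 1" if "2 \<le> m" for m
            using half[OF that] by simp
          have "k1 = 2"
          proof (rule ccontr)
            assume "k1 \<noteq> 2"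
            then have "1 / 2 \<le> t x1" using t2[OF 1(1)] 1 by auto
            then show False using le t4[OF x2(1)] t4[OF x3(1)] Npos' by linarith
          qed
          moreover have "k2 = 2"
          proof (rule ccontr)
            assume "k2 \<noteq> 2"
            then have "1 / 2 \<le> t x2" using t2[OF 2(1)] 2 by auto
            then show False using le t4[OF x1] t4[OF x3(1)] Npos' by linarith
          qed
          moreover have "k3 = 2"
          proof (rule ccontr)
            assume "k3 \<noteq> 2"
            then have "1 / 2 \<le> t x3" using t2[OF 3(1)] 3 by auto
            then show False using le t4[OF x1] t4[OF x2(1)] Npos' by linarith
          qed
          moreover have "r1 + r2 + r3 = 1 + 2 * N'"
            if "(1 - r1) / 2 + (1 - r2) / 2 + (1 - r3) / 2 = 1 - N'" for r1 r2 r3 N' :: real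
            using that by (simp add: field_simps)
          moreover note this[of "1 / real m1" "1 / real m2" "1 / real m3" "1 / real N"]
          ultimately have "1 / real m1 + 1 / real m2 + 1 / real m3 = 1 + 2 / real N"
            using s 1(4) 2(4) 3(4) by simp
          then show ?thesis
            by (intro goal three_term_bound_unsorted[of m1 m2 m3 M N]) (use 1 2 3 Npos in auto)
        next
          case False
          then obtain x4 where x4: "x4 \<in> carrier G - Z" "x4 \<notin> U x1"
            "x4 \<notin> U x2" "x4 \<notin> U x3" using Usub by blast
          have "card (U x1 \<union> U x2 \<union> U x3 \<union> U x4) =
            card (U x1) + card (U x2) + card (U x3) + card (U x4)"
            unfolding c123[symmetric] by (rule card_Un_disjoint) (use fU disj x1 x2 x3 x4 in auto)
          then have "t x1 + t x2 + t x3 + t x4 \<le> 1 - 1 / real N"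
            using cardsub[of "U x1 \<union> U x2 \<union> U x3 \<union> U x4"] Usub
              unfolding t_def by (simp add: add_divide_distrib)
          then show ?thesis
            using t4[OF x1] t4[OF x2(1)] t4[OF x3(1)] t4[OF x4(1)] Npos' by linarith
        qed
      qed
    qed
  qed
qed

section \<open>Stabilizers of vectors in subgroups without transvections\<close>

context prime_ideal
begin

definition transv_free :: "('a^3^3) set \<Rightarrow> bool" where
  "transv_free H \<longleftrightarrow> (\<forall>u\<in>V. \<forall>f\<in>V. dot f u =
    0 \<longrightarrow> transv u f \<in> H \<longrightarrow> u = 0 \<or> f = 0)"

lemma transv_freeD: "transv_free H \<Longrightarrow> transv u f \<in> H \<Longrightarrow>
  u \<in> V \<Longrightarrow> f \<in> V \<Longrightarrow> dot f u = 0 \<Longrightarrow> u =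
    0 \<or> f = 0"
  unfolding transv_free_def by blast

definition vec_stab :: "('a^3^3) set \<Rightarrow> ('a^3^3) set" where
  "vec_stab H = {x \<in> H. x *v e1 = e1}"

text \<open>The traceless part of the lower right 2 by 2 block, which is the action on the quotient
  by \<open>e1\<close>. It vanishes exactly when the block is scalar.\<close>

definition offdiag :: "'a^3^3 \<Rightarrow> 'a^3" where
  "offdiag x = vector [x$2$3, x$3$2, x$3$3 - x$2$2]"

lemma vec_stab_entries:
  assumes "x \<in> Mt" "x *v e1 = e1"
  shows "x$1$1 = e" "x$2$1 = 0" "x$3$1 = 0"
  using assms by (simp_all add: vec_eq_iff forall_3 matrix_vector_mult_def sum_3)

lemma vec_stab_det:
  assumes "x \<in> carrier SL" "x *v e1 = e1"
  shows "x$2$2 * x$3$3 - x$2$3 * x$3$2 = e"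
proof -
  have "x \<in> Mt" "det x = e" using assms(1) by (simp_all add: carrier_SL)
  then show ?thesis using vec_stab_entries[OF _ assms(2)] by (simp add: det_3)
qed

lemma subgroup_vec_stab:
  assumes H: "subgroup H SL"
  shows "subgroup (vec_stab H) SL"
proof (rule SL.subgroupI)
  note HS = subgroup_SL[OF H]
  show "vec_stab H \<subseteq> carrier SL" unfolding vec_stab_def using HS(4) by auto
  show "vec_stab H \<noteq> {}" unfolding vec_stab_def using HS(3)
    by (auto intro!: exI[of _ "mat e"])
  show "inv' x \<in> vec_stab H" if x: "x \<in> vec_stab H" for x
  proof -
    have "x \<in> carrier SL" "x *v e1 = e1" using x HS(4) unfolding vec_stab_def by auto
    then have "inv' x *v e1 = e1" using SL_inv(4)[of x e1] by simp
    then show ?thesis using x HS(2) unfolding vec_stab_def by auto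
  qed
  show "x \<otimes>\<^bsub>SL\<^esub> y \<in> vec_stab H"
    if "x \<in> vec_stab H" "y \<in> vec_stab H" for x y
    using that HS(1) unfolding vec_stab_def by (auto simp: matrix_vector_mul_assoc[symmetric])
qed

text \<open>Two elements with the same block differ by a transvection centred at \<open>e1\<close>.
  So the action on the quotient by \<open>e1\<close> is faithful, and \<open>vec_stab H\<close>
  embeds into SL_2.\<close>

lemma vec_stab_inj:
  assumes H: "subgroup H SL" "transv_free H" and xy: "x \<in> vec_stab H" "y \<in> vec_stab H"
    and eq: "x$2$2 = y$2$2" "offdiag x = offdiag y"
  shows "x = y"
proof -
  note HS = subgroup_SL[OF H(1)]
  have x: "x \<in> H" "x \<in> carrier SL" "x *v e1 = e1"
    and y: "y \<in> H" "y \<in> carrier SL" "y *v e1 = e1"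
    using xy HS(4) unfolding vec_stab_def by auto
  have eqs: "x$2$3 = y$2$3" "x$3$2 = y$3$2" "x$3$3 = y$3$3"
    using eq by (simp_all add: offdiag_def vec_eq_iff forall_3)
  let ?d = "vector [0, x$1$2 - y$1$2, x$1$3 - y$1$3] :: 'a^3"
  have dV: "?d \<in> V" using x y by simp
  have M: "x \<in> Mt" "y \<in> Mt" using x y by simp_all
  note E = vec_stab_entries[OF M(1) x(3)] vec_stab_entries[OF M(2) y(3)]
  have xd: "x = y + outer e1 ?d"
    using E M eqs eq(1) by (simp add: coords)
  have "x ** inv' y = (y + outer e1 ?d) ** inv' y"
    using xd by (rule arg_cong)
  also have "\<dots> = transv e1 (?d v* inv' y)"
    using y by (simp add: mat_mul_add outer_mul transv_def)
  finally have "x ** inv' y = transv e1 (?d v* inv' y)" .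
  then have t: "transv e1 (?d v* inv' y) \<in> H" using HS(1)[OF x(1) HS(2)[OF y(1)]] by simp
  have iy: "inv' y \<in> carrier SL" using y by simp
  have "inv' y *v e1 = e1" using SL_inv(4)[OF y(2), of e1] y(3) by simp
  then have "dot (?d v* inv' y) e1 = 0" unfolding dot_vec_mul using dV by simp
  then have "?d v* inv' y = 0" using transv_freeD[OF H(2) t] dV iy e123_nz by auto
  then have "?d = 0" using SL_covec_0[OF iy dV] by blast
  then have "x$1$2 = y$1$2" "x$1$3 = y$1$3" by (simp_all add: vec_eq_iff forall_3)
  then show ?thesis
    using E eqs eq(1) by (simp add: vec_eq_iff forall_3)
qed

text \<open>For 2 by 2 matrices the commutator is, up to signs and order of coordinates, the cross
  product of the traceless parts. Faithfulness on the block lifts equality to the whole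
  matrices.\<close>

lemma vec_stab_commute_iff:
  assumes H: "subgroup H SL" "transv_free H" and xy: "x \<in> vec_stab H" "y \<in> vec_stab H"
  shows "x ** y = y ** x \<longleftrightarrow> cross (offdiag x) (offdiag y) = 0"
proof -
  note HS = subgroup_SL[OF H(1)]
  note KS = subgroup_SL[OF subgroup_vec_stab[OF H(1)]]
  have x: "x \<in> Mt" "x *v e1 = e1" and y: "y \<in> Mt" "y *v e1 = e1"
    using xy HS(4) unfolding vec_stab_def by auto
  have ent: "(x ** y)$2$2 - (y ** x)$2$2 = cross (offdiag x) (offdiag y) $ 3"
    "(x ** y)$2$3 - (y ** x)$2$3 = - (cross (offdiag x) (offdiag y) $ 2)"
    "(x ** y)$3$2 - (y ** x)$3$2 = - (cross (offdiag x) (offdiag y) $ 1)"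
    "(x ** y)$3$3 - (y ** x)$3$3 = - (cross (offdiag x) (offdiag y) $ 3)"
    using vec_stab_entries[OF x] vec_stab_entries[OF y]
    by (simp_all add: offdiag_def cross_def matrix_matrix_mult_def sum_3 algebra_simps)
  show ?thesis
  proof
    assume "x ** y = y ** x"
    then show "cross (offdiag x) (offdiag y) = 0" using ent by (simp add: vec_eq_iff forall_3)
  next
    assume "cross (offdiag x) (offdiag y) = 0"
    then have "(x ** y)$2$2 = (y ** x)$2$2" "offdiag (x ** y) = offdiag (y ** x)"
      using ent by (simp_all add: offdiag_def vec_eq_iff forall_3)
    then show "x ** y = y ** x" using vec_stab_inj[OF H KS(1)[OF xy] KS(1)[OF xy(2,1)]] by blast
  qed
qed

end

context prime_ideal_2_mod_3
begin

lemma double_eq_0: "x \<in> F \<Longrightarrow> x + x = 0 \<Longrightarrow> x = 0"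
proof -
  assume x: "x \<in> F" "x + x = 0"
  have "(e + e) * x = e * x + e * x" by (rule distrib_right)
  then have "(e + e) * x = 0" using x by simp
  then show "x = 0" using F_no_zero_div[OF add_F[OF e_F e_F] x(1)] two_nz by blast
qed

lemma square_eq:
  assumes "a \<in> F" "b \<in> F" "a * a = b * b"
  shows "a = b \<or> a = - b"
proof -
  have "(a - b) * (a + b) = 0" using assms(3) by (simp add: algebra_simps)
  then have "a - b = 0 \<or> a + b = 0" using F_no_zero_div[of "a - b" "a + b"] assms(1,2) by simp
  then show ?thesis by (auto simp: eq_neg_iff_add_eq_0)
qed

text \<open>
  Conjugation by \<open>g\<close> divides \<open>x$1$2\<close> by \<open>b = g$2$2\<close>
    and multiplies \<open>x$2$3\<close> by \<open>b\<^sup>2\<close>. The result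
  commutes with \<open>x\<close> only if both factors agree, that is \<open>b\<^sup>3 = 1\<close>.
\<close>

lemma unipotent_conj:
  assumes H: "subgroup H SL" "transv_free H" and x: "x \<in> vec_stab H" and g: "g \<in> vec_stab H"
    and ent: "x$3$2 = 0" "x$2$2 = e" "x$3$3 = e" "x$2$3 \<noteq> 0"
    and y: "y = g ** x ** inv' g" "y ** x = x ** y"
  shows "y = x"
proof -
  note KS = subgroup_SL[OF subgroup_vec_stab[OF H(1)]]
  have yK: "y \<in> vec_stab H" using KS x g unfolding y(1) by blast
  have S: "x \<in> carrier SL" "g \<in> carrier SL" "y \<in> carrier SL" using KS x g yK by auto
  have M: "x \<in> Mt" "g \<in> Mt" "y \<in> Mt" using S by auto
  have v: "x *v e1 = e1" "g *v e1 = e1" "y *v e1 = e1" using x g yK unfolding vec_stab_def by auto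
  note E = vec_stab_entries[OF M(1) v(1)] vec_stab_entries[OF M(2) v(2)] vec_stab_entries[OF M(3)
    v(3)]
  have yg: "y ** g = g ** x" unfolding y(1) using S by (simp add: matrix_mul_assoc[symmetric])
  \<comment> \<open>Otherwise \<open>x\<close> would be a transvection with covector
    \<open>e3\<close>. Thus \<open>x\<close> is a single unipotent Jordan block.\<close>
  have x12: "x$1$2 \<noteq> 0"
  proof
    assume "x$1$2 = 0"
    then have "x = transv (vector [x$1$3, x$2$3, 0]) e3"
      using E ent M by (simp add: transv_def coords)
    then have "transv (vector [x$1$3, x$2$3, 0]) e3 \<in> H" using x unfolding vec_stab_def by simp
    then have "vector [x$1$3, x$2$3, 0] = (0 :: 'a^3) \<or> e3 = 0"
      by (rule transv_freeD[OF H(2)]) (use M in auto)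
    then show False using ent(4) e123_nz by (auto simp: vec_eq_iff forall_3)
  qed
  have comm: "cross (offdiag y) (offdiag x) = 0" using vec_stab_commute_iff[OF H yK x] y(2) by blast
  then have y32: "y$3$2 = 0" and y23: "y$3$3 = y$2$2"
    using ent M F_no_zero_div[of "y$3$2" "x$2$3"] F_no_zero_div[of "y$3$3 - y$2$2" "x$2$3"]
    by (auto simp: offdiag_def cross_def vec_eq_iff forall_3)
  have prods: "y$2$2 * g$3$2 = g$3$2" "y$2$2 * g$3$3 = g$3$2 * x$2$3 + g$3$3"
    "y$2$2 * g$2$3 + y$2$3 * g$3$3 = g$2$2 * x$2$3 + g$2$3"
    "g$1$2 + y$1$2 * g$2$2 + y$1$3 * g$3$2 = x$1$2 + g$1$2"
    using arg_cong[OF yg, of "\<lambda>m. m$3$2"] arg_cong[OF yg, of "\<lambda>m. m$3$3"]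
      arg_cong[OF yg, of "\<lambda>m. m$2$3"] arg_cong[OF yg, of
        "\<lambda>m. m$1$2"] E ent M y32 y23
    by (simp_all add: matrix_matrix_mult_def sum_3)
  have xy13: "x$1$2 * y$2$3 + x$1$3 * y$2$2 = y$1$2 * x$2$3 + x$1$3"
    using arg_cong[OF y(2), of "\<lambda>m. m$1$3"] E ent M y32 y23
    by (simp add: matrix_matrix_mult_def sum_3 algebra_simps)
  \<comment> \<open>Conceptually, the blocks of \<open>x\<close> and \<open>y\<close> are commuting
    nontrivial unipotents, so they have the same fixed line, and \<open>g\<close> must preserve
    it.\<close>
  have g32: "g$3$2 = 0"
  proof (rule ccontr)
    assume "g$3$2 \<noteq> 0"
    then have "y$2$2 = e" using prods(1) M F_mult_cancel[of "g$3$2" "y$2$2" e]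
      by (simp add: mult.commute)
    then have "g$3$2 * x$2$3 = 0" using prods(2) M by simp
    then show False using \<open>g$3$2 \<noteq> 0\<close> ent(4) M by simp
  qed
  have gd: "g$2$2 * g$3$3 = e" using vec_stab_det[OF S(2) v(2)] g32 by simp
  then have g33: "g$3$3 \<noteq> 0" using nz by auto
  then have y22: "y$2$2 = e"
    using prods(2) g32 M F_mult_cancel[of "g$3$3" "y$2$2" e] by (simp add: mult.commute)
  define b c where "b = g$2$2" and "c = g$3$3"
  have bc: "b \<in> F" "c \<in> F" "b * c = e" using M gd unfolding b_def c_def by auto
  have 1: "y$2$3 * c = b * x$2$3" using prods(3) y22 M unfolding b_def c_def by simp
  have 2: "y$1$2 * b = x$1$2" using prods(4) g32 unfolding b_def by simp
  have 3: "x$1$2 * y$2$3 = y$1$2 * x$2$3" using xy13 y22 M by simp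
  have "y$1$2 = y$1$2 * b * c" using bc M by (simp add: mult.assoc)
  then have 4: "y$1$2 = x$1$2 * c" unfolding 2 .
  have "(x$1$2 * x$2$3) * b = x$1$2 * (b * x$2$3)" by (simp only: ac_simps)
  also have "\<dots> = (x$1$2 * y$2$3) * c" unfolding 1[symmetric] by (simp only: ac_simps)
  also have "\<dots> = (x$1$2 * x$2$3) * (c * c)" unfolding 3 4 by (simp only: ac_simps)
  finally have "b = c * c"
    by (rule F_mult_cancel[rotated 4]) (use M bc x12 ent in auto)
  then have "b * (b * b) = (c * c) * (b * b)" by (rule arg_cong)
  also have "\<dots> = (b * c) * (b * c)" by (simp only: ac_simps)
  finally have "b * b * b = e" unfolding bc(3) idem by (simp only: ac_simps)
  then have "b = e" by (rule cube_root_one[OF bc(1)])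
  then have "c = e" using bc by simp
  have "y$2$3 = x$2$3" using 1 \<open>b = e\<close> \<open>c = e\<close> M by simp
  then show "y = x" by (intro vec_stab_inj[OF H yK x]) (use y22 y23 y32 ent in \<open>auto simp:
    offdiag_def\<close>)
qed


definition block_trace :: "'a^3^3 \<Rightarrow> 'a" where "block_trace x = x$2$2 + x$3$3"

lemma numeral_F [simp]: "x \<in> F \<Longrightarrow> numeral n * x \<in> F"
proof -
  assume "x \<in> F"
  then obtain k :: nat where "x = of_nat k * e" by (rule F_cases)
  then have "numeral n * x = of_nat (numeral n * k) * e" by (simp add: mult.assoc)
  then show ?thesis by (simp only: of_nat_F)
qed

text \<open>The discriminant of the block, trace squared minus four times the determinant, as a
  quadratic form in \<open>offdiag\<close>.\<close>

definition disc :: "'a^3 \<Rightarrow> 'a" where "disc v = v$3 * v$3 + 4 * (v$1 * v$2)"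

lemma block_trace_square: "x \<in> Mt \<Longrightarrow> x$2$2 * x$3$3 - x$2$3 * x$3$2 =
  e \<Longrightarrow> block_trace x * block_trace x = 4 * e + disc (offdiag x)"
proof -
  assume "x$2$2 * x$3$3 - x$2$3 * x$3$2 = e"
  then have "4 * e = 4 * (x$2$2 * x$3$3 - x$2$3 * x$3$2)" by simp
  then show ?thesis by (simp add: block_trace_def disc_def offdiag_def algebra_simps)
qed

lemma offdiag_V [simp]: "x \<in> Mt \<Longrightarrow> offdiag x \<in> V"
  by (simp add: offdiag_def)

lemma vec_stab_SL:
  assumes "subgroup H SL" "x \<in> vec_stab H"
  shows "x \<in> H" "x \<in> carrier SL" "x \<in> Mt" "x *v e1 = e1"
    "x$2$2 * x$3$3 - x$2$3 * x$3$2 = e"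
proof -
  show *: "x \<in> H" "x \<in> carrier SL" "x *v e1 = e1" using assms subgroup_SL(4)
    unfolding vec_stab_def by auto
  then show "x \<in> Mt" by simp
  show "x$2$2 * x$3$3 - x$2$3 * x$3$2 = e" using vec_stab_det * by blast
qed

lemma block_trace_conj:
  assumes "subgroup H SL" "x \<in> vec_stab H" "g \<in> vec_stab H"
  shows "block_trace (g ** x ** inv' g) = block_trace x"
proof -
  note KS = subgroup_SL[OF subgroup_vec_stab[OF assms(1)]]
  let ?y = "g ** x ** inv' g"
  have y: "?y \<in> vec_stab H" using KS assms by blast
  have *: "trace z = e + block_trace z" if "z \<in> vec_stab H" for z
    using vec_stab_entries(1)[of z] vec_stab_SL[OF assms(1) that]
      by (simp add: trace_def sum_3 block_trace_def add.assoc)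
  have "trace ?y = trace (inv' g ** (g ** x))" by (rule trace_mul_sym)
  also have "inv' g ** (g ** x) = x" using vec_stab_SL[OF assms(1)] assms(2,3)
    by (simp add: matrix_mul_assoc)
  finally show ?thesis using *[OF y] *[OF assms(2)] by simp
qed

text \<open>As 2 is invertible, the trace and the traceless part determine the block.\<close>

lemma vec_stab_eqI:
  assumes H: "subgroup H SL" "transv_free H" and xy: "x \<in> vec_stab H" "y \<in> vec_stab H"
    and eq: "block_trace x = block_trace y" "offdiag x = offdiag y"
  shows "x = y"
proof (rule vec_stab_inj[OF H xy _ eq(2)])
  have M: "x \<in> Mt" "y \<in> Mt" using vec_stab_SL[OF H(1)] xy by auto
  have i: "x$3$3 - x$2$2 = y$3$3 - y$2$2" using eq(2) by (simp add: offdiag_def vec_eq_iff forall_3)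
  have "(x$2$2 - y$2$2) + (x$2$2 - y$2$2) = (block_trace x - block_trace y) - ((x$3$3 - x$2$2) -
    (y$3$3 - y$2$2))"
    by (simp add: block_trace_def algebra_simps)
  then have "(x$2$2 - y$2$2) + (x$2$2 - y$2$2) = 0" unfolding i eq(1) by simp
  then have "x$2$2 - y$2$2 = 0" using double_eq_0[of "x$2$2 - y$2$2"] M by simp
  then show "x$2$2 = y$2$2" by simp
qed

text \<open>Cayley-Hamilton for a block of determinant \<open>e\<close>: its square is the trace
  times the block minus the identity.\<close>

lemma vec_stab_square:
  assumes "x \<in> Mt" "x *v e1 = e1" "x$2$2 * x$3$3 - x$2$3 * x$3$2 = e"
  shows "offdiag (x ** x) = block_trace x *s offdiag x" "block_trace (x ** x) =
    block_trace x * block_trace x - (e + e)"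
proof -
  have "e + e = 2 * (x$2$2 * x$3$3 - x$2$3 * x$3$2)" unfolding assms(3) by simp
  then show "offdiag (x ** x) = block_trace x *s offdiag x" "block_trace (x ** x) =
    block_trace x * block_trace x - (e + e)"
    using vec_stab_entries[OF assms(1,2)]
    by (simp_all add: offdiag_def block_trace_def vec_eq_iff forall_3 matrix_matrix_mult_def
      sum_3 algebra_simps)
qed

text \<open>A block with trace \<open>e + e\<close> and determinant \<open>e\<close> has eigenvalue
  \<open>e\<close>. A change of basis that fixes \<open>e1\<close> and sends \<open>e2\<close> to an
  eigenvector of the block gives the triangular form of \<open>unipotent_conj\<close>.\<close>

lemma unipotent_vec_stab_conj:
  assumes H: "subgroup H SL" "transv_free H" and x: "x \<in> vec_stab H" and g: "g \<in> vec_stab H"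
    and u: "offdiag x \<noteq> 0" "block_trace x = e + e"
    and y: "y = g ** x ** inv' g" "y ** x = x ** y"
  shows "y = x"
proof -
  note xs = vec_stab_SL[OF H(1) x] and gs = vec_stab_SL[OF H(1) g]
  have ys: "y \<in> carrier SL" using xs gs unfolding y by simp
  have d: "x$3$3 = e + e - x$2$2" using u(2) by (simp add: block_trace_def algebra_simps)
  have bc: "(x$2$2 - e) * (e - x$2$2) = x$2$3 * x$3$2"
    using xs(3,5) unfolding d by (simp add: algebra_simps idem)
  \<comment> \<open>The eigenvector of the block. By \<open>bc\<close> the block minus the identity
    has determinant zero, so a kernel vector can be read off a nonzero row.\<close>
  have "\<exists>w\<in>V. w \<noteq> 0 \<and> w$1 = 0 \<and> (x$2$2 - e) * w$2 + x$2$3 * w$3 =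
    0 \<and> x$3$2 * w$2 + (e - x$2$2) * w$3 = 0"
  proof (cases "x$2$3 = 0 \<and> x$2$2 = e")
    case False
    show ?thesis
      by (rule bexI[of _ "vector [0, x$2$3, e - x$2$2]"])
        (use False xs bc in \<open>auto simp: vec_eq_iff forall_3 algebra_simps\<close>)
  next
    case True
    then have "x$3$2 \<noteq> 0" using u(1) d by (auto simp: offdiag_def vec_eq_iff forall_3)
    then show ?thesis
      by (intro bexI[of _ "vector [0, 0, x$3$2]"]) (use True xs in \<open>auto simp: vec_eq_iff
        forall_3\<close>)
  qed
  then obtain w where w: "w \<in> V" "w \<noteq> 0" "w$1 = 0"
    "(x$2$2 - e) * w$2 + x$2$3 * w$3 = 0" "x$3$2 * w$2 + (e - x$2$2) * w$3 = 0"
    by blast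
  have xw: "x *v w = w + (x$1$2 * w$2 + x$1$3 * w$3) *s e1"
  proof -
    have "x$2$2 * w$2 + x$2$3 * w$3 = ((x$2$2 - e) * w$2 + x$2$3 * w$3) + e * w$2"
      by (simp add: left_diff_distrib)
    moreover have "x$3$2 * w$2 + x$3$3 * w$3 = (x$3$2 * w$2 + (e - x$2$2) * w$3) + e * w$3"
      unfolding d by (simp add: algebra_simps)
    ultimately have "x$2$2 * w$2 + x$2$3 * w$3 = w$2" "x$3$2 * w$2 + x$3$3 * w$3 = w$3"
      unfolding w(4,5) using w(1) by simp_all
    then show ?thesis using vec_stab_entries[OF xs(3,4)] w(1,3) xs(3)
      by (simp add: vec_eq_iff forall_3 matrix_vector_mult_def sum_3)
  qed
  have "cross e1 w \<noteq> 0" using w by (auto simp: coords)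
  then obtain z where z: "z \<in> V" "cols e1 w z \<in> carrier SL"
    using exists_cols[of e1 w] w by auto
  define h where "h = cols e1 w z"
  have h: "h \<in> carrier SL" using z unfolding h_def by simp
  have he: "h *v e1 = e1" "h *v e2 = w" unfolding h_def using cols_e[of e1 w z] w z by auto
  have ih: "inv' h \<in> carrier SL" using h by simp
  have ihe: "inv' h *v e1 = e1" "inv' h *v w = e2"
    using SL_inv(4)[OF h, of e1] SL_inv(4)[OF h, of e2] he by simp_all
  define K where "K = {m \<in> carrier SL. h \<otimes>\<^bsub>SL\<^esub> m
    \<otimes>\<^bsub>SL\<^esub> inv' h \<in> H}"
  define cj where "cj m = inv' h ** m ** h" for m
  have cjS: "cj m \<in> carrier SL" if "m \<in> carrier SL" for m unfolding cj_def
    using that h ih by simp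
  have uncj: "h ** cj m ** inv' h = m" if "m \<in> carrier SL" for m
  proof -
    have "h ** cj m ** inv' h = (h ** inv' h) ** m ** (h ** inv' h)"
      unfolding cj_def by (simp only: matrix_mul_assoc)
    then show ?thesis using h that by simp
  qed
  have cj_mul: "cj (m ** n) = cj m ** cj n" if "m \<in> carrier SL" "n \<in> carrier SL" for m n
  proof -
    have "cj m ** cj n = inv' h ** m ** (h ** inv' h) ** n ** h"
      unfolding cj_def by (simp only: matrix_mul_assoc)
    also have "\<dots> = cj (m ** n)" unfolding cj_def using h ih that
      by (simp add: matrix_mul_assoc)
    finally show ?thesis by simp
  qed
  have cj_inv: "cj (inv' m) = inv' (cj m)" if "m \<in> carrier SL" for m
  proof -
    have "cj (inv' m) ** cj m = cj (inv' m ** m)"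
      by (rule cj_mul[symmetric]) (use that in auto)
    also have "\<dots> = mat e" using that h ih unfolding cj_def by simp
    finally show ?thesis using SL.inv_equality[of "cj (inv' m)" "cj m"] cjS that by simp
  qed
  have cjK: "cj m \<in> vec_stab K" if m: "m \<in> vec_stab H" for m
  proof -
    note ms = vec_stab_SL[OF H(1) m]
    have "cj m \<in> K" unfolding K_def using cjS uncj ms by simp
    moreover have "cj m *v e1 = e1" unfolding cj_def
      by (simp only: matrix_vector_mul_assoc[symmetric] he ms ihe)
    ultimately show ?thesis unfolding vec_stab_def by simp
  qed
  have K: "subgroup K SL" unfolding K_def by (rule SL.conj_closed_subgroup[OF H(1) h])
  have Kn: "transv_free K"
    unfolding transv_free_def
  proof (intro ballI impI)
    fix v f assume v: "v \<in> V" "f \<in> V" "dot f v = 0" "transv v f \<in> K"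
    then have "transv (h *v v) (f v* inv' h) \<in> H" using transv_conj[OF h v(1,2)]
      unfolding K_def by simp
    then have "h *v v = 0 \<or> f v* inv' h = 0"
      by (rule transv_freeD[OF H(2)]) (use v h ih dot_invariant[OF h v(1)] in auto)
    then show "v = 0 \<or> f = 0" using v h ih by simp
  qed
  let ?x = "cj x"
  note x1 = vec_stab_SL[OF K cjK[OF x]]
  have "?x *v e2 = inv' h *v (x *v w)" unfolding cj_def
    by (simp only: matrix_vector_mul_assoc[symmetric] he)
  also have "\<dots> = e2 + (x$1$2 * w$2 + x$1$3 * w$3) *s e1"
    unfolding xw by (simp add: matrix_vector_right_distrib mat_vec_scale ihe)
  finally have ent: "?x$3$2 = 0" "?x$2$2 = e"
    using x1(3) by (simp_all add: vec_eq_iff forall_3 matrix_vector_mult_def sum_3)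
  then have ent3: "?x$3$3 = e" using x1(3,5) by simp
  have ent4: "?x$2$3 \<noteq> 0"
  proof
    assume "?x$2$3 = 0"
    then have "offdiag ?x = offdiag (mat e)" using ent ent3 by (simp add: offdiag_def mat_def)
    moreover have "?x$2$2 = (mat e :: 'a^3^3)$2$2" using ent by (simp add: mat_def)
    moreover have "mat e \<in> vec_stab K" using subgroup_SL(3)[OF subgroup_vec_stab[OF K]] .
    ultimately have "?x = mat e" using vec_stab_inj[OF K Kn cjK[OF x]] by blast
    then have "x = h ** mat e ** inv' h" using uncj[OF xs(2)] by simp
    then have "x = mat e" using h by simp
    then show False using u(1) by (auto simp: offdiag_def mat_def vec_eq_iff forall_3)
  qed
  have "cj y = ?x"
  proof (rule unipotent_conj[OF K Kn cjK[OF x] cjK[OF g] ent ent3 ent4])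
    show "cj y = cj g ** ?x ** inv' (cj g)"
      unfolding y(1) using cj_mul cj_inv xs gs by simp
    show "cj y ** ?x = ?x ** cj y"
      using cj_mul[OF ys xs(2)] cj_mul[OF xs(2) ys] y(2) by simp
  qed
  then have "h ** cj y ** inv' h = h ** ?x ** inv' h" by (rule arg_cong)
  then show "y = x" unfolding uncj[OF ys] uncj[OF xs(2)] .
qed


lemma disc_scale: "disc (c *s v) = c * c * disc v"
  by (simp add: disc_def algebra_simps)

text \<open>Zero discriminant leaves the traces \<open>e + e\<close> and \<open>- (e + e)\<close>.
  In the second case the square is unipotent, and its traceless part is a nonzero multiple of that
  of \<open>x\<close>, so \<open>x\<close> is recovered from its square.\<close>

lemma degenerate_vec_stab_conj:
  assumes H: "subgroup H SL" "transv_free H" and x: "x \<in> vec_stab H" and g: "g \<in> vec_stab H"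
    and u: "offdiag x \<noteq> 0" "disc (offdiag x) = 0"
    and y: "y = g ** x ** inv' g" "y ** x = x ** y"
  shows "y = x"
proof -
  note xs = vec_stab_SL[OF H(1) x] and gs = vec_stab_SL[OF H(1) g]
  note KS = subgroup_SL[OF subgroup_vec_stab[OF H(1)]]
  have yK: "y \<in> vec_stab H" using KS x g unfolding y by blast
  note ys = vec_stab_SL[OF H(1) yK]
  have trF: "block_trace x \<in> F" using xs unfolding block_trace_def by simp
  have tr_eq: "block_trace y = block_trace x" using block_trace_conj[OF H(1) x g] y by simp
  have "block_trace x * block_trace x = (e + e) * (e + e)"
    using block_trace_square[OF xs(3,5)] u(2) by (simp add: algebra_simps idem)
  then consider "block_trace x = e + e" | "block_trace x = - (e + e)"
    using square_eq[of "block_trace x" "e + e"] trF add_F[OF e_F e_F] by blast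
  then show ?thesis
  proof cases
    case 1
    then show ?thesis using unipotent_vec_stab_conj[OF H x g u(1) _ y] by blast
  next
    case 2
    have x2: "x ** x \<in> vec_stab H" using KS x by blast
    have tn: "block_trace x \<noteq> 0" using 2 two_nz by simp
    have "y ** y = x ** x"
    proof (rule unipotent_vec_stab_conj[OF H x2 g])
      show "offdiag (x ** x) \<noteq> 0" unfolding vec_stab_square(1)[OF xs(3-5)]
        using u(1) tn trF xs(3) by simp
      show "block_trace (x ** x) = e + e" unfolding vec_stab_square(2)[OF xs(3-5)] 2
        by (simp add: algebra_simps idem)
      have "g ** (x ** x) ** inv' g = g ** x ** mat e ** x ** inv' g"
        using xs gs by (simp add: matrix_mul_assoc)
      also have "\<dots> = g ** x ** (inv' g ** g) ** x ** inv' g" using gs by simp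
      also have "\<dots> = y ** y" unfolding y(1) by (simp only: matrix_mul_assoc)
      finally show "y ** y = g ** (x ** x) ** inv' g" by simp
      show "y ** y ** (x ** x) = x ** x ** (y ** y)"
        using y(2) by (metis matrix_mul_assoc)
    qed
    then have "block_trace y *s offdiag y = block_trace x *s offdiag x"
      using vec_stab_square(1)[OF xs(3-5)] vec_stab_square(1)[OF ys(3-5)] by simp
    then have "block_trace x * offdiag y $ i = block_trace x * offdiag x $ i" for i
      unfolding tr_eq by (simp add: vec_eq_iff)
    then have "offdiag y $ i = offdiag x $ i" for i
      using F_mult_cancel[OF trF _ _ tn] xs(3) ys(3) by (meson V_nth offdiag_V)
    then have "offdiag y = offdiag x" by (simp add: vec_eq_iff)
    then show ?thesis using vec_stab_eqI[OF H yK x tr_eq] by blast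
  qed
qed

text \<open>Commuting means parallel traceless parts, so it is transitive outside the elements with
  scalar block. Dickson's count then applies with centralizers of order at most
  \<open>2 * p\<close>.\<close>

lemma card_vec_stab:
  assumes H: "subgroup H SL" "transv_free H"
  shows "card (vec_stab H) \<le> 4 * p"
proof -
  define K where "K = vec_stab H"
  define M where "M = SL\<lparr>carrier := K\<rparr>"
  define Z where "Z = {x \<in> K. offdiag x = 0}"
  have sK: "subgroup K SL" unfolding K_def using subgroup_vec_stab[OF H(1)] .
  note KS = subgroup_SL[OF sK]
  interpret M: group M unfolding M_def by (rule SL.subgroup_imp_group[OF sK])
  have M: "carrier M = K" "x \<otimes>\<^bsub>M\<^esub> y = x ** y"
    "\<one>\<^bsub>M\<^esub> = mat e" for x y unfolding M_def by simp_all
  have Minv: "inv\<^bsub>M\<^esub> x = inv' x" if "x \<in> K" for x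
    unfolding M_def using SL.m_inv_consistent[OF sK that] by simp
  have Ks: "x \<in> H" "x \<in> carrier SL" "x \<in> Mt" "x *v e1 = e1"
    "x$2$2 * x$3$3 - x$2$3 * x$3$2 = e" if "x \<in> K" for x
    using vec_stab_SL[OF H(1)] that unfolding K_def by auto
  have finK: "finite K" by (rule finite_subset[OF _ finite_SL]) (use Ks in auto)
  have comm: "x ** y = y ** x \<longleftrightarrow> cross (offdiag x) (offdiag y) = 0"
    if "x \<in> K" "y \<in> K" for x y
    using vec_stab_commute_iff[OF H] that unfolding K_def by blast
  have Zc: "x \<in> K" "x$2$3 = 0" "x$3$2 = 0" "x$3$3 = x$2$2" if "x \<in> Z" for x
    using that unfolding Z_def offdiag_def by (auto simp: vec_eq_iff forall_3)
  have ZI: "x \<in> Z" if "x \<in> K" "x$2$3 = 0" "x$3$2 = 0" "x$3$3 = x$2$2" for x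
    using that unfolding Z_def offdiag_def by (auto simp: vec_eq_iff forall_3)
  have c0: "cross 0 v = 0" "cross v 0 = 0" for v :: "'a^3" by (simp_all add: coords)
  have oneK: "mat e \<in> K" using KS(3) .
  have sZ: "subgroup Z M"
  proof (rule M.subgroupI)
    show "Z \<subseteq> carrier M" unfolding M(1) Z_def by auto
    have "mat e \<in> Z" by (rule ZI[OF oneK]) (simp_all add: mat_def)
    then show "Z \<noteq> {}" by blast
    show "inv\<^bsub>M\<^esub> x \<in> Z" if x: "x \<in> Z" for x
    proof -
      note xz = Zc[OF x] and xk = Ks[OF Zc(1)[OF x]]
      have "inv' x \<in> K" using KS(2) xz by blast
      moreover have "(inv' x)$2$3 = 0" "(inv' x)$3$2 = 0" "(inv' x)$3$3 = (inv' x)$2$2"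
        unfolding inv_SL[OF xk(2)] adj3_def using xz vec_stab_entries[OF xk(3,4)] by simp_all
      ultimately show ?thesis using ZI Minv xz by simp
    qed
    show "x \<otimes>\<^bsub>M\<^esub> y \<in> Z" if x: "x \<in> Z" and y: "y \<in> Z" for x y
      unfolding M(2)
      by (rule ZI) (use KS(1) Zc[OF x] Zc[OF y] vec_stab_entries[OF Ks(3,4)] in \<open>auto simp:
        matrix_matrix_mult_def sum_3\<close>)
  qed
  have cardZ: "card Z \<le> 2"
  proof -
    have "card Z \<le> card {e, - e}"
    proof (rule card_inj_on_le[of "\<lambda>x. x$2$2"])
      show "inj_on (\<lambda>x. x$2$2) Z"
        by (rule inj_onI, rule vec_stab_inj[OF H]) (auto simp: Z_def K_def)
      show "(\<lambda>x. x$2$2) ` Z \<subseteq> {e, - e}"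
      proof
        fix r assume "r \<in> (\<lambda>x. x$2$2) ` Z"
        then obtain x where x: "x \<in> Z" "r = x$2$2" by blast
        then have "r * r = e * e" using Zc[OF x(1)] Ks(5)[OF Zc(1)[OF x(1)]] by (simp add: idem)
        then show "r \<in> {e, - e}" using square_eq[of r e] x Zc[OF x(1)] Ks(3) by auto
      qed
    qed simp
    also have "\<dots> \<le> 2" by (simp add: card_insert_if)
    finally show ?thesis .
  qed
  have par: "\<exists>k\<in>F. offdiag y = k *s offdiag x"
    if "x \<in> K" "x \<notin> Z" "y \<in> K" "x ** y = y ** x" for x y
    using cross_eq_0[of "offdiag x" "offdiag y"] comm[of x y] that Ks(3) unfolding Z_def by auto
  have "order M \<le> max (60 * card Z) (max (card Z) (2 * (2 * p)))"
  proof (rule M.commuting_transitive_order_bound[OF _ sZ])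
    show "finite (carrier M)" using M finK by simp
    show "z \<otimes>\<^bsub>M\<^esub> x = x \<otimes>\<^bsub>M\<^esub> z"
      if "z \<in> Z" "x \<in> carrier M" for z x
      using comm[of z x] that c0 unfolding M Z_def by auto
    show "x \<otimes>\<^bsub>M\<^esub> w = w \<otimes>\<^bsub>M\<^esub> x"
      if a: "x \<in> carrier M - Z" "y \<in> carrier M - Z" "w \<in> carrier M - Z"
        "x \<otimes>\<^bsub>M\<^esub> y = y \<otimes>\<^bsub>M\<^esub> x"
          "y \<otimes>\<^bsub>M\<^esub> w = w \<otimes>\<^bsub>M\<^esub> y" for x y w
    proof -
      obtain j k where "offdiag w = j *s offdiag y" "offdiag x = k *s offdiag y"
        using par[of y w] par[of y x] a unfolding M by auto
      then show ?thesis using comm[of x w] a unfolding M by (simp add: cross_linear)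
    qed
    show "card {y \<in> carrier M. x \<otimes>\<^bsub>M\<^esub> y =
      y \<otimes>\<^bsub>M\<^esub> x} \<le> 2 * p" if "x \<in> carrier M - Z" for x
    proof -
      have x: "x \<in> K" "x \<notin> Z" using that unfolding M by auto
      let ?C = "{y \<in> K. x ** y = y ** x}"
      \<comment> \<open>On \<open>?D k\<close> the discriminant and hence the square of the trace is
        constant, which leaves at most two elements for each of the \<open>p\<close>
        scalars.\<close>
      let ?D = "\<lambda>k. {y \<in> K. offdiag y = k *s offdiag x}"
      have "?C \<subseteq> (\<Union>k\<in>F. ?D k)" using par x by blast
      then have "card ?C \<le> card (\<Union>k\<in>F. ?D k)" using finK by (intro card_mono) auto
      also have "\<dots> \<le> (\<Sum>k\<in>F. card (?D k))" by (rule card_UN_le) simp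
      also have "\<dots> \<le> (\<Sum>k\<in>F. 2)"
      proof (rule sum_mono)
        fix k assume "k \<in> F"
        show "card (?D k) \<le> 2"
        proof (cases "?D k = {}")
          case False
          then obtain y0 where y0: "y0 \<in> ?D k" by blast
          have "card (?D k) \<le> card {block_trace y0, - block_trace y0}"
          proof (rule card_inj_on_le[of block_trace])
            show "inj_on block_trace (?D k)" by (rule inj_onI,
              rule vec_stab_eqI[OF H]) (auto simp: K_def)
            show "block_trace ` ?D k \<subseteq> {block_trace y0, - block_trace y0}"
            proof
              fix r assume "r \<in> block_trace ` ?D k"
              then obtain y where y: "y \<in> ?D k" "r = block_trace y" by blast
              then have "block_trace y * block_trace y = block_trace y0 * block_trace y0"
                using y0 block_trace_square[OF Ks(3,5)] by simp
              moreover have "block_trace y \<in> F" "block_trace y0 \<in> F"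
                using y y0 Ks(3) unfolding block_trace_def by simp_all
              ultimately show "r \<in> {block_trace y0, - block_trace y0}" using square_eq y
                by blast
            qed
          qed simp
          also have "\<dots> \<le> 2" by (simp add: card_insert_if)
          finally show ?thesis .
        next
          case True
          show ?thesis unfolding True by simp
        qed
      qed
      also have "\<dots> = 2 * p" using card_F by simp
      finally show ?thesis unfolding M .
    qed
    show "card {y \<in> carrier M. x \<otimes>\<^bsub>M\<^esub> y =
      y \<otimes>\<^bsub>M\<^esub> x \<and> (\<exists>g\<in>carrier M. y =
        g \<otimes>\<^bsub>M\<^esub> x \<otimes>\<^bsub>M\<^esub> inv\<^bsub>M\<^esub> g)} \<le> 2"
      if "x \<in> carrier M - Z" for x
    proof -
      have x: "x \<in> K" "x \<notin> Z" using that unfolding M by auto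
      have imx: "offdiag x \<noteq> 0" using x unfolding Z_def by simp
      let ?S = "{y \<in> K. x ** y = y ** x \<and> (\<exists>g\<in>K. y = g ** x ** inv' g)}"
      have S: "{y \<in> carrier M. x \<otimes>\<^bsub>M\<^esub> y =
        y \<otimes>\<^bsub>M\<^esub> x \<and> (\<exists>g\<in>carrier M. y =
          g \<otimes>\<^bsub>M\<^esub> x \<otimes>\<^bsub>M\<^esub> inv\<^bsub>M\<^esub> g)} = ?S"
        unfolding M using Minv by auto
      have xF: "disc (offdiag x) \<in> F" using Ks(3)[OF x(1)] by (simp add: disc_def)
      have trS: "block_trace y = block_trace x" if "y \<in> ?S" for y
        using that block_trace_conj[OF H(1)] x unfolding K_def by auto
      show ?thesis
      \<comment> \<open>Conjugates have the same trace and hence the same discriminant. If it is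
        nonzero, the factor between the traceless parts squares to \<open>e\<close>. If it is zero,
        the discriminant says nothing: a unipotent element in a Borel subgroup of SL_2(p) can have
        (p - 1)/2 conjugates in its centralizer, and the absence of transvections must be
        used.\<close>
      proof (cases "disc (offdiag x) = 0")
        case True
        have "?S \<subseteq> {x}"
        proof
          fix y assume "y \<in> ?S"
          then obtain g where "g \<in> K" "y = g ** x ** inv' g" "y ** x = x ** y" by auto
          then have "y = x" using degenerate_vec_stab_conj[OF H _ _ imx True] x
            unfolding K_def by blast
          then show "y \<in> {x}" by simp
        qed
        then have "card ?S \<le> card {x}" by (intro card_mono) auto
        then show ?thesis unfolding S by simp
      next
        case False
        define s where "s y = (SOME k. k \<in> F \<and> offdiag y = k *s offdiag x)" for y
        have s: "s y \<in> F" "offdiag y = s y *s offdiag x" if "y \<in> ?S" for y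
          using someI_ex[of "\<lambda>k. k \<in> F \<and> offdiag y =
            k *s offdiag x"] par[of x y] x that unfolding s_def by blast+
        have "card ?S \<le> card {e, - e}"
        proof (rule card_inj_on_le[of s])
          show "inj_on s ?S"
          proof (rule inj_onI)
            fix y y' assume "y \<in> ?S" "y' \<in> ?S" "s y = s y'"
            then show "y = y'" using s[of y] s[of y'] trS[of y] trS[of y']
              by (intro vec_stab_eqI[OF H]) (auto simp: K_def)
          qed
          show "s ` ?S \<subseteq> {e, - e}"
          proof
            fix r assume "r \<in> s ` ?S"
            then obtain y where y: "y \<in> ?S" "r = s y" by blast
            then have yK: "y \<in> K" by simp
            have "4 * e + disc (offdiag y) = 4 * e + disc (offdiag x)"
              using block_trace_square[OF Ks(3,5)[OF yK]] block_trace_square[OF Ks(3,5)[OF x(1)]]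
                trS[OF y(1)] by simp
            then have "disc (offdiag x) * (r * r) = disc (offdiag x) * e"
              using s(2)[OF y(1)] xF y(2) by (simp add: disc_scale mult.commute)
            then have "r * r = e"
              by (rule F_mult_cancel[rotated 4]) (use xF False s(1)[OF y(1)] y(2) in auto)
            then show "r \<in> {e, - e}" using square_eq[of r e] s(1)[OF y(1)] y(2) idem by auto
          qed
        qed simp
        also have "\<dots> \<le> 2" by (simp add: card_insert_if)
        finally show ?thesis unfolding S .
      qed
    qed
  qed
  \<comment> \<open>With \<open>card Z\<close> at most 2 the exceptional term is at most 120, which
    is below \<open>4 * p\<close>.\<close>
  then show ?thesis using cardZ p_large unfolding order_def M(1) K_def by simp
qed

text \<open>The elements with a given image of \<open>e1\<close> form a coset of
  \<open>vec_stab H\<close>, if there are any, and \<open>V\<close> offers \<open>p ^ 3\<close>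
  images.\<close>

lemma card_transv_free:
  assumes H: "subgroup H SL" "transv_free H"
  shows "card H \<le> 4 * p ^ 4"
proof -
  note HS = subgroup_SL[OF H(1)]
  have finH: "finite H" by (rule finite_subset[OF _ finite_SL]) (use HS in auto)
  let ?D = "\<lambda>w. {x \<in> H. x *v e1 = w}"
  have "H \<subseteq> (\<Union>w\<in>V. ?D w)" using HS(4) by auto
  then have "card H \<le> card (\<Union>w\<in>V. ?D w)" using finH by (intro card_mono) auto
  also have "\<dots> \<le> (\<Sum>w\<in>V. card (?D w))" by (rule card_UN_le) simp
  also have "\<dots> \<le> (\<Sum>w\<in>V. 4 * p)"
  proof (rule sum_mono)
    fix w assume "w \<in> V"
    show "card (?D w) \<le> 4 * p"
    proof (cases "?D w = {}")
      case False
      then obtain y where y: "y \<in> H" "y *v e1 = w" by blast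
      have yS: "y \<in> carrier SL" using HS y by blast
      have "card (?D w) \<le> card (vec_stab H)"
      proof (rule card_inj_on_le[of "\<lambda>x. inv' y ** x"])
        show "inj_on (\<lambda>x. inv' y ** x) (?D w)"
        proof (rule inj_onI)
          fix a b assume ab: "a \<in> ?D w" "b \<in> ?D w" "inv' y ** a = inv' y ** b"
          have "a \<in> Mt" "b \<in> Mt" using ab(1,2) HS(4) by auto
          moreover have "(y ** inv' y) ** a = (y ** inv' y) ** b"
            using ab(3) by (simp only: matrix_mul_assoc[symmetric])
          ultimately show "a = b" using yS by simp
        qed
        show "(\<lambda>x. inv' y ** x) ` ?D w \<subseteq> vec_stab H"
        proof
          fix r assume "r \<in> (\<lambda>x. inv' y ** x) ` ?D w"
          then obtain x where x: "x \<in> H" "x *v e1 = w" "r = inv' y ** x" by blast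
          have "r *v e1 = inv' y *v (y *v e1)" using x y
            by (simp add: matrix_vector_mul_assoc[symmetric])
          then have "r *v e1 = e1" using SL_inv(4)[OF yS, of e1] by simp
          moreover have "r \<in> H" unfolding x(3) using HS(1)[OF HS(2)[OF y(1)] x(1)] .
          ultimately show "r \<in> vec_stab H" unfolding vec_stab_def by simp
        qed
        show "finite (vec_stab H)" using finH unfolding vec_stab_def by simp
      qed
      also have "\<dots> \<le> 4 * p" by (rule card_vec_stab[OF H])
      finally show ?thesis .
    next
      case True
      show ?thesis unfolding True by simp
    qed
  qed
  also have "\<dots> = 4 * p ^ 4" using card_V by (simp add: power3_eq_cube power4_eq_xxxx)
  finally show ?thesis .
qed

end

section \<open>Counting in subgroups without transvections\<close>

context prime_ideal_2_mod_3
begin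

definition centr :: "'a^3^3 \<Rightarrow> ('a^3^3) set" where
  "centr x = {g \<in> carrier SL. g ** x = x ** g}"

lemma finite_centr [simp]: "finite (centr x)"
  by (rule finite_subset[OF _ finite_SL]) (auto simp: centr_def)

lemma mat_scale: "(mat k ** A) $ i $ j = k * A $ i $ j" "mat k ** A = A ** mat k"
  "(mat k ** A) *v v = k *s (A *v v)"
  for A :: "'a^3^3"
  using exhaust_3[of i] by (auto simp: coords algebra_simps)

lemma mat_inj:
  assumes "k \<in> F" "k \<noteq> 0" "A \<in> Mt" "B \<in> Mt" "mat k ** A = mat k ** B"
  shows "A = B"
proof -
  have "k * A $ i $ j = k * B $ i $ j" for i j using assms(5) by (metis mat_scale(1))
  then have "A $ i $ j = B $ i $ j" for i j
    using F_mult_cancel[OF assms(1) _ _ assms(2)] assms(3,4) by (meson Mt_nth)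
  then show ?thesis by (simp add: vec_eq_iff)
qed

text \<open>As cube roots in \<open>F\<close> are unique,
  \<open>GL\<^sub>3\<close> is the direct product of \<open>SL\<^sub>3\<close>
    and the scalars.\<close>

lemma scalar_SL_inj:
  assumes "k \<in> F" "k \<noteq> 0" "k' \<in> F" "k' \<noteq> 0" "A \<in> carrier SL"
    "B \<in> carrier SL" "mat k ** A = mat k' ** B"
  shows "k = k'" "A = B"
proof -
  have det: "det (mat k ** C) = k * k * k" if "k \<in> F" "C \<in> carrier SL" for k C
    using that by (simp add: det_mul carrier_SL) (simp add: det_3 mat_def)
  have "k * k * k = k' * k' * k'" using det[of k A] det[of k' B] assms by simp
  moreover have "(finv k' * k) * (finv k' * k) * (finv k' * k) =
    (finv k' * finv k' * finv k') * (k * k * k)"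
    by (simp only: ac_simps)
  moreover have "(finv k' * finv k' * finv k') * (k' * k' * k') =
    (finv k' * k') * (finv k' * k') * (finv k' * k')"
    by (simp only: ac_simps)
  ultimately have "(finv k' * k) * (finv k' * k) * (finv k' * k) = e"
    using finv(3)[OF assms(3,4)] idem by simp
  then have "finv k' * k = e" by (rule cube_root_one[rotated]) (use finv(1)[OF assms(3,4)] assms
    in simp)
  then have "k' * (finv k' * k) = k'" using assms by simp
  then show kk: "k = k'" using assms by simp
  show "A = B" using mat_inj[of k A B] assms kk by simp
qed

text \<open>A matrix commuting with \<open>x\<close> is determined by its value at the cyclic vector
  \<open>v\<close>. Including the \<open>p - 1\<close> nonzero scalars as factors gains the factor
  on the left.\<close>

lemma centr_cyclic_bound:
  assumes x: "x \<in> carrier SL" and v: "v \<in> V" "dot (cross v (x *v v)) (x *v (x *v v))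
    \<noteq> 0"
  shows "(p - 1) * card (centr x) \<le> p ^ 3"
proof -
  let ?M = "cols v (x *v v) (x *v (x *v v))"
  let ?d = "det ?M"
  have d: "?d \<noteq> 0" "?d \<in> F" using v x by (simp_all add: det_cols)
  have "card ((F - {0}) \<times> centr x) \<le> card V"
  proof (rule card_inj_on_le[of "\<lambda>(k, g). k *s (g *v v)"])
    show "inj_on (\<lambda>(k, g). k *s (g *v v)) ((F - {0}) \<times> centr x)"
    proof (rule inj_onI)
      fix s t assume st: "s \<in> (F - {0}) \<times> centr x" "t \<in> (F - {0}) \<times> centr x"
        "(\<lambda>(k, g). k *s (g *v v)) s = (\<lambda>(k, g). k *s (g *v v)) t"
      obtain k g k' g' where st': "s = (k, g)" "t = (k', g')" by (cases s, cases t) auto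
      have k: "k \<in> F" "k \<noteq> 0" "k' \<in> F" "k' \<noteq> 0"
        and g: "g \<in> centr x" "g' \<in> centr x"
        and eq: "k *s (g *v v) = k' *s (g' *v v)"
        using st unfolding st' by auto
      have gS: "g \<in> carrier SL" "g' \<in> carrier SL" using g unfolding centr_def by auto
      have *: "(mat j ** h) ** ?M = cols (j *s (h *v v)) (x *v (j *s (h *v v))) (x *v (x *v (j *s
        (h *v v))))"
        if "h \<in> centr x" for j h
      proof -
        have hx: "h *v (x *v w) = x *v (h *v w)" for w
          using that unfolding centr_def by (simp add: matrix_vector_mul_assoc)
        show ?thesis by (simp add: cols_mul mat_scale(3) hx mat_vec_scale)
      qed
      have "(mat k ** g) ** ?M = (mat k' ** g') ** ?M" unfolding *[OF g(1)] *[OF g(2)] eq ..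
      then have "(mat k ** g) ** ?M ** adj3 ?M = (mat k' ** g') ** ?M ** adj3 ?M" by simp
      then have "(mat k ** g) ** mat ?d = (mat k' ** g') ** mat ?d"
        by (simp only: matrix_mul_assoc[symmetric] mul_adj3)
      then have "mat ?d ** (mat k ** g) = mat ?d ** (mat k' ** g')"
        by (simp only: mat_scale(2)[of ?d])
      then have "mat k ** g = mat k' ** g'" by (rule mat_inj[OF d(2,1),
        rotated 2]) (use k gS in auto)
      then show "s = t" unfolding st' using scalar_SL_inj[OF k gS] by blast
    qed
    show "(\<lambda>(k, g). k *s (g *v v)) ` ((F - {0}) \<times> centr x) \<subseteq> V"
      using v unfolding centr_def by auto
  qed simp
  then show ?thesis using card_F card_V by (simp add: card_cartesian_product)
qed

text \<open>A matrix commuting with \<open>x\<close> preserves the centre \<open>u\<close> and the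
  axis of \<open>f\<close>, so it is block diagonal with blocks of sizes 1 and 2. With scalar
  factors included, five entries determine the pair.\<close>

lemma centr_special_bound:
  assumes x: "x = mat c + outer u f" and uf: "u \<in> V" "f \<in> V" "dot f u \<noteq> 0"
  shows "(p - 1) * card (centr x) \<le> p ^ 5"
proof -
  have nz': "u \<noteq> 0" "f \<noteq> 0" using uf by (auto simp: dot_linear)
  define a where "a = dot f u"
  have a: "a \<in> F" "a \<noteq> 0" using uf unfolding a_def by auto
  obtain w0 where w0: "w0 \<in> V" "cross u w0 \<noteq> 0" using exists_indep uf nz' by blast
  \<comment> \<open>Projection along \<open>u\<close> moves \<open>w0\<close>, and below
    \<open>z0\<close>, into the kernel of \<open>f\<close>, which gives a basis adapted to centre
    and axis.\<close>
  define w where "w = w0 - (finv a * dot f w0) *s u"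
  have w: "w \<in> V" "dot f w = 0" "cross u w \<noteq> 0"
  proof -
    show "w \<in> V" unfolding w_def using w0 uf finv(1)[OF a] by simp
    have "dot f w = dot f w0 - dot f w0 * (finv a * a)"
      unfolding w_def a_def by (simp add: dot_linear ac_simps)
    then show "dot f w = 0" using w0 uf finv(3)[OF a] by simp
    have "cross u w = cross u w0" unfolding w_def by (simp add: coords algebra_simps)
    then show "cross u w \<noteq> 0" using w0 by simp
  qed
  obtain z0 where z0: "z0 \<in> V" "dot (cross u w) z0 = e" using exists_cols uf w by blast
  define z where "z = z0 - (finv a * dot f z0) *s u"
  have z: "z \<in> V" "dot f z = 0" "dot (cross u w) z = e"
  proof -
    show "z \<in> V" unfolding z_def using z0 uf finv(1)[OF a] by simp
    have "dot f z = dot f z0 - dot f z0 * (finv a * a)"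
      unfolding z_def a_def by (simp add: dot_linear ac_simps)
    then show "dot f z = 0" using z0 uf finv(3)[OF a] by simp
    show "dot (cross u w) z = e" unfolding z_def using z0 by (simp add: dot_linear dot_cross)
  qed
  define h where "h = cols u w z"
  have h: "h \<in> carrier SL" "h *v e1 = u" "f v* h = a *s e1"
    unfolding h_def using cols_SL cols_e uf w z by (auto simp: cols_mul a_def vec_eq_iff forall_3)
  have ih: "inv' h \<in> carrier SL" using h by simp
  have ihu: "inv' h *v u = e1" using SL_inv(4)[OF h(1), of e1] h by simp
  have ihf: "e1 v* inv' h = finv a *s f"
  proof -
    have "f = (f v* h) v* inv' h" using SL_inv(6)[OF h(1) uf(2)] by (rule sym)
    also have "\<dots> = a *s (e1 v* inv' h)" unfolding h(3) by (simp add: mat_vec_scale)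
    finally have "finv a *s f = finv a *s (a *s (e1 v* inv' h))" by (rule arg_cong)
    then show ?thesis using finv(3)[OF a] ih by (simp add: mat_vec_scale)
  qed
  have gS: "g \<in> carrier SL" if "g \<in> centr x" for g using that unfolding centr_def by simp
  define m where "m g = inv' h ** g ** h" for g
  have mS: "m g \<in> carrier SL" if "g \<in> centr x" for g unfolding m_def
    using h ih gS[OF that] by simp
  have ent: "m g $ 2 $ 1 = 0" "m g $ 3 $ 1 = 0" "m g $ 1 $ 2 = 0" "m g $ 1 $ 3 = 0"
    if g: "g \<in> centr x" for g
  proof -
    have "mat c ** g + outer (g *v u) f = g ** mat c + outer (g *v u) f"
      by (simp add: mat_scale(2)[of c])
    also have "\<dots> = g ** x" unfolding x by (simp add: mat_mul_add outer_mul)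
    also have "\<dots> = x ** g" using g unfolding centr_def by simp
    also have "\<dots> = mat c ** g + outer u (f v* g)" unfolding x
      by (simp add: mat_mul_add outer_mul)
    \<comment> \<open>Comparing both sides, \<open>g *v u\<close> is a multiple of \<open>u\<close>
      and \<open>f v* g\<close> a multiple of \<open>f\<close>.\<close>
    finally have o: "outer (g *v u) f = outer u (f v* g)" by simp
    obtain w1 where w1: "w1 \<in> V" "dot f w1 = e" using dot_dual uf nz' by blast
    have "outer (g *v u) f *v w1 = outer u (f v* g) *v w1" unfolding o ..
    then have gu: "g *v u = dot (f v* g) w1 *s u" using w1 uf gS[OF g] by (simp add: outer_mul_vec)
    obtain l where l: "l \<in> V" "dot u l = e" using dot_dual uf nz' by blast
    have "l v* outer (g *v u) f = l v* outer u (f v* g)" unfolding o ..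
    then have fg: "f v* g = dot l (g *v u) *s f" using l uf gS[OF g]
      by (simp add: outer_mul_vec dot_commute[of l u])
    have "m g *v e1 = dot (f v* g) w1 *s e1"
      unfolding m_def by (simp add: matrix_vector_mul_assoc[symmetric] h gu mat_vec_scale ihu)
    moreover have "e1 v* m g = (finv a * dot l (g *v u) * a) *s e1"
      unfolding m_def by (simp add: vector_matrix_mul_assoc[symmetric] ihf fg mat_vec_scale h)
    ultimately show "m g $ 2 $ 1 = 0" "m g $ 3 $ 1 = 0" "m g $ 1 $ 2 = 0" "m g $ 1 $ 3 = 0"
      using mS[OF g] by (simp_all add: vec_eq_iff forall_3 matrix_vector_mult_def
        vector_matrix_mult_def sum_3)
  qed
  have "card ((F - {0}) \<times> centr x) \<le> card (F \<times> F \<times> F \<times> F \<times>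
    F)"
  proof (rule card_inj_on_le[of "\<lambda>(k, g). (k * m g $ 1 $ 1, k * m g $ 2 $ 2,
    k * m g $ 2 $ 3, k * m g $ 3 $ 2, k * m g $ 3 $ 3)"])
    show "inj_on (\<lambda>(k, g). (k * m g $ 1 $ 1, k * m g $ 2 $ 2, k * m g $ 2 $ 3,
      k * m g $ 3 $ 2, k * m g $ 3 $ 3)) ((F - {0}) \<times> centr x)"
    proof (rule inj_onI)
      fix s t assume st: "s \<in> (F - {0}) \<times> centr x" "t \<in> (F - {0}) \<times> centr x"
        "(\<lambda>(k, g). (k * m g $ 1 $ 1, k * m g $ 2 $ 2, k * m g $ 2 $ 3, k * m g $ 3 $ 2,
          k * m g $ 3 $ 3)) s =
         (\<lambda>(k, g). (k * m g $ 1 $ 1, k * m g $ 2 $ 2, k * m g $ 2 $ 3, k * m g $ 3 $ 2,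
           k * m g $ 3 $ 3)) t"
      obtain k g k' g' where st': "s = (k, g)" "t = (k', g')" by (cases s, cases t) auto
      have k: "k \<in> F" "k \<noteq> 0" "k' \<in> F" "k' \<noteq> 0"
        and g: "g \<in> centr x" "g' \<in> centr x"
        and eq: "k * m g $ 1 $ 1 = k' * m g' $ 1 $ 1" "k * m g $ 2 $ 2 = k' * m g' $ 2 $ 2"
          "k * m g $ 2 $ 3 = k' * m g' $ 2 $ 3" "k * m g $ 3 $ 2 = k' * m g' $ 3 $ 2"
            "k * m g $ 3 $ 3 = k' * m g' $ 3 $ 3"
        using st unfolding st' by auto
      have "mat k ** m g = mat k' ** m g'"
        unfolding vec_eq_iff forall_3 mat_scale(1) using eq ent[OF g(1)] ent[OF g(2)] by simp
      then have *: "k = k'" "m g = m g'" using scalar_SL_inj[OF k mS[OF g(1)] mS[OF g(2)]] by auto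
      have "h ** m g ** inv' h = g" if "g \<in> centr x" for g
      proof -
        have "h ** m g ** inv' h = (h ** inv' h) ** g ** (h ** inv' h)"
          unfolding m_def by (simp only: matrix_mul_assoc)
        then show ?thesis using h gS[OF that] by simp
      qed
      then show "s = t" unfolding st' using * g by metis
    qed
    show "(\<lambda>(k, g). (k * m g $ 1 $ 1, k * m g $ 2 $ 2, k * m g $ 2 $ 3,
      k * m g $ 3 $ 2, k * m g $ 3 $ 3)) ` ((F - {0}) \<times> centr x)
        \<subseteq> F \<times> F \<times> F \<times> F \<times> F"
      using mS by auto
  qed simp
  then show ?thesis using card_F by (simp add: card_cartesian_product eval_nat_numeral)
qed

text \<open>A nonscalar matrix without cyclic vector differs from a scalar by a matrix of rank one.
  Here \<open>v\<close>, \<open>w\<close> span an invariant plane, and \<open>c\<close> is the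
  eigenvalue on the quotient by it.\<close>

lemma noncyclic_special:
  assumes x: "x \<in> carrier SL" "x \<noteq> mat e"
    and nc: "\<And>v. v \<in> V \<Longrightarrow> dot (cross v (x *v v)) (x *v (x *v v)) = 0"
  shows "\<exists>c\<in>F. \<exists>u\<in>V. \<exists>f\<in>V. u \<noteq> 0 \<and>
    f \<noteq> 0 \<and> x = mat c + outer u f"
proof -
  obtain v where v: "v \<in> V" "cross v (x *v v) \<noteq> 0" using nonscalar[OF x] by blast
  define w where "w = x *v v"
  have w: "w \<in> V" "cross v w \<noteq> 0" unfolding w_def using v x by auto
  obtain z where z: "z \<in> V" "dot (cross v w) z = e" using exists_cols v w by blast
  obtain a b where ab: "a \<in> F" "b \<in> F" "x *v w = a *s v + b *s w"
    using plane_coords[OF v(1) w, of "x *v w"] nc[OF v(1)] w x unfolding w_def by auto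
  obtain r s c where rs: "r \<in> F" "s \<in> F" "c \<in> F" "x *v z = r *s v + s *s w + c *s z"
    using cols_coords[OF v(1) w(1) z, of "x *v z"] x z by auto
  \<comment> \<open>For each \<open>j\<close> choose \<open>i\<close> such that \<open>y =
    z + i v + j w\<close> satisfies \<open>x y = c y + P v\<close>; then \<open>P\<^sup>2 =
      0\<close>.\<close>
  have P0: "r + c * s + (a + c * (b - c)) * j = 0" if j: "j \<in> F" for j
  proof -
    define i where "i = - s - (b - c) * j"
    define P where "P = r + c * s + (a + c * (b - c)) * j"
    define y where "y = z + i *s v + j *s w"
    have ij: "i \<in> F" "P \<in> F" "y \<in> V" unfolding i_def P_def y_def
      using j ab rs z v w by simp_all
    have "x *v y = (r *s v + s *s w + c *s z) + i *s w + j *s (a *s v + b *s w)"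
      unfolding y_def by (simp add: matrix_vector_right_distrib mat_vec_scale rs(4) ab(3)
        w_def[symmetric])
    also have "\<dots> = c *s y + P *s v"
      unfolding y_def P_def i_def by (simp add: vec_eq_iff algebra_simps)
    finally have xy: "x *v y = c *s y + P *s v" .
    have xxy: "x *v (x *v y) = c *s (c *s y + P *s v) + P *s w"
      unfolding xy by (simp only: matrix_vector_right_distrib mat_vec_scale xy w_def[symmetric])
    have "dot (cross y v) w = dot (cross v w) z"
      unfolding y_def by (simp add: coords algebra_simps)
    then have yvw: "dot (cross y v) w = e" using z by simp
    have "dot (cross y (x *v y)) (x *v (x *v y)) = P * (P * dot (cross y v) w)"
      unfolding xxy unfolding xy by (simp add: cross_linear dot_linear dot_cross)
    then have "P * P = 0" using nc[OF ij(3)] yvw ij by simp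
    then show ?thesis using ij F_mult_eq_0[of P P] unfolding P_def by simp
  qed
  \<comment> \<open>The values 0 and \<open>e\<close> of \<open>j\<close> separate the constant and
    the linear coefficient. The two relations say that \<open>x\<close> minus \<open>c\<close> maps
    \<open>v\<close>, \<open>w\<close>, \<open>z\<close> to multiples of
    \<open>d = w - c *s v\<close>.\<close>
  have r: "r = - (c * s)" using P0[of 0] by (simp add: eq_neg_iff_add_eq_0)
  have "a + c * (b - c) = 0" using P0[of e] ab rs unfolding r by simp
  then have a: "a = - (c * (b - c))" by (simp add: eq_neg_iff_add_eq_0)
  define d where "d = w - c *s v"
  have d: "d \<in> V" unfolding d_def using v w rs by simp
  have "cross v d = cross v w" unfolding d_def by (simp add: coords algebra_simps)
  then have d0: "d \<noteq> 0" using w by (auto simp: cross_linear)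
  define g where "g = cols v w z"
  have g: "g \<in> carrier SL" unfolding g_def using cols_SL v w z by simp
  let ?k = "vector [e, b - c, s] :: 'a^3"
  define f where "f = ?k v* inv' g"
  have f: "f \<in> V" "f v* g = ?k" unfolding f_def using g ab rs by simp_all
  have "?k \<noteq> 0" using nz by (auto simp: vec_eq_iff forall_3)
  then have f0: "f \<noteq> 0" using f(2) by auto
  have "x ** g = cols w (a *s v + b *s w) (r *s v + s *s w + c *s z)"
    unfolding g_def cols_mul(2) ab(3) rs(4) w_def[symmetric] ..
  also have "\<dots> = (mat c + outer d f) ** g"
  proof -
    have "(mat c + outer d f) ** g = mat c ** g + outer d ?k"
      by (simp add: mat_mul_add outer_mul f(2))
    also have "\<dots> = cols w (a *s v + b *s w) (r *s v + s *s w + c *s z)"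
      unfolding g_def d_def r a using v w by (simp add: coords algebra_simps)
    finally show ?thesis by simp
  qed
  finally have "x ** g ** inv' g = (mat c + outer d f) ** g ** inv' g" by simp
  then have "x = mat c + outer d f" using g x rs d f by (simp add: matrix_mul_assoc[symmetric])
  then show ?thesis using rs d f d0 f0 by blast
qed

lemma special_nz:
  assumes "x = mat c + outer u f" "x \<in> carrier SL" "c \<in> F" "u \<in> V" "f \<in> V"
  shows "c \<noteq> 0" "c * c * c + c * c * dot f u = e"
proof -
  show *: "c * c * c + c * c * dot f u = e" using assms(1,2) by (simp add: carrier_SL det_mat_outer)
  then show "c \<noteq> 0" using nz by auto
qed

text \<open>Equal determinants force \<open>dot f u = dot f' u\<close>. The quotient of the two
  elements is then a transvection centred at a multiple of \<open>u\<close>, hence trivial.\<close>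

lemma special_unique:
  assumes H: "subgroup H SL" "transv_free H" and c: "c \<in> F"
    and V: "u \<in> V" "u \<noteq> 0" "f \<in> V" "f' \<in> V"
    and x: "mat c + outer u f \<in> H" "mat c + outer u f' \<in> H"
  shows "f = f'"
proof -
  note HS = subgroup_SL[OF H(1)]
  let ?x = "mat c + outer u f"
  have S: "?x \<in> carrier SL" "mat c + outer u f' \<in> carrier SL" using HS x by auto
  have ix: "inv' ?x \<in> carrier SL" using S by simp
  have c0: "c \<noteq> 0" using special_nz[OF refl S(1) c V(1,3)] by simp
  have "c * c * dot f u = c * c * dot f' u"
    using special_nz(2)[OF refl S(1) c V(1,3)] special_nz(2)[OF refl S(2) c V(1,4)]
      by (metis add_left_imp_eq)
  then have "dot f u = dot f' u" by (rule F_mult_cancel[rotated 4]) (use c c0 V in auto)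
  then have d0: "dot (f' - f) u = 0" by (simp add: dot_linear)
  have "?x *v u = (c + dot f u) *s u"
    by (simp add: matrix_vector_mult_add_rdistrib outer_mul_vec) (simp add: coords algebra_simps)
  then have iu: "inv' ?x *v u = finv (c + dot f u) *s u"
    using eigen_inv(1)[OF S(1) V(1,2)] c V by simp
  have fV: "f' - f \<in> V" using V by simp
  have iuV: "inv' ?x *v u \<in> V" using ix V by simp
  have "mat c + outer u f' = ?x + outer u (f' - f)"
    by (simp add: vec_eq_iff outer_def algebra_simps)
  then have "inv' ?x ** (mat c + outer u f') = inv' ?x ** ?x + outer (inv' ?x *v u) (f' - f)"
    by (simp add: mat_mul_add outer_mul)
  also have "\<dots> = transv (inv' ?x *v u) (f' - f)" using S by (simp add: transv_def)
  finally have "transv (inv' ?x *v u) (f' - f) \<in> H" using HS(1)[OF HS(2)[OF x(1)] x(2)] by simp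
  then have "inv' ?x *v u = 0 \<or> f' - f = 0"
    by (rule transv_freeD[OF H(2) _ iuV fV]) (simp only: iu dot_linear(6) d0 mult_zero_right)
  then show ?thesis using SL_vec_0[OF ix V(1)] V(2) by simp
qed

definition special :: "'a \<Rightarrow> ('a^3^3) set" where
  "special c = {x. \<exists>u\<in>V. \<exists>f\<in>V. u \<noteq> 0 \<and> f \<noteq> 0 \<and>
    x = mat c + outer u f}"

text \<open>By \<open>special_unique\<close> an element of \<open>H\<close> in
  \<open>special c\<close> is determined by its centre, so the nonzero multiples of the centre
  vectors are pairwise distinct.\<close>

lemma card_special:
  assumes H: "subgroup H SL" "transv_free H" and c: "c \<in> F"
  shows "(p - 1) * card (H \<inter> special c) \<le> p ^ 3"
proof -
  have "\<forall>x\<in>special c. \<exists>u f. u \<in> V \<and> f \<in> V \<and>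
    u \<noteq> 0 \<and> f \<noteq> 0 \<and> x = mat c + outer u f"
    unfolding special_def by blast
  then obtain us fs where uf: "\<And>x. x \<in> special c \<Longrightarrow> us x \<in> V \<and>
    fs x \<in> V \<and> us x \<noteq> 0 \<and> fs x \<noteq> 0 \<and> x =
      mat c + outer (us x) (fs x)"
    by metis
  have "card ((F - {0}) \<times> (H \<inter> special c)) \<le> card V"
  proof (rule card_inj_on_le[of "\<lambda>(k, x). k *s us x"])
    show "inj_on (\<lambda>(k, x). k *s us x) ((F - {0}) \<times> (H \<inter> special c))"
    proof (rule inj_onI)
      fix s t assume st: "s \<in> (F - {0}) \<times> (H \<inter> special c)"
        "t \<in> (F - {0}) \<times> (H \<inter> special c)"
        "(\<lambda>(k, x). k *s us x) s = (\<lambda>(k, x). k *s us x) t"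
      obtain k x k' x' where st': "s = (k, x)" "t = (k', x')" by (cases s, cases t) auto
      have k: "k \<in> F" "k \<noteq> 0" "k' \<in> F" "k' \<noteq> 0"
        and x: "x \<in> H" "x \<in> special c" "x' \<in> H" "x' \<in> special c"
        and eq: "k *s us x = k' *s us x'"
        using st unfolding st' by auto
      note u = uf[OF x(2)] and u' = uf[OF x(4)]
      let ?m = "finv k' * k"
      have mF: "?m \<in> F" using finv(1)[OF k(3,4)] k by simp
      have "finv k' *s (k *s us x) = finv k' *s (k' *s us x')" using eq by simp
      then have us: "us x' = ?m *s us x" using finv(3)[OF k(3,4)] u' by (simp add: mat_vec_scale)
      have x'e: "x' = mat c + outer (us x) (?m *s fs x')"
        using u' unfolding us by (simp add: outer_add)
      have "fs x = ?m *s fs x'"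
        by (rule special_unique[OF H c, of "us x"]) (use u u' x x'e mF in \<open>auto\<close>)
      then have xx: "x = x'" using u x'e by simp
      have "k *s us x = k' *s us x" using eq unfolding xx[symmetric] .
      then have "(k - k') *s us x = 0" by (simp add: vec_eq_iff left_diff_distrib)
      then have "k = k'" using k u by simp
      then show "s = t" unfolding st' using xx by simp
    qed
    show "(\<lambda>(k, x). k *s us x) ` ((F - {0}) \<times> (H \<inter> special c)) \<subseteq>
      V" using uf by auto
  qed simp
  then show ?thesis using card_F card_V by (simp add: card_cartesian_product)
qed

text \<open>Trades the factor \<open>p - 1\<close> for \<open>p\<close> at the cost of a factor
  2.\<close>

lemma divide_bound:
  assumes "(p - 1) * a \<le> p ^ Suc n"
  shows "a \<le> 2 * p ^ n"
proof -
  have "p \<le> 2 * (p - 1)" using p_large by simp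
  then have "p * a \<le> 2 * (p - 1) * a" by (rule mult_le_mono1)
  also have "\<dots> \<le> 2 * p ^ Suc n" using assms by simp
  finally have "p * a \<le> p * (2 * p ^ n)" by simp
  then show ?thesis using p_large by simp
qed

definition transporter :: "'a^3^3 \<Rightarrow> ('a^3^3) set \<Rightarrow> ('a^3^3) set" where
  "transporter x Y = {g \<in> carrier SL. g ** x ** inv' g \<in> Y}"

text \<open>The elements that conjugate \<open>x\<close> to one given \<open>y\<close> form a coset
  of the centralizer, if there are any.\<close>

lemma card_transporter:
  assumes x: "x \<in> carrier SL" and "finite Y"
  shows "card (transporter x Y) \<le> card Y * card (centr x)"
proof -
  let ?D = "\<lambda>y. {g \<in> carrier SL. g ** x ** inv' g = y}"
  have "transporter x Y \<subseteq> (\<Union>y\<in>Y. ?D y)" unfolding transporter_def by auto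
  then have "card (transporter x Y) \<le> card (\<Union>y\<in>Y. ?D y)" using assms(2)
    by (intro card_mono) auto
  also have "\<dots> \<le> (\<Sum>y\<in>Y. card (?D y))" by (rule card_UN_le) fact
  also have "\<dots> \<le> (\<Sum>y\<in>Y. card (centr x))"
  proof (rule sum_mono)
    fix y assume "y \<in> Y"
    show "card (?D y) \<le> card (centr x)"
    proof (cases "?D y = {}")
      case True
      show ?thesis unfolding True by simp
    next
      case False
      then obtain h where h: "h \<in> carrier SL" "h ** x ** inv' h = y" by blast
      have hg: "h ** (inv' h ** g) = g" if "g \<in> carrier SL" for g
        using h that by (simp add: matrix_mul_assoc)
      show ?thesis
      proof (rule card_inj_on_le[of "\<lambda>g. inv' h ** g"])
        show "inj_on (\<lambda>g. inv' h ** g) (?D y)"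
          by (rule inj_onI) (metis (no_types, lifting) hg mem_Collect_eq)
        show "(\<lambda>g. inv' h ** g) ` ?D y \<subseteq> centr x"
        proof
          fix r assume "r \<in> (\<lambda>g. inv' h ** g) ` ?D y"
          then obtain g where g: "g \<in> carrier SL" "g ** x ** inv' g = y" "r = inv' h ** g"
            by blast
          have "y ** g = g ** x ** (inv' g ** g)" unfolding g(2)[symmetric]
            by (simp only: matrix_mul_assoc)
          then have yg: "y ** g = g ** x" using g(1) x by simp
          have "inv' h ** y = (inv' h ** h) ** x ** inv' h" unfolding h(2)[symmetric]
            by (simp only: matrix_mul_assoc)
          then have hy: "inv' h ** y = x ** inv' h" using h(1) x by simp
          have "r ** x = inv' h ** (y ** g)" unfolding g(3) yg by (simp only: matrix_mul_assoc)
          also have "\<dots> = x ** r" unfolding g(3) by (simp only: matrix_mul_assoc hy)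
          finally show "r \<in> centr x" unfolding centr_def using g h by simp
        qed
      qed simp
    qed
  qed
  also have "\<dots> = card Y * card (centr x)" by simp
  finally show ?thesis .
qed

text \<open>Counts the matrices whose first two leading minors \<open>a\<close> and \<open>m\<close>
  are nonzero. These minors and six entries can be prescribed; the other two entries follow.\<close>

lemma order_SL_ge: "p ^ 6 * (p - 1) ^ 2 \<le> order SL"
proof -
  let ?P = "(F - {0}) \<times> (F - {0}) \<times> F \<times> F \<times> F \<times> F \<times> F
    \<times> F"
  define \<phi> where "\<phi> A = (A$1$1, A$1$1 * A$2$2 - A$1$2 * A$2$1, A$1$2, A$2$1, A$1$3,
    A$2$3, A$3$1, A$3$2)" for A :: "'a^3^3"
  have "?P \<subseteq> \<phi> ` carrier SL"
  proof
    fix t assume tP: "t \<in> ?P"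
    obtain a m b c f g h i where t: "t = (a, m, b, c, f, g, h, i)" by (metis surj_pair)
    have F: "a \<in> F" "a \<noteq> 0" "m \<in> F" "m \<noteq> 0" "b \<in> F" "c \<in> F"
      "f \<in> F" "g \<in> F" "h \<in> F" "i \<in> F"
      using tP unfolding t by auto
    \<comment> \<open>The entry \<open>d\<close> is solved from the minor
      \<open>m = a * d - b * c\<close>; then \<open>k\<close> is solved from the determinant, in
      which it has coefficient \<open>m\<close>.\<close>
    define d where "d = finv a * (m + b * c)"
    have d: "d \<in> F" "a * d = m + b * c" unfolding d_def using F finv(1)[OF F(1,2)] by simp_all
    define q where "q = b * g * h + f * c * i - a * g * i - f * d * h"
    define k where "k = finv m * (e - q)"
    have q: "q \<in> F" unfolding q_def using F d by simp
    have k: "k \<in> F" "m * k = e - q" unfolding k_def using F finv(1)[OF F(3,4)] q by simp_all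
    let ?A = "vector [vector [a, b, f], vector [c, d, g], vector [h, i, k]] :: 'a^3^3"
    have "det ?A = (a * d - b * c) * k + q" unfolding q_def by (simp add: det_3 algebra_simps)
    also have "\<dots> = e" unfolding d(2) using k by simp
    finally have "?A \<in> carrier SL" using F d k by (simp add: carrier_SL Mt_iff)
    moreover have "\<phi> ?A = (a, m, b, c, f, g, h, i)" unfolding \<phi>_def using d by simp
    ultimately show "t \<in> \<phi> ` carrier SL" unfolding t by (metis image_eqI)
  qed
  then have "card ?P \<le> card (carrier SL)" by (rule surj_card_le[OF finite_SL])
  then show ?thesis using card_F by (simp add: card_cartesian_product order_def eval_nat_numeral
    ac_simps)
qed

lemma transv_free_regular:
  assumes H: "subgroup H SL" "transv_free H"
  shows "regular_tuple SL 4 (\<lambda>_. H)"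
proof -
  note HS = subgroup_SL[OF H(1)]
  have finH: "finite H" by (rule finite_subset[OF _ finite_SL]) (use HS in auto)
  define T where "T x = transporter x H" for x
  have fT: "finite (T x)" for x unfolding T_def transporter_def by simp
  \<comment> \<open>The bad triples: together with the identity they leave a nontrivial
    \<open>x\<close> in all four conjugates.\<close>
  define B where "B = (\<Union>x\<in>H - {mat e}. T x \<times> T x \<times> T x)"
  define Sp where "Sp = (\<Union>c\<in>F. H \<inter> special c) - {mat e}"
  have cH: "card H \<le> 4 * p ^ 4" using card_transv_free[OF H] .
  have cS: "card (H \<inter> special c) \<le> 2 * p ^ 2" if "c \<in> F" for c
    by (rule divide_bound) (use card_special[OF H that] in \<open>simp add: numeral_3_eq_3\<close>)
  \<comment> \<open>The centralizer is too large for the bound by \<open>card H\<close>. Conjugates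
    of \<open>x\<close> stay in \<open>special c\<close>, so only
    \<open>card (H \<inter> special c)\<close> targets count.\<close>
  have TS: "card (T x) \<le> 4 * p ^ 6" if xS: "x \<in> Sp" for x
  proof -
    obtain c u f where c: "c \<in> F" "x \<in> H" "x \<in> special c" "x \<noteq> mat e"
      "u \<in> V" "f \<in> V" "u \<noteq> 0" "f \<noteq> 0" "x = mat c + outer u f"
      using xS unfolding Sp_def special_def by blast
    have x: "x \<in> carrier SL" using HS c by blast
    \<comment> \<open>With \<open>dot f u = 0\<close> the determinant gives \<open>c = e\<close>,
      and \<open>x\<close> would be a transvection.\<close>
    have fu: "dot f u \<noteq> 0"
    proof
      assume d: "dot f u = 0"
      then have "c * c * c = e" using special_nz(2)[OF c(9) x c(1,5,6)] by simp
      then have "c = e" using cube_root_one c by blast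
      then have "transv u f \<in> H" using c unfolding transv_def by simp
      then show False using transv_freeD[OF H(2) _ c(5,6) d] c by blast
    qed
    have "T x \<subseteq> transporter x (H \<inter> special c)"
    proof
      fix g assume g: "g \<in> T x"
      then have gS: "g \<in> carrier SL" unfolding T_def transporter_def by simp
      have ig: "inv' g \<in> carrier SL" using gS by simp
      have "g ** x ** inv' g = g ** mat c ** inv' g + outer (g *v u) (f v* inv' g)"
        unfolding c(9) by (simp add: mat_mul_add outer_mul)
      also have "g ** mat c ** inv' g = mat c ** (g ** inv' g)"
        by (simp only: mat_scale(2)[of c] matrix_mul_assoc)
      also have "\<dots> = mat c" using gS c by simp
      finally have "g ** x ** inv' g \<in> special c"
        unfolding special_def using gS ig c(1,5-8)
        by (intro CollectI bexI[of _ "g *v u"] bexI[of _ "f v* inv' g"]) simp_all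
      then show "g \<in> transporter x (H \<inter> special c)" using g
        unfolding T_def transporter_def by simp
    qed
    then have "card (T x) \<le> card (transporter x (H \<inter> special c))"
      by (intro card_mono) (auto simp: transporter_def)
    also have "\<dots> \<le> card (H \<inter> special c) * card (centr x)"
      by (rule card_transporter[OF x]) (use finH in simp)
    also have "\<dots> \<le> (2 * p ^ 2) * (2 * p ^ 4)"
    proof (rule mult_le_mono[OF cS[OF c(1)]])
      have "(p - 1) * card (centr x) \<le> p ^ Suc 4"
        using centr_special_bound[OF c(9,5,6) fu] by simp
      then show "card (centr x) \<le> 2 * p ^ 4" by (rule divide_bound)
    qed
    also have "\<dots> = 4 * p ^ 6" by (simp add: power_add[symmetric])
    finally show ?thesis .
  qed
  have TN: "card (T x) \<le> 8 * p ^ 6" if x: "x \<in> H - {mat e} - Sp" for x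
  proof -
    have xS: "x \<in> carrier SL" using HS x by blast
    have "\<exists>v\<in>V. dot (cross v (x *v v)) (x *v (x *v v)) \<noteq> 0"
    proof (rule ccontr)
      assume "\<not> ?thesis"
      then have "\<exists>c\<in>F. x \<in> special c" using noncyclic_special[OF xS] x
        unfolding special_def by blast
      then show False using x unfolding Sp_def by blast
    qed
    then obtain v where v: "v \<in> V" "dot (cross v (x *v v)) (x *v (x *v v)) \<noteq> 0" by blast
    have "card (T x) \<le> card H * card (centr x)" unfolding T_def
      by (rule card_transporter[OF xS finH])
    also have "\<dots> \<le> (4 * p ^ 4) * (2 * p ^ 2)"
    proof (rule mult_le_mono[OF cH])
      have "(p - 1) * card (centr x) \<le> p ^ Suc 2" using centr_cyclic_bound[OF xS v]
        by (simp add: numeral_3_eq_3)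
      then show "card (centr x) \<le> 2 * p ^ 2" by (rule divide_bound)
    qed
    also have "\<dots> = 8 * p ^ 6" by (simp add: power_add[symmetric])
    finally show ?thesis .
  qed
  have cSp: "card Sp \<le> 2 * p ^ 3"
  proof -
    have "card Sp \<le> card (\<Union>c\<in>F. H \<inter> special c)" unfolding Sp_def
      using finH by (intro card_mono) auto
    also have "\<dots> \<le> (\<Sum>c\<in>F. card (H \<inter> special c))" by (rule card_UN_le) simp
    also have "\<dots> \<le> (\<Sum>c\<in>F. 2 * p ^ 2)" using cS by (rule sum_mono)
    also have "\<dots> = 2 * p ^ 3" using card_F by (simp add: power2_eq_square power3_eq_cube)
    finally show ?thesis .
  qed
  have "card B \<le> (\<Sum>x\<in>H - {mat e}. card (T x) ^ 3)"
  proof -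
    have "card B \<le> (\<Sum>x\<in>H - {mat e}. card (T x \<times> T x \<times> T x))"
      unfolding B_def by (rule card_UN_le) (use finH in simp)
    then show ?thesis by (simp add: card_cartesian_product power3_eq_cube mult.assoc)
  qed
  also have "\<dots> = (\<Sum>x\<in>Sp. card (T x) ^ 3) + (\<Sum>x\<in>H - {mat e} - Sp. card (T
    x) ^ 3)"
    by (subst sum.subset_diff[of Sp]) (use finH in \<open>auto simp: Sp_def\<close>)
  also have "\<dots> \<le> (\<Sum>x\<in>Sp. (4 * p ^ 6) ^ 3) + (\<Sum>x\<in>H - {mat e} - Sp. (8
    * p ^ 6) ^ 3)"
    by (intro add_mono sum_mono power_mono TS TN) auto
  also have "\<dots> \<le> (2 * p ^ 3) * (4 * p ^ 6) ^ 3 + (4 * p ^ 4) * (8 * p ^ 6) ^ 3"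
  proof -
    have "card (H - {mat e} - Sp) \<le> card H" using finH by (intro card_mono) auto
    then have "card (H - {mat e} - Sp) \<le> 4 * p ^ 4" using cH by simp
    then show ?thesis using cSp by (simp only: sum_constant of_nat_id) (intro add_mono
      mult_le_mono1)
  qed
  also have "\<dots> < (order SL) ^ 3"
  proof -
    have "p ^ 8 \<le> 2 * (p ^ 6 * (p - 1) ^ 2)"
    proof -
      have "p ^ 2 \<le> 2 * (p - 1) ^ 2"
      proof -
        obtain q where q: "p = Suc q" "q \<ge> 200" using p_large by (cases p) auto
        have "3 * q \<le> q * q" using q(2) by (intro mult_le_mono1) simp
        then have "2 * q + 1 \<le> q * q" using q(2) by linarith
        then show ?thesis unfolding q by (simp add: power2_eq_square)
      qed
      then have "p ^ 6 * p ^ 2 \<le> p ^ 6 * (2 * (p - 1) ^ 2)" by (rule mult_le_mono2)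
      then show ?thesis by (simp add: power_add[symmetric])
    qed
    then have "p ^ 8 \<le> 2 * order SL" using order_SL_ge by linarith
    then have "(p ^ 8) ^ 3 \<le> (2 * order SL) ^ 3" by (rule power_mono) simp
    then have 1: "p ^ 24 \<le> 8 * order SL ^ 3" by (simp add: power_mult_distrib
      power_mult[symmetric])
    have 2: "8 * ((2 * p ^ 3) * (4 * p ^ 6) ^ 3 + (4 * p ^ 4) * (8 * p ^ 6) ^ 3) =
      p ^ 21 * (1024 + 16384 * p)"
      by (simp add: power_mult_distrib power_mult[symmetric] algebra_simps power_add[symmetric])
        (simp add: power_Suc[symmetric] del: power_Suc)
    \<comment> \<open>The constants are 8 * 2 * 4^3 and 8 * 4 * 8^3, where the first 8 comes from
      \<open>p ^ 8\<close> being at most \<open>2 * order SL\<close>.\<close>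
    have "1024 + 16384 * p < p ^ 3"
    proof -
      have "200 * 200 \<le> p * p" using p_large by (intro mult_le_mono) auto
      then have "40000 * p \<le> p * p * p" by (intro mult_le_mono1) simp
      then show ?thesis using p_large unfolding power3_eq_cube by linarith
    qed
    then have "p ^ 21 * (1024 + 16384 * p) < p ^ 21 * p ^ 3" using p_large
      by (intro mult_strict_left_mono) auto
    then show ?thesis using 1 2 by (simp add: power_add[symmetric])
  qed
  finally have "card B < card (carrier SL \<times> carrier SL \<times> carrier SL)"
    by (simp add: card_cartesian_product order_def power3_eq_cube mult.assoc)
  moreover have "finite B" unfolding B_def using finH fT by auto
  ultimately have "\<not> carrier SL \<times> carrier SL \<times> carrier SL \<subseteq> B"
    using card_mono by (metis leD)
  then obtain g1 g2 g3 where g: "g1 \<in> carrier SL" "g2 \<in> carrier SL"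
    "g3 \<in> carrier SL" "(g1, g2, g3) \<notin> B" by auto
  \<comment> \<open>The conjugator \<open>mat e\<close> at index 0 puts the common element into
    \<open>H\<close> itself; the triple outside \<open>B\<close> does the rest.\<close>
  define g where "g i = (if i = 0 then mat e else if i = 1 then g1 else if i =
    2 then g2 else g3)" for i :: nat
  show ?thesis
  proof (rule regular_tupleI[OF H(1), of _ g])
    show "g i \<in> carrier SL" for i unfolding g_def using g by simp
    fix x assume x: "x \<in> carrier SL" and *: "\<And>i. i < 4 \<Longrightarrow>
      g i ** x ** inv' (g i) \<in> H"
    have "inv' (mat e) = mat e" using SL.inv_one by simp
    then have "x \<in> H" using *[of 0] x unfolding g_def by simp
    moreover have "g1 \<in> T x" "g2 \<in> T x" "g3 \<in> T x"
      using *[of 1] *[of 2] *[of 3] g unfolding g_def T_def transporter_def by auto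
    ultimately show "x = mat e" using g(4) unfolding B_def by blast
  qed
qed

theorem base_number_SL: "base_number SL \<le> 4"
proof -
  have "base_size SL H \<le> 4" if cf: "core_free SL H" for H
  proof -
    have H: "subgroup H SL" "H \<noteq> carrier SL"
      using simple_group.core_free_iff[OF simple_SL] cf by auto
    have "regular_tuple SL 4 (\<lambda>_. H)"
    proof (cases "acts_irred H")
      case False
      then show ?thesis using reducible_cases[OF H(1)] reducible_regular[OF H(1)] by blast
    next
      case True
      then have "transv_free H" using irreducible_with_transvection[OF H(1) True] H(2)
        unfolding transv_free_def by blast
      then show ?thesis using transv_free_regular[OF H(1)] by blast
    qed
    then show ?thesis unfolding base_size_def by (rule Least_le)
  qed
  then show ?thesis unfolding base_number_def by (intro Least_le) simp
qed

end

section \<open>Transport to groups on the natural numbers\<close>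

lemma (in group) core_free_iso:
  assumes K: "group K" and f: "f \<in> iso G K" and H: "core_free G H"
  shows "core_free K (f ` H)"
proof -
  interpret K: group K by fact
  interpret f: group_hom G K f
    using f unfolding iso_def by unfold_locales auto
  have bij: "bij_betw f (carrier G) (carrier K)" using f unfolding iso_def by simp
  have Hs: "subgroup H G" using H unfolding core_free_def by blast
  show ?thesis
    unfolding core_free_def
  proof (intro conjI allI impI)
    show "subgroup (f ` H) K" using f.subgroup_img_is_subgroup[OF Hs] .
    fix N assume N: "N \<lhd> K \<and> N \<subseteq> f ` H"
    let ?M = "{x \<in> carrier G. f x \<in> N}"
    have Ns: "subgroup N K" using N normal_imp_subgroup by blast
    have M: "?M \<lhd> G"
      unfolding normal_inv_iff
    proof (intro conjI ballI)
      show "subgroup ?M G"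
        by (rule subgroupI)
          (auto simp: subgroup.m_closed[OF Ns] subgroup.m_inv_closed[OF Ns]
            subgroup.one_closed[OF Ns] intro!: exI[of _ \<one>])
      show "x \<otimes> h \<otimes> inv x \<in> ?M" if "x \<in> carrier G" "h \<in> ?M" for x h
        using that normal.inv_op_closed2[of N K "f x" "f h"] N by simp
    qed
    moreover have "?M \<subseteq> H"
    proof
      fix x assume x: "x \<in> ?M"
      then obtain h where h: "h \<in> H" "f x = f h" using N by blast
      then have "x = h" using bij x subgroup.mem_carrier[OF Hs]
        unfolding bij_betw_def inj_on_def by blast
      then show "x \<in> H" using h by simp
    qed
    ultimately have M1: "?M = {\<one>}" using H unfolding core_free_def by blast
    have "N \<subseteq> {\<one>\<^bsub>K\<^esub>}"
    proof
      fix y assume y: "y \<in> N"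
      then obtain x where x: "x \<in> carrier G" "y = f x"
        using bij subgroup.mem_carrier[OF Ns] unfolding bij_betw_def by blast
      then have "x = \<one>" using M1 y by blast
      then show "y \<in> {\<one>\<^bsub>K\<^esub>}" using x by simp
    qed
    then show "N = {\<one>\<^bsub>K\<^esub>}" using subgroup.one_closed[OF Ns] by blast
  qed
qed

lemma (in group) regular_tuple_iso:
  assumes K: "group K" and f: "f \<in> iso G K" and H: "\<And>i. i < k \<Longrightarrow>
    subgroup (H i) G"
    and reg: "regular_tuple K k (\<lambda>i. f ` H i)"
  shows "regular_tuple G k H"
proof -
  interpret K: group K by fact
  interpret f: group_hom G K f
    using f unfolding iso_def by unfold_locales auto
  have bij: "bij_betw f (carrier G) (carrier K)" using f unfolding iso_def by simp
  then have inj: "inj_on f (carrier G)" unfolding bij_betw_def by blast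
  obtain g' where g': "\<forall>i<k. g' i \<in> carrier K" "conj_inter K k (\<lambda>i. f ` H i)
    g' = {\<one>\<^bsub>K\<^esub>}"
    using reg unfolding regular_tuple_def by blast
  have "\<forall>i. \<exists>x. i < k \<longrightarrow> x \<in> carrier G \<and> f x = g' i"
    using g'(1) bij unfolding bij_betw_def by (metis imageE)
  then obtain g where g: "\<And>i. i < k \<Longrightarrow> g i \<in> carrier G"
    "\<And>i. i < k \<Longrightarrow> f (g i) = g' i" by metis
  have "conj_inter G k H g \<subseteq> {\<one>}"
  proof
    fix x assume x: "x \<in> conj_inter G k H g"
    then have xc: "x \<in> carrier G" unfolding conj_inter_def by blast
    have "f x \<in> conjugate K (f ` H i) (g' i)" if i: "i < k" for i
    proof -
      have "g i \<otimes> x \<otimes> inv (g i) \<in> H i"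
        using x i mem_conjugate_iff[OF H[OF i] g(1)[OF i] xc] unfolding conj_inter_def by blast
      then have "f (g i \<otimes> x \<otimes> inv (g i)) \<in> f ` H i" by blast
      then have "g' i \<otimes>\<^bsub>K\<^esub> f x \<otimes>\<^bsub>K\<^esub>
        inv\<^bsub>K\<^esub> (g' i) \<in> f ` H i" using g[OF i] xc by simp
      then show ?thesis
        using K.mem_conjugate_iff[OF f.subgroup_img_is_subgroup[OF H[OF i]]] g'(1) i xc by simp
    qed
    then have "f x \<in> conj_inter K k (\<lambda>i. f ` H i) g'" using xc
      unfolding conj_inter_def by auto
    then have "f x = f \<one>" using g'(2) by simp
    then show "x \<in> {\<one>}" using inj xc unfolding inj_on_def by blast
  qed
  moreover have "\<one> \<in> conj_inter G k H g" by (rule one_conj_inter) (use H g in auto)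
  ultimately have "conj_inter G k H g = {\<one>}" by blast
  then show ?thesis using g unfolding regular_tuple_def by blast
qed

text \<open>Core-free tuples are pushed forward along \<open>f\<close> and regularity is pulled
  back, so one inequality results. The isomorphism and its inverse then supply the two directions
  needed for \<open>nat_group_large\<close>.\<close>

lemma (in group) regularity_number_iso_le:
  assumes K: "group K" and f: "f \<in> iso G K" and fin: "finite (carrier G)"
  shows "regularity_number G \<le> regularity_number K"
proof -
  interpret K: group K by fact
  have "bij_betw f (carrier G) (carrier K)" using f unfolding iso_def by simp
  then have finK: "finite (carrier K)" using fin bij_betw_finite by blast
  have "regular_tuple G (regularity_number K) H" if cf: "\<forall>i<regularity_number K.
    core_free G (H i)" for H
  proof (rule regular_tuple_iso[OF K f])
    show "subgroup (H i) G" if "i < regularity_number K" for i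
      using cf that unfolding core_free_def by simp
    have "\<forall>i<regularity_number K. core_free K (f ` H i)"
      using cf core_free_iso[OF K f] by simp
    then show "regular_tuple K (regularity_number K) (\<lambda>i. f ` H i)"
      by (rule K.regularity_number_attained(2)[OF finK])
  qed
  then show ?thesis
    unfolding regularity_number_def[of G] using K.regularity_number_attained(1)[OF finK]
      by (intro Least_le) blast
qed

lemma (in group) base_number_iso_le:
  assumes K: "group K" and f: "f \<in> iso G K" and fin: "finite (carrier G)"
  shows "base_number G \<le> base_number K"
proof -
  interpret K: group K by fact
  have "bij_betw f (carrier G) (carrier K)" using f unfolding iso_def by simp
  then have finK: "finite (carrier K)" using fin bij_betw_finite by blast
  have "base_size G H \<le> base_number K" if H: "core_free G H" for H
  proof -
    have cf: "core_free K (f ` H)" using core_free_iso[OF K f H] .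
    have "regular_tuple G (base_size K (f ` H)) (\<lambda>_. H)"
      by (rule regular_tuple_iso[OF K f]) (use H K.base_size_attained(1)[OF finK cf] in
        \<open>auto simp: core_free_def\<close>)
    then have "base_size G H \<le> base_size K (f ` H)" unfolding base_size_def[of G]
      by (rule Least_le)
    then show ?thesis using K.base_number_attained(2)[OF finK cf] by simp
  qed
  then show ?thesis
    unfolding base_number_def[of G] using K.base_number_attained(1)[OF finK]
      by (intro Least_le) blast
qed

lemma (in group) nat_copy:
  assumes "finite (carrier G)"
  shows "\<exists>(K :: nat monoid) f. group K \<and> f \<in> iso G K"
proof -
  obtain c :: "'a \<Rightarrow> nat" where c: "inj_on c (carrier G)"
    using assms finite_imp_inj_to_nat_seg by blast
  define d where "d = inv_into (carrier G) c"
  have dc: "d (c x) = x" if "x \<in> carrier G" for x unfolding d_def using c that by simp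
  define K :: "nat monoid" where "K = \<lparr>carrier = c ` carrier G, monoid.mult =
    (\<lambda>m n. c (d m \<otimes> d n)), one = c \<one>\<rparr>"
  have K: "carrier K = c ` carrier G" "m \<otimes>\<^bsub>K\<^esub> n = c (d m \<otimes> d n)"
    "\<one>\<^bsub>K\<^esub> = c \<one>" for m n unfolding K_def by simp_all
  have gK: "group K"
  proof (rule groupI)
    fix x assume "x \<in> carrier K"
    then obtain a where a: "a \<in> carrier G" "x = c a" unfolding K by blast
    then show "\<exists>y\<in>carrier K. y \<otimes>\<^bsub>K\<^esub> x = \<one>\<^bsub>K\<^esub>"
      unfolding K by (intro bexI[of _ "c (inv a)"]) (auto simp: dc)
  qed (auto simp: K dc m_assoc)
  have "c \<in> iso G K"
    unfolding iso_def hom_def bij_betw_def using c by (auto simp: K dc)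
  with gK show ?thesis by blast
qed

section \<open>The product of all prime fields\<close>

text \<open>The product of the integers modulo \<open>n\<close> over all \<open>n\<close>, with
  canonical representatives. Factor 0 is the ring of integers, because \<open>mod 0\<close> changes
  nothing, and factor 1 is trivial. One type thus contains every prime field as an ideal.\<close>

typedef residues = "{f :: nat \<Rightarrow> int. \<forall>n. f n = f n mod int n}"
  by (rule exI[of _ "\<lambda>_. 0"]) simp

setup_lifting type_definition_residues

instantiation residues :: comm_ring_1
begin

lift_definition zero_residues :: residues is "\<lambda>_. 0" by simp
lift_definition one_residues :: residues is "\<lambda>n. 1 mod int n" by simp
lift_definition plus_residues :: "residues \<Rightarrow> residues \<Rightarrow> residues" is
  "\<lambda>f g n. (f n + g n) mod int n" by simp
lift_definition times_residues :: "residues \<Rightarrow> residues \<Rightarrow> residues" is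
  "\<lambda>f g n. (f n * g n) mod int n" by simp
lift_definition uminus_residues :: "residues \<Rightarrow> residues" is
  "\<lambda>f n. (- f n) mod int n" by simp
lift_definition minus_residues :: "residues \<Rightarrow> residues \<Rightarrow> residues" is
  "\<lambda>f g n. (f n - g n) mod int n" by simp

instance
proof
  fix a b c :: residues
  show "a * b * c = a * (b * c)" by transfer (simp add: mod_simps mult.assoc)
  show "a * b = b * a" by transfer (simp add: mult.commute)
  show "1 * a = a" by (transfer, rule ext) (metis mod_mult_left_eq mult_1)
  show "a + b + c = a + (b + c)" by transfer (simp add: mod_simps add.assoc)
  show "a + b = b + a" by transfer (simp add: add.commute)
  show "0 + a = a" by (transfer, rule ext) (metis add_0)
  show "- a + a = 0" by transfer (simp add: mod_simps)
  show "a - b = a + - b" by transfer (simp add: mod_simps)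
  show "(a + b) * c = a * c + b * c" by transfer (simp add: mod_simps distrib_right)
  show "(0::residues) \<noteq> 1" by transfer (auto simp: fun_eq_iff intro!: exI[of _ 2])
qed

end

text \<open>The unit of the factor with index \<open>p\<close>, extended by zero: the idempotent
  \<open>e\<close> of the prime ideals.\<close>

lift_definition residue_unit :: "nat \<Rightarrow> residues" is
  "\<lambda>p n. if n = p then 1 mod int n else 0" by simp

lemma of_nat_residue_unit:
  "Rep_residues (of_nat k * residue_unit p) = (\<lambda>n. if n = p then int k mod int n else 0)"
proof (induction k)
  case 0
  then show ?case by (simp add: zero_residues.rep_eq fun_eq_iff)
next
  case (Suc k)
  have "of_nat (Suc k) * residue_unit p = residue_unit p + of_nat k * residue_unit p"
    by (simp add: distrib_right)
  then show ?case by (simp add: plus_residues.rep_eq Suc residue_unit.rep_eq fun_eq_iff mod_simps)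
qed

lemma residue_prime_ideal:
  assumes "Factorial_Ring.prime p"
  shows "prime_ideal (residue_unit p) p"
proof
  show "residue_unit p * residue_unit p = residue_unit p" by transfer (auto simp: mod_simps)
  have "1 < p" using assms prime_gt_1_nat by blast
  then show "residue_unit p \<noteq> 0" by transfer (auto simp: fun_eq_iff intro!: exI[of _ p])
  show "of_nat p * residue_unit p = 0"
    by (rule Rep_residues_inject[THEN iffD1]) (simp add: of_nat_residue_unit zero_residues.rep_eq
      fun_eq_iff)
qed fact

text \<open>Euclid's argument with \<open>3 * fact (n + 2) - 1\<close>: this number is 2 modulo 3
  and has no prime factor up to \<open>n\<close>. If all its prime factors were 1 modulo 3, so would
  be the number itself.\<close>

lemma infinitely_many_primes_2_mod_3: "\<exists>p. Factorial_Ring.prime p \<and> p mod 3 =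
  2 \<and> p > (n::nat)"
proof (rule ccontr)
  assume no: "\<not> ?thesis"
  define m where "m = 3 * fact (n + 2) - (1::nat)"
  obtain t where t: "fact (n + 2) = Suc t" using fact_ge_1[of "n + 2", where 'a = nat]
    by (cases "fact (n + 2) :: nat") auto
  have m3: "m = 3 * t + 2" unfolding m_def t by simp
  have m: "m mod 3 = 2" "m > 0" unfolding m3 by presburger+
  have big: "q > n" if "Factorial_Ring.prime q" "q dvd m" for q
  proof (rule ccontr)
    assume "\<not> q > n"
    then have "q dvd fact (n + 2)" using that(1) prime_dvd_fact_iff[of q] by simp
    then have "q dvd 3 * fact (n + 2)" by (rule dvd_mult)
    moreover have "3 * fact (n + 2) = m + 1" unfolding m3 t by simp
    ultimately have "q dvd 1" using that(2) by (metis dvd_add_right_iff)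
    then show False using that(1) by simp
  qed
  have mod1: "q mod 3 = 1" if q: "Factorial_Ring.prime q" "q dvd m" for q
  proof -
    have "q mod 3 \<noteq> 2" using no big[OF q] q by blast
    moreover have "q mod 3 \<noteq> 0"
    proof
      assume "q mod 3 = 0"
      then have "3 dvd m" using q(2) dvd_trans by (metis mod_0_imp_dvd)
      then show False using m by presburger
    qed
    ultimately show ?thesis by presburger
  qed
  have "k mod 3 = 1" if "k dvd m" for k
    using that
  proof (induction k rule: prime_divisors_induct)
    case zero then show ?case using m by simp
  next
    case (unit x) then show ?case by simp
  next
    case (factor q x)
    then have "q mod 3 = 1" "x mod 3 = 1" using mod1 by (auto dest: dvd_mult_left dvd_mult_right)
    moreover have "q * x mod 3 = (q mod 3) * (x mod 3) mod 3" by (rule mod_mult_eq[symmetric])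
    ultimately show ?case by simp
  qed
  then show False using m by force
qed

text \<open>The bound on the order yields infinitely many orders, hence infinitely many isomorphism
  types. It is met by choosing \<open>p\<close> larger than \<open>n\<close>.\<close>

lemma nat_group_large:
  "\<exists>K :: nat monoid. simple_group K \<and> finite (carrier K) \<and>
    base_number K < regularity_number K \<and> order K > n"
proof -
  obtain p where p: "Factorial_Ring.prime p" "p mod 3 = 2" "p > max 200 n"
    using infinitely_many_primes_2_mod_3 by blast
  interpret prime_ideal_2_mod_3 "residue_unit p" p
    by (intro prime_ideal_2_mod_3.intro prime_ideal_2_mod_3_axioms.intro residue_prime_ideal)
      (use p in auto)
  obtain K :: "nat monoid" and f where K: "group K" "f \<in> iso SL K"
    using SL.nat_copy[OF finite_SL] by blast
  interpret K: group K by fact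
  have bij: "bij_betw f (carrier SL) (carrier K)" using K(2) unfolding iso_def by simp
  have fin: "finite (carrier K)" using bij finite_SL bij_betw_finite by blast
  have g: "inv_into (carrier SL) f \<in> iso K SL" using SL.iso_set_sym[OF K(2)] .
  have "base_number K \<le> 4" using K.base_number_iso_le[OF SL.group_axioms g fin]
    base_number_SL by simp
  moreover have "4 < regularity_number K"
    using SL.regularity_number_iso_le[OF K finite_SL] regularity_number_SL by simp
  moreover have "simple_group K" using simple_group.iso_simple[OF simple_SL K] .
  moreover have "order K > n"
  proof -
    have "n < p ^ 1 * 1" using p by simp
    also have "\<dots> \<le> p ^ 6 * (p - 1) ^ 2" using p
      by (intro mult_le_mono power_increasing) auto
    also have "\<dots> \<le> order SL" by (rule order_SL_ge)
    also have "\<dots> = order K" unfolding order_def using bij by (rule bij_betw_same_card)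
    finally show ?thesis .
  qed
  ultimately show ?thesis using fin by (intro exI[of _ K]) simp
qed

theorem proposition2p12:
  shows "\<exists>\<G> :: nat monoid set.
    infinite \<G> \<and>
    pairwise (\<lambda>G H. \<not> G \<cong> H) \<G> \<and>
    (\<forall>G\<in>\<G>. simple_group G \<and> finite (carrier G) \<and>
      base_number G < regularity_number G)"
proof -
  define P where "P G \<longleftrightarrow> simple_group G \<and> finite (carrier G) \<and>
    base_number G < regularity_number G" for G :: "nat monoid"
  define D where "D = order ` {G. P G}"
  \<comment> \<open>One group for each order that occurs: distinct chosen groups have distinct
    orders and are not isomorphic.\<close>
  define rep where "rep k = (SOME G. P G \<and> order G = k)" for k
  have rep: "P (rep k)" "order (rep k) = k" if "k \<in> D" for k
    using someI_ex[of "\<lambda>G. P G \<and> order G = k"] that unfolding D_def rep_def by auto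
  have "\<exists>k>n. k \<in> D" for n using nat_group_large[of n] unfolding D_def P_def by blast
  then have "infinite D" using infinite_nat_iff_unbounded by blast
  moreover have "inj_on rep D" by (rule inj_on_inverseI[of _ order]) (rule rep)
  ultimately have inf: "infinite (rep ` D)" using finite_imageD by blast
  have "pairwise (\<lambda>G H. \<not> G \<cong> H) (rep ` D)"
  proof (rule pairwiseI)
    fix G H assume GH: "G \<in> rep ` D" "H \<in> rep ` D" "G \<noteq> H"
    then obtain j k where jk: "j \<in> D" "k \<in> D" "G = rep j" "H = rep k" by blast
    show "\<not> G \<cong> H"
    proof
      assume "G \<cong> H"
      then have "order G = order H" unfolding is_iso_def iso_def order_def
        using bij_betw_same_card by blast
      then show False using jk GH rep by metis
    qed
  qed
  moreover have "\<forall>G\<in>rep ` D. P G" using rep by blast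
  ultimately show ?thesis using inf unfolding P_def by blast
qed

end
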